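(* Let $\mathcal{C}$ be a small non-empty category satisfying the amalgamation property and the joint embedding property, and let $u$ be a $\mathcal{C}$-universal and $\mathcal{C}$-ultrahomogeneous object of $\mathrm{Ind}\text{-}\mathcal{C}$. Then the collection $\mathcal{I}_{\mathcal{C}}$ of sets of the form $\mathcal{I}_{\chi}:=\{f:u\cong u \mid f\circ\chi=\chi\}$, for an arrow $\chi:c\to u$ from an object $c$ of $\mathcal{C}$ to $u$, is an algebraic base for the group of automorphisms of $u$ in $\mathrm{Ind}\text{-}\mathcal{C}$; and, denoting by $Aut_{\mathcal{C}}(u)$ the resulting topological group, there is an equivalence of toposes $$\mathbf{Sh}(\mathcal{C}^{\mathrm{op}},J_{at})\simeq\mathbf{Cont}(Aut_{\mathcal{C}}(u))$$ induced by the functor $F:\mathcal{C}^{\mathrm{op}}\to\mathbf{Cont}_t(Aut_{\mathcal{C}}(u))$ which sends any object $c$ of $\mathcal{C}$ to the set $\mathrm{Hom}_{\mathrm{Ind}\text{-}\mathcal{C}}(c,u)$ (with the obvious action of $Aut_{\mathcal{C}}(u)$) and any arrow $f:c\to d$ in $\mathcal{C}$ to the $Aut_{\mathcal{C}}(u)$-equivariant map $-\circ f:\mathrm{Hom}_{\mathrm{Ind}\text{-}\mathcal{C}}(d,u)\to\mathrm{Hom}_{\mathrm{Ind}\text{-}\mathcal{C}}(c,u)$.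
   Context: $\mathrm{Ind}\text{-}\mathcal{C}$ is the ind-completion of $\mathcal{C}$, with the canonical full embedding $\mathcal{C}\hookrightarrow\mathrm{Ind}\text{-}\mathcal{C}$. $\mathcal{C}$ satisfies the amalgamation property (AP) if for all $f:a\to b$, $g:a\to c$ in $\mathcal{C}$ there are $f':b\to d$, $g':c\to d$ in $\mathcal{C}$ with $f'\circ f=g'\circ g$; it satisfies the joint embedding property (JEP) if for any objects $a,b$ there are an object $c$ and arrows $a\to c$, $b\to c$ in $\mathcal{C}$. For a full embedding $\mathcal{C}\hookrightarrow\mathcal{D}$, an object $u$ of $\mathcal{D}$ is $\mathcal{C}$-universal if every object $a$ of $\mathcal{C}$ admits an arrow $a\to u$ in $\mathcal{D}$; it is $\mathcal{C}$-ultrahomogeneous if for every arrow $j:a\to b$ in $\mathcal{C}$ and arrows $\chi_1:a\to u$, $\chi_2:b\to u$ in $\mathcal{D}$ there is an automorphism $\check{j}:u\to u$ in $\mathcal{D}$ with $\check{j}\circ\chi_1=\chi_2\circ j$. $J_{at}$ is the atomic topology (covering sieves are exactly the non-empty ones), which is a Grothendieck topology on $\mathcal{C}^{\mathrm{op}}$ by AP. An algebraic base for a group $G$ is a (non-empty) collection of subgroups such that the intersection of any two members contains a member, and every conjugate of a member is a member; it generates a unique group topology having it as a neighbourhood basis of the identity. For a topological group $G$, $\mathbf{Cont}(G)$ is the topos of continuous left $G$-actions on discrete sets and equivariant maps, and $\mathbf{Cont}_t(G)$ its full subcategory on the non-empty transitive actions. *)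

theory Defs
  imports "HOL-Algebra.Group_Action" "HOL-Analysis.Product_Topology" "HOL-Library.Equipollence"
begin

section \<open>Small sets\<close>

text \<open>
  A universe is a family of sets of elements of \<^typ>\<open>'v\<close>, to be read as the small ones. The conditions
  say that these are the sets of fewer than \<open>\<kappa>\<close> elements of \<^typ>\<open>'v\<close>, for some regular uncountable
  \<open>\<kappa>\<close>. Grothendieck universes are the case of \<open>\<kappa>\<close> inaccessible; power sets are not demanded, so that
  there are also instances in HOL itself, such as all subsets of an infinite type.
\<close>

definition universe :: "'v set set \<Rightarrow> bool" where
  "universe \<U> \<longleftrightarrow>
     (\<forall>A\<in>\<U>. \<forall>B. B \<lesssim> A \<longrightarrow> B \<in> \<U>) \<and>
     (\<forall>I\<in>\<U>. \<forall>A :: 'v \<Rightarrow> 'v set. (\<forall>i\<in>I. A i \<in> \<U>) \<longrightarrow> (\<Union>i\<in>I. A i) \<in> \<U>) \<and>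
     (\<exists>A\<in>\<U>. infinite A)"

lemma universe_UNIV: "infinite (UNIV :: 'v set) \<Longrightarrow> universe (UNIV :: 'v set set)"
  unfolding universe_def by blast

text \<open>Smallness for sets over any other type.\<close>

definition small :: "'v set set \<Rightarrow> 'a set \<Rightarrow> bool" where
  "small \<U> A \<longleftrightarrow> (\<exists>B\<in>\<U>. A \<lesssim> B)"


section \<open>Categories and functors\<close>

record ('o, 'm) cat =
  obj :: "'o set"
  arr :: "'m set"
  src :: "'m \<Rightarrow> 'o"
  trg :: "'m \<Rightarrow> 'o"
  ide :: "'o \<Rightarrow> 'm"
  cmp :: "'m \<Rightarrow> 'm \<Rightarrow> 'm"  \<comment> \<open>\<open>cmp C g f\<close> is \<open>g \<circ> f\<close>\<close>

definition homs :: "('o, 'm) cat \<Rightarrow> 'o \<Rightarrow> 'o \<Rightarrow> 'm set" where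
  "homs C a b = {f \<in> arr C. src C f = a \<and> trg C f = b}"

locale category =
  fixes C :: "('o, 'm) cat"
  assumes src_obj: "f \<in> arr C \<Longrightarrow> src C f \<in> obj C"
    and trg_obj: "f \<in> arr C \<Longrightarrow> trg C f \<in> obj C"
    and ide_homs: "a \<in> obj C \<Longrightarrow> ide C a \<in> homs C a a"
    and cmp_homs: "\<lbrakk>f \<in> homs C a b; g \<in> homs C b c\<rbrakk> \<Longrightarrow> cmp C g f \<in> homs C a c"
    and cmp_ide_left: "f \<in> homs C a b \<Longrightarrow> cmp C (ide C b) f = f"
    and cmp_ide_right: "f \<in> homs C a b \<Longrightarrow> cmp C f (ide C a) = f"
    and cmp_assoc: "\<lbrakk>f \<in> homs C a b; g \<in> homs C b c; h \<in> homs C c d\<rbrakk>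
      \<Longrightarrow> cmp C h (cmp C g f) = cmp C (cmp C h g) f"

definition opp :: "('o, 'm) cat \<Rightarrow> ('o, 'm) cat" where
  "opp C = \<lparr>obj = obj C, arr = arr C, src = trg C, trg = src C, ide = ide C,
            cmp = (\<lambda>g f. cmp C f g)\<rparr>"

lemma opp_opp [simp]: "opp (opp C) = C"
  by (simp add: opp_def)

definition full_sub :: "('o, 'm) cat \<Rightarrow> 'o set \<Rightarrow> ('o, 'm) cat" where
  "full_sub C X = C\<lparr>obj := obj C \<inter> X, arr := {f \<in> arr C. src C f \<in> X \<and> trg C f \<in> X}\<rparr>"

definition iso :: "('o, 'm) cat \<Rightarrow> 'o \<Rightarrow> 'o \<Rightarrow> 'm set" where
  "iso C a b = {f \<in> homs C a b. \<exists>g\<in>homs C b a. cmp C g f = ide C a \<and> cmp C f g = ide C b}"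

definition isomorphic :: "('o, 'm) cat \<Rightarrow> 'o \<Rightarrow> 'o \<Rightarrow> bool" where
  "isomorphic C a b \<longleftrightarrow> a \<in> obj C \<and> b \<in> obj C \<and> iso C a b \<noteq> {}"

record ('o, 'm, 'p, 'n) ftor =
  fob :: "'o \<Rightarrow> 'p"
  far :: "'m \<Rightarrow> 'n"

locale is_functor = A: category A + B: category B
  for A :: "('o, 'm) cat" and B :: "('p, 'n) cat" +
  fixes F :: "('o, 'm, 'p, 'n) ftor"
  assumes fob_ext: "fob F \<in> extensional (obj A)"
    and far_ext: "far F \<in> extensional (arr A)"
    and fob_obj: "a \<in> obj A \<Longrightarrow> fob F a \<in> obj B"
    and far_homs: "f \<in> homs A a b \<Longrightarrow> far F f \<in> homs B (fob F a) (fob F b)"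
    and far_ide: "a \<in> obj A \<Longrightarrow> far F (ide A a) = ide B (fob F a)"
    and far_cmp: "\<lbrakk>f \<in> homs A a b; g \<in> homs A b c\<rbrakk>
      \<Longrightarrow> far F (cmp A g f) = cmp B (far F g) (far F f)"

definition id_ftor :: "('o, 'm) cat \<Rightarrow> ('o, 'm, 'o, 'm) ftor" where
  "id_ftor A = \<lparr>fob = (\<lambda>a\<in>obj A. a), far = (\<lambda>f\<in>arr A. f)\<rparr>"

text \<open>\<open>comp_ftor A G F\<close> is \<open>G \<circ> F\<close>, where \<open>A\<close> is the domain of \<open>F\<close>.\<close>

definition comp_ftor ::
    "('o, 'm) cat \<Rightarrow> ('p, 'n, 'q, 'k) ftor \<Rightarrow> ('o, 'm, 'p, 'n) ftor \<Rightarrow> ('o, 'm, 'q, 'k) ftor" where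
  "comp_ftor A G F = \<lparr>fob = (\<lambda>a\<in>obj A. fob G (fob F a)), far = (\<lambda>f\<in>arr A. far G (far F f))\<rparr>"

text \<open>The category of functors \<open>A \<rightarrow> B\<close>; an arrow \<open>F \<rightarrow> G\<close> is a triple of \<open>F\<close>, \<open>G\<close> and the family of
  components.\<close>

type_synonym ('o, 'm, 'p, 'n) ntrans =
  "('o, 'm, 'p, 'n) ftor \<times> ('o, 'm, 'p, 'n) ftor \<times> ('o \<Rightarrow> 'n)"

definition nat_trans :: "('o, 'm) cat \<Rightarrow> ('p, 'n) cat \<Rightarrow>
    ('o, 'm, 'p, 'n) ftor \<Rightarrow> ('o, 'm, 'p, 'n) ftor \<Rightarrow> ('o \<Rightarrow> 'n) \<Rightarrow> bool" where
  "nat_trans A B F G \<tau> \<longleftrightarrow>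
     is_functor A B F \<and> is_functor A B G \<and> \<tau> \<in> extensional (obj A) \<and>
     (\<forall>a\<in>obj A. \<tau> a \<in> homs B (fob F a) (fob G a)) \<and>
     (\<forall>f\<in>arr A. cmp B (\<tau> (trg A f)) (far F f) = cmp B (far G f) (\<tau> (src A f)))"

definition Fun :: "('o, 'm) cat \<Rightarrow> ('p, 'n) cat \<Rightarrow>
    (('o, 'm, 'p, 'n) ftor, ('o, 'm, 'p, 'n) ntrans) cat" where
  "Fun A B =
     \<lparr>obj = {F. is_functor A B F},
      arr = {(F, G, \<tau>). nat_trans A B F G \<tau>},
      src = (\<lambda>(F, G, \<tau>). F),
      trg = (\<lambda>(F, G, \<tau>). G),
      ide = (\<lambda>F. (F, F, \<lambda>a\<in>obj A. ide B (fob F a))),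
      cmp = (\<lambda>(G', H, \<sigma>) (F, G, \<tau>). (F, H, \<lambda>a\<in>obj A. cmp B (\<sigma> a) (\<tau> a)))\<rparr>"

definition is_equivalence :: "('o, 'm) cat \<Rightarrow> ('p, 'n) cat \<Rightarrow> ('o, 'm, 'p, 'n) ftor \<Rightarrow> bool" where
  "is_equivalence A B F \<longleftrightarrow>
     is_functor A B F \<and>
     (\<exists>G. is_functor B A G \<and>
          isomorphic (Fun A A) (id_ftor A) (comp_ftor A G F) \<and>
          isomorphic (Fun B B) (comp_ftor B F G) (id_ftor B))"


section \<open>Sets, presheaves and the Yoneda embedding\<close>

text \<open>The category of small sets of elements of a type \<^typ>\<open>'a\<close>. As soon as \<^typ>\<open>'v\<close> embeds into
  \<^typ>\<open>'a\<close>, it contains a copy of every member of \<open>\<U>\<close>, so that up to equivalence it does not depend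
  on \<^typ>\<open>'a\<close>. Below, hom-sets are used as values of functors as they are, which determines \<^typ>\<open>'a\<close>.\<close>

type_synonym 'a sarr = "'a set \<times> 'a set \<times> ('a \<Rightarrow> 'a)"

definition SetC :: "'v set set \<Rightarrow> ('a set, 'a sarr) cat" where
  "SetC \<U> =
     \<lparr>obj = {X. small \<U> X},
      arr = {(X, Y, f). small \<U> X \<and> small \<U> Y \<and> f \<in> X \<rightarrow>\<^sub>E Y},
      src = (\<lambda>(X, Y, f). X),
      trg = (\<lambda>(X, Y, f). Y),
      ide = (\<lambda>X. (X, X, \<lambda>x\<in>X. x)),
      cmp = (\<lambda>(Y', Z, g) (X, Y, f). (X, Z, \<lambda>x\<in>X. g (f x)))\<rparr>"

definition app :: "'a sarr \<Rightarrow> 'a \<Rightarrow> 'a" where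
  "app t x = snd (snd t) x"

definition PSh :: "'v set set \<Rightarrow> ('o, 'm) cat \<Rightarrow>
    (('o, 'm, 'a set, 'a sarr) ftor, ('o, 'm, 'a set, 'a sarr) ntrans) cat" where
  "PSh \<U> A = Fun (opp A) (SetC \<U>)"

text \<open>For a functor \<open>F: A \<rightarrow> B\<close>, the functor \<open>B \<rightarrow> [A\<^sup>o\<^sup>p, Set]\<close> sending \<open>X\<close> to \<open>Hom\<^sub>B(F -, X)\<close>. If \<open>A\<close> is a
  site and \<open>B\<close> a topos, this is the direct image of the geometric morphism \<open>B \<rightarrow> Sh(A)\<close> induced by
  \<open>F\<close>; its left adjoint, the inverse image, takes the sheaf associated with \<open>Hom\<^sub>A(-, a)\<close> to \<open>F a\<close>.\<close>

definition hom_presheaf ::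
    "('o, 'm) cat \<Rightarrow> ('p, 'n) cat \<Rightarrow> ('o, 'm, 'p, 'n) ftor \<Rightarrow> 'p \<Rightarrow> ('o, 'm, 'n set, 'n sarr) ftor" where
  "hom_presheaf A B F X =
     \<lparr>fob = (\<lambda>a\<in>obj A. homs B (fob F a) X),
      far = (\<lambda>f\<in>arr A.
        (homs B (fob F (trg A f)) X, homs B (fob F (src A f)) X,
         \<lambda>h\<in>homs B (fob F (trg A f)) X. cmp B h (far F f)))\<rparr>"

definition hom_functor :: "('o, 'm) cat \<Rightarrow> ('p, 'n) cat \<Rightarrow> ('o, 'm, 'p, 'n) ftor \<Rightarrow>
    ('p, 'n, ('o, 'm, 'n set, 'n sarr) ftor, ('o, 'm, 'n set, 'n sarr) ntrans) ftor" where
  "hom_functor A B F =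
     \<lparr>fob = (\<lambda>X\<in>obj B. hom_presheaf A B F X),
      far = (\<lambda>g\<in>arr B.
        (hom_presheaf A B F (src B g), hom_presheaf A B F (trg B g),
         \<lambda>a\<in>obj A. (homs B (fob F a) (src B g), homs B (fob F a) (trg B g),
                     \<lambda>h\<in>homs B (fob F a) (src B g). cmp B g h)))\<rparr>"

definition yoneda :: "('o, 'm) cat \<Rightarrow>
    ('o, 'm, ('o, 'm, 'm set, 'm sarr) ftor, ('o, 'm, 'm set, 'm sarr) ntrans) ftor" where
  "yoneda C = hom_functor C C (id_ftor C)"


section \<open>Ind-completion\<close>

definition filtered :: "('o, 'm) cat \<Rightarrow> bool" where
  "filtered I \<longleftrightarrow>
     obj I \<noteq> {} \<and>
     (\<forall>i\<in>obj I. \<forall>j\<in>obj I. \<exists>k\<in>obj I. homs I i k \<noteq> {} \<and> homs I j k \<noteq> {}) \<and>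
     (\<forall>i\<in>obj I. \<forall>j\<in>obj I. \<forall>f\<in>homs I i j. \<forall>g\<in>homs I i j.
        \<exists>k\<in>obj I. \<exists>h\<in>homs I j k. cmp I h f = cmp I h g)"

definition is_cocone ::
    "('i, 'j) cat \<Rightarrow> ('o, 'm) cat \<Rightarrow> ('i, 'j, 'o, 'm) ftor \<Rightarrow> 'o \<Rightarrow> ('i \<Rightarrow> 'm) \<Rightarrow> bool" where
  "is_cocone I A D x \<tau> \<longleftrightarrow>
     x \<in> obj A \<and> (\<forall>i\<in>obj I. \<tau> i \<in> homs A (fob D i) x) \<and>
     (\<forall>f\<in>arr I. cmp A (\<tau> (trg I f)) (far D f) = \<tau> (src I f))"

definition is_colimit ::
    "('i, 'j) cat \<Rightarrow> ('o, 'm) cat \<Rightarrow> ('i, 'j, 'o, 'm) ftor \<Rightarrow> 'o \<Rightarrow> ('i \<Rightarrow> 'm) \<Rightarrow> bool" where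
  "is_colimit I A D x \<tau> \<longleftrightarrow>
     is_functor I A D \<and> is_cocone I A D x \<tau> \<and>
     (\<forall>z \<sigma>. is_cocone I A D z \<sigma> \<longrightarrow>
        (\<exists>!h. h \<in> homs A x z \<and> (\<forall>i\<in>obj I. cmp A h (\<tau> i) = \<sigma> i)))"

text \<open>The full subcategory of \<open>[C\<^sup>o\<^sup>p, Set]\<close> on the colimits of small filtered diagrams of
  representables; \<^const>\<open>yoneda\<close> is the canonical embedding of \<open>C\<close> into it.\<close>

definition Ind :: "'v set set \<Rightarrow> ('v, 'v) cat \<Rightarrow>
    (('v, 'v, 'v set, 'v sarr) ftor, ('v, 'v, 'v set, 'v sarr) ntrans) cat" where
  "Ind \<U> C = full_sub (PSh \<U> C)
     {P. \<exists>(I :: ('v, 'v) cat) D \<tau>.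
           category I \<and> obj I \<in> \<U> \<and> arr I \<in> \<U> \<and> filtered I \<and> is_functor I C D \<and>
           is_colimit I (PSh \<U> C) (comp_ftor I (yoneda C) D) P \<tau>}"


section \<open>Amalgamation, joint embedding, homogeneity\<close>

definition AP :: "('o, 'm) cat \<Rightarrow> bool" where
  "AP C \<longleftrightarrow>
     (\<forall>a\<in>obj C. \<forall>b\<in>obj C. \<forall>c\<in>obj C. \<forall>f\<in>homs C a b. \<forall>g\<in>homs C a c.
        \<exists>d\<in>obj C. \<exists>f'\<in>homs C b d. \<exists>g'\<in>homs C c d. cmp C f' f = cmp C g' g)"

definition JEP :: "('o, 'm) cat \<Rightarrow> bool" where
  "JEP C \<longleftrightarrow> (\<forall>a\<in>obj C. \<forall>b\<in>obj C. \<exists>c\<in>obj C. homs C a c \<noteq> {} \<and> homs C b c \<noteq> {})"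

definition universal_obj ::
    "('o, 'm) cat \<Rightarrow> ('p, 'n) cat \<Rightarrow> ('o, 'm, 'p, 'n) ftor \<Rightarrow> 'p \<Rightarrow> bool" where
  "universal_obj C D E u \<longleftrightarrow> u \<in> obj D \<and> (\<forall>a\<in>obj C. homs D (fob E a) u \<noteq> {})"

definition ultrahomogeneous ::
    "('o, 'm) cat \<Rightarrow> ('p, 'n) cat \<Rightarrow> ('o, 'm, 'p, 'n) ftor \<Rightarrow> 'p \<Rightarrow> bool" where
  "ultrahomogeneous C D E u \<longleftrightarrow>
     u \<in> obj D \<and>
     (\<forall>a\<in>obj C. \<forall>b\<in>obj C. \<forall>j\<in>homs C a b.
        \<forall>\<chi>\<^sub>1\<in>homs D (fob E a) u. \<forall>\<chi>\<^sub>2\<in>homs D (fob E b) u.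
        \<exists>j'\<in>iso D u u. cmp D j' \<chi>\<^sub>1 = cmp D \<chi>\<^sub>2 (far E j))"


section \<open>Sheaves\<close>

definition sieve :: "('o, 'm) cat \<Rightarrow> 'o \<Rightarrow> 'm set \<Rightarrow> bool" where
  "sieve A c S \<longleftrightarrow> S \<subseteq> {f \<in> arr A. trg A f = c} \<and>
     (\<forall>f\<in>S. \<forall>g\<in>arr A. trg A g = src A f \<longrightarrow> cmp A f g \<in> S)"

definition pullback_sieve :: "('o, 'm) cat \<Rightarrow> 'm \<Rightarrow> 'm set \<Rightarrow> 'm set" where
  "pullback_sieve A h S = {g \<in> arr A. trg A g = src A h \<and> cmp A h g \<in> S}"

definition grothendieck_topology :: "('o, 'm) cat \<Rightarrow> ('o \<Rightarrow> 'm set set) \<Rightarrow> bool" where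
  "grothendieck_topology A J \<longleftrightarrow>
     (\<forall>c\<in>obj A. \<forall>S\<in>J c. sieve A c S) \<and>
     (\<forall>c\<in>obj A. {f \<in> arr A. trg A f = c} \<in> J c) \<and>
     (\<forall>h\<in>arr A. \<forall>S\<in>J (trg A h). pullback_sieve A h S \<in> J (src A h)) \<and>
     (\<forall>c\<in>obj A. \<forall>S\<in>J c. \<forall>R. sieve A c R \<and> (\<forall>h\<in>S. pullback_sieve A h R \<in> J (src A h)) \<longrightarrow> R \<in> J c)"

definition atomic_topology :: "('o, 'm) cat \<Rightarrow> 'o \<Rightarrow> 'm set set" where
  "atomic_topology A c = {S. sieve A c S \<and> S \<noteq> {}}"

lemma grothendieck_topology_atomic:
  assumes "category C" "AP C"
  shows "grothendieck_topology (opp C) (atomic_topology (opp C))"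
proof -
  interpret category C by fact
  have pull: "pullback_sieve (opp C) h S \<in> atomic_topology (opp C) (src (opp C) h)"
    if h: "h \<in> arr C" and S: "S \<in> atomic_topology (opp C) (trg (opp C) h)" for h S
  proof -
    have "sieve (opp C) (src (opp C) h) (pullback_sieve (opp C) h S)"
      using h S cmp_homs cmp_assoc
      unfolding sieve_def pullback_sieve_def atomic_topology_def opp_def homs_def
      by (auto; metis)
    moreover obtain f where f: "f \<in> S" "f \<in> homs C (src C h) (trg C f)"
      using S by (auto simp: atomic_topology_def sieve_def opp_def homs_def)
    moreover have h': "h \<in> homs C (src C h) (trg C h)" using h by (simp add: homs_def)
    moreover obtain d f' h'' where "f' \<in> homs C (trg C f) d" "h'' \<in> homs C (trg C h) d"
      "cmp C f' f = cmp C h'' h"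
      using \<open>AP C\<close> f h' src_obj[of h] trg_obj[of h] trg_obj[of f] unfolding AP_def homs_def by blast
    ultimately have "h'' \<in> pullback_sieve (opp C) h S"
      using S by (auto simp: pullback_sieve_def opp_def homs_def atomic_topology_def sieve_def) metis
    with \<open>sieve _ _ _\<close> show ?thesis by (auto simp: atomic_topology_def)
  qed
  have max: "{f \<in> arr (opp C). trg (opp C) f = c} \<in> atomic_topology (opp C) c" if "c \<in> obj C" for c
  proof -
    have "ide C c \<in> {f \<in> arr (opp C). trg (opp C) f = c}"
      using ide_homs[OF that] by (simp add: homs_def opp_def)
    moreover have "sieve (opp C) c {f \<in> arr (opp C). trg (opp C) f = c}"
      using cmp_homs by (auto simp: sieve_def opp_def homs_def)
    ultimately show ?thesis by (auto simp: atomic_topology_def)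
  qed
  have loc: "R \<in> atomic_topology (opp C) c"
    if "S \<in> atomic_topology (opp C) c" "sieve (opp C) c R"
      "\<forall>h\<in>S. pullback_sieve (opp C) h R \<in> atomic_topology (opp C) (src (opp C) h)" for c S R
    using that unfolding atomic_topology_def pullback_sieve_def by blast
  show ?thesis
    unfolding grothendieck_topology_def
    using pull max loc by (auto simp: opp_def[of C]) (simp_all add: atomic_topology_def)
qed

definition is_sheaf :: "('o, 'm) cat \<Rightarrow> ('o \<Rightarrow> 'm set set) \<Rightarrow> ('o, 'm, 'a set, 'a sarr) ftor \<Rightarrow> bool" where
  "is_sheaf A J P \<longleftrightarrow>
     (\<forall>c\<in>obj A. \<forall>S\<in>J c. \<forall>x.
        (\<forall>f\<in>S. x f \<in> fob P (src A f)) \<and>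
        (\<forall>f\<in>S. \<forall>g\<in>arr A. trg A g = src A f \<longrightarrow> app (far P g) (x f) = x (cmp A f g)) \<longrightarrow>
        (\<exists>!p. p \<in> fob P c \<and> (\<forall>f\<in>S. app (far P f) p = x f)))"

definition Sh :: "'v set set \<Rightarrow> ('o, 'm) cat \<Rightarrow> ('o \<Rightarrow> 'm set set) \<Rightarrow>
    (('o, 'm, 'a set, 'a sarr) ftor, ('o, 'm, 'a set, 'a sarr) ntrans) cat" where
  "Sh \<U> A J = full_sub (PSh \<U> A) {P. is_sheaf A J P}"


section \<open>Topological groups and continuous actions\<close>

definition algebraic_base :: "('g, 'z) monoid_scheme \<Rightarrow> 'g set set \<Rightarrow> bool" where
  "algebraic_base G B \<longleftrightarrow>
     group G \<and> B \<noteq> {} \<and> (\<forall>H\<in>B. subgroup H G) \<and>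
     (\<forall>H\<in>B. \<forall>K\<in>B. \<exists>L\<in>B. L \<subseteq> H \<inter> K) \<and>
     (\<forall>g\<in>carrier G. \<forall>H\<in>B. g <#\<^bsub>G\<^esub> H #>\<^bsub>G\<^esub> inv\<^bsub>G\<^esub> g \<in> B)"

definition topological_group :: "('g, 'z) monoid_scheme \<Rightarrow> 'g topology \<Rightarrow> bool" where
  "topological_group G T \<longleftrightarrow>
     group G \<and> topspace T = carrier G \<and>
     continuous_map (prod_topology T T) T (\<lambda>(x, y). x \<otimes>\<^bsub>G\<^esub> y) \<and>
     continuous_map T T (\<lambda>x. inv\<^bsub>G\<^esub> x)"

definition nhds_basis :: "'g topology \<Rightarrow> 'g \<Rightarrow> 'g set set \<Rightarrow> bool" where
  "nhds_basis T x B \<longleftrightarrow>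
     (\<forall>H\<in>B. \<exists>U. openin T U \<and> x \<in> U \<and> U \<subseteq> H) \<and>
     (\<forall>U. openin T U \<and> x \<in> U \<longrightarrow> (\<exists>H\<in>B. H \<subseteq> U))"

lemma base_topology_ex1:
  assumes "algebraic_base G B"
  shows "\<exists>!T. topological_group G T \<and> nhds_basis T \<one>\<^bsub>G\<^esub> B"
proof -
  interpret group G using assms by (simp add: algebraic_base_def)
  have ne: "B \<noteq> {}" and sg: "\<And>H. H \<in> B \<Longrightarrow> subgroup H G"
    and int: "\<And>H K. H \<in> B \<Longrightarrow> K \<in> B \<Longrightarrow> \<exists>L\<in>B. L \<subseteq> H \<inter> K"
    and cj: "\<And>g H. g \<in> carrier G \<Longrightarrow> H \<in> B \<Longrightarrow> g <#\<^bsub>G\<^esub> H #>\<^bsub>G\<^esub> inv\<^bsub>G\<^esub> g \<in> B"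
    using assms by (auto simp: algebraic_base_def)
  note sgc = subgroup.mem_carrier[OF sg] subgroup.one_closed[OF sg]
    subgroup.m_closed[OF sg] subgroup.m_inv_closed[OF sg]
  define Op where "Op = (\<lambda>U. U \<subseteq> carrier G \<and> (\<forall>x\<in>U. \<exists>H\<in>B. \<forall>h\<in>H. x \<otimes>\<^bsub>G\<^esub> h \<in> U))"
  have Op_int: "Op (U \<inter> V)" if "Op U" "Op V" for U V
    unfolding Op_def
  proof (intro conjI ballI)
    show "U \<inter> V \<subseteq> carrier G" using that unfolding Op_def by blast
    fix x assume "x \<in> U \<inter> V"
    then obtain H K where "H \<in> B" "K \<in> B" "\<forall>h\<in>H. x \<otimes>\<^bsub>G\<^esub> h \<in> U" "\<forall>h\<in>K. x \<otimes>\<^bsub>G\<^esub> h \<in> V"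
      using \<open>Op U\<close> \<open>Op V\<close> unfolding Op_def by blast
    then show "\<exists>L\<in>B. \<forall>h\<in>L. x \<otimes>\<^bsub>G\<^esub> h \<in> U \<inter> V" using int[of H K] by blast
  qed
  have Op_Un: "Op (\<Union>\<K>)" if op: "\<forall>K\<in>\<K>. Op K" for \<K>
    unfolding Op_def
  proof (intro conjI ballI)
    show "\<Union>\<K> \<subseteq> carrier G" using that unfolding Op_def by blast
    fix x assume "x \<in> \<Union>\<K>"
    then obtain K where K: "K \<in> \<K>" "x \<in> K" by blast
    then obtain H where "H \<in> B" "\<forall>h\<in>H. x \<otimes>\<^bsub>G\<^esub> h \<in> K" using op unfolding Op_def by blast
    then show "\<exists>H\<in>B. \<forall>h\<in>H. x \<otimes>\<^bsub>G\<^esub> h \<in> \<Union>\<K>" using K by blast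
  qed
  define T where "T = topology Op"
  have "istopology Op" using Op_int Op_Un by (simp add: istopology_def)
  then have oT: "openin T U \<longleftrightarrow> Op U" for U by (simp add: T_def topology_inverse')
  obtain H0 where H0: "H0 \<in> B" using ne by blast
  then have "Op (carrier G)" unfolding Op_def using sgc(1)[OF H0] by blast
  then have ts: "topspace T = carrier G"
    unfolding topspace_def oT unfolding Op_def by blast
  have coset: "Op ((\<lambda>h. x \<otimes>\<^bsub>G\<^esub> h) ` H)" if "x \<in> carrier G" "H \<in> B" for x H
    unfolding Op_def
  proof (intro conjI ballI)
    show "(\<lambda>h. x \<otimes>\<^bsub>G\<^esub> h) ` H \<subseteq> carrier G" using that(1) sgc(1)[OF that(2)] by auto
    fix y assume "y \<in> (\<lambda>h. x \<otimes>\<^bsub>G\<^esub> h) ` H"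
    then obtain k where k: "k \<in> H" "y = x \<otimes>\<^bsub>G\<^esub> k" by blast
    have "y \<otimes>\<^bsub>G\<^esub> h \<in> (\<lambda>h. x \<otimes>\<^bsub>G\<^esub> h) ` H" if h: "h \<in> H" for h
      using k h sgc(1)[OF \<open>H \<in> B\<close>] sgc(3)[OF \<open>H \<in> B\<close>] \<open>x \<in> carrier G\<close> by (simp add: m_assoc)
    then show "\<exists>K\<in>B. \<forall>h\<in>K. y \<otimes>\<^bsub>G\<^esub> h \<in> (\<lambda>h. x \<otimes>\<^bsub>G\<^esub> h) ` H"
      using \<open>H \<in> B\<close> by blast
  qed
  have nb: "nhds_basis T \<one>\<^bsub>G\<^esub> B" unfolding nhds_basis_def
  proof (intro conjI ballI allI impI)
    fix H assume H: "H \<in> B"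
    have "(\<lambda>h. \<one>\<^bsub>G\<^esub> \<otimes>\<^bsub>G\<^esub> h) ` H = H" using sgc(1)[OF H] by simp
    then have "Op H" using coset[OF one_closed H] by simp
    then show "\<exists>U. openin T U \<and> \<one>\<^bsub>G\<^esub> \<in> U \<and> U \<subseteq> H" using oT sgc(2)[OF H] by blast
  next
    fix U assume "openin T U \<and> \<one>\<^bsub>G\<^esub> \<in> U"
    then obtain H where "H \<in> B" "\<forall>h\<in>H. \<one>\<^bsub>G\<^esub> \<otimes>\<^bsub>G\<^esub> h \<in> U" unfolding oT Op_def by blast
    then show "\<exists>H\<in>B. H \<subseteq> U" using sgc(1)[OF \<open>H \<in> B\<close>] by (metis l_one subsetI)
  qed
  have conj_in: "\<exists>K\<in>B. \<forall>k\<in>K. inv\<^bsub>G\<^esub> y \<otimes>\<^bsub>G\<^esub> k \<otimes>\<^bsub>G\<^esub> y \<in> H"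
    if y: "y \<in> carrier G" and H: "H \<in> B" for y H
  proof (intro bexI ballI)
    show "y <#\<^bsub>G\<^esub> H #>\<^bsub>G\<^esub> inv\<^bsub>G\<^esub> y \<in> B" using cj[OF y H] .
    fix k assume "k \<in> y <#\<^bsub>G\<^esub> H #>\<^bsub>G\<^esub> inv\<^bsub>G\<^esub> y"
    then obtain h where h: "h \<in> H" "k = y \<otimes>\<^bsub>G\<^esub> h \<otimes>\<^bsub>G\<^esub> inv\<^bsub>G\<^esub> y" by (auto simp: l_coset_def r_coset_def)
    have hc: "h \<in> carrier G" using h sgc(1)[OF H] by blast
    have "inv\<^bsub>G\<^esub> y \<otimes>\<^bsub>G\<^esub> k \<otimes>\<^bsub>G\<^esub> y = (inv\<^bsub>G\<^esub> y \<otimes>\<^bsub>G\<^esub> y) \<otimes>\<^bsub>G\<^esub> h \<otimes>\<^bsub>G\<^esub> (inv\<^bsub>G\<^esub> y \<otimes>\<^bsub>G\<^esub> y)"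
      unfolding h(2) using y hc by (simp only: m_assoc inv_closed m_closed)
    then have "inv\<^bsub>G\<^esub> y \<otimes>\<^bsub>G\<^esub> k \<otimes>\<^bsub>G\<^esub> y = h" using y hc by simp
    then show "inv\<^bsub>G\<^esub> y \<otimes>\<^bsub>G\<^esub> k \<otimes>\<^bsub>G\<^esub> y \<in> H" using h by simp
  qed
  have cm: "continuous_map (prod_topology T T) T (\<lambda>(x, y). x \<otimes>\<^bsub>G\<^esub> y)"
    unfolding continuous_map_def
  proof (intro conjI allI impI)
    show "(\<lambda>(x, y). x \<otimes>\<^bsub>G\<^esub> y) \<in> topspace (prod_topology T T) \<rightarrow> topspace T" by (auto simp: ts)
    fix U assume U: "openin T U"
    show "openin (prod_topology T T) {p \<in> topspace (prod_topology T T). (case p of (x, y) \<Rightarrow> x \<otimes>\<^bsub>G\<^esub> y) \<in> U}"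
      unfolding openin_prod_topology_alt
    proof (intro allI impI)
      fix x y assume "(x, y) \<in> {p \<in> topspace (prod_topology T T). (case p of (x, y) \<Rightarrow> x \<otimes>\<^bsub>G\<^esub> y) \<in> U}"
      then have xy: "x \<in> carrier G" "y \<in> carrier G" "x \<otimes>\<^bsub>G\<^esub> y \<in> U" by (auto simp: ts)
      then obtain H where H: "H \<in> B" "\<forall>h\<in>H. x \<otimes>\<^bsub>G\<^esub> y \<otimes>\<^bsub>G\<^esub> h \<in> U" using U unfolding oT Op_def by blast
      obtain K where K: "K \<in> B" "\<forall>k\<in>K. inv\<^bsub>G\<^esub> y \<otimes>\<^bsub>G\<^esub> k \<otimes>\<^bsub>G\<^esub> y \<in> H" using conj_in xy H by blast
      let ?V = "(\<lambda>h. x \<otimes>\<^bsub>G\<^esub> h) ` K" and ?W = "(\<lambda>h. y \<otimes>\<^bsub>G\<^esub> h) ` H"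
      have "(x \<otimes>\<^bsub>G\<^esub> k) \<otimes>\<^bsub>G\<^esub> (y \<otimes>\<^bsub>G\<^esub> h) \<in> U" if "k \<in> K" "h \<in> H" for k h
      proof -
        have c: "k \<in> carrier G" "h \<in> carrier G" using that sgc(1)[OF K(1)] sgc(1)[OF H(1)] by auto
        have "(x \<otimes>\<^bsub>G\<^esub> k) \<otimes>\<^bsub>G\<^esub> (y \<otimes>\<^bsub>G\<^esub> h) = x \<otimes>\<^bsub>G\<^esub> y \<otimes>\<^bsub>G\<^esub> ((inv\<^bsub>G\<^esub> y \<otimes>\<^bsub>G\<^esub> k \<otimes>\<^bsub>G\<^esub> y) \<otimes>\<^bsub>G\<^esub> h)"
        proof -
          have "x \<otimes>\<^bsub>G\<^esub> y \<otimes>\<^bsub>G\<^esub> ((inv\<^bsub>G\<^esub> y \<otimes>\<^bsub>G\<^esub> k \<otimes>\<^bsub>G\<^esub> y) \<otimes>\<^bsub>G\<^esub> h) = x \<otimes>\<^bsub>G\<^esub> (y \<otimes>\<^bsub>G\<^esub> inv\<^bsub>G\<^esub> y) \<otimes>\<^bsub>G\<^esub> k \<otimes>\<^bsub>G\<^esub> (y \<otimes>\<^bsub>G\<^esub> h)"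
            using c xy by (simp only: m_assoc inv_closed m_closed)
          then show ?thesis using c xy by simp
        qed
        then show ?thesis using that K H sgc(3)[OF H(1)] by simp
      qed
      moreover have "?V \<subseteq> carrier G" "?W \<subseteq> carrier G" using xy sgc(1)[OF K(1)] sgc(1)[OF H(1)] by auto
      moreover have "x \<in> ?V" using r_one[OF xy(1), symmetric] sgc(2)[OF K(1)] by (rule image_eqI)
      moreover have "y \<in> ?W" using r_one[OF xy(2), symmetric] sgc(2)[OF H(1)] by (rule image_eqI)
      moreover have "openin T ?V" "openin T ?W" using coset xy K H oT by blast+
      ultimately show "\<exists>V W. openin T V \<and> openin T W \<and> x \<in> V \<and> y \<in> W \<and>
        V \<times> W \<subseteq> {p \<in> topspace (prod_topology T T). (case p of (x, y) \<Rightarrow> x \<otimes>\<^bsub>G\<^esub> y) \<in> U}"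
        by (intro exI[of _ ?V] exI[of _ ?W] conjI) (auto simp: ts)
    qed
  qed
  have ci: "continuous_map T T (\<lambda>x. inv\<^bsub>G\<^esub> x)"
    unfolding continuous_map_def
  proof (intro conjI allI impI)
    show "(\<lambda>x. inv\<^bsub>G\<^esub> x) \<in> topspace T \<rightarrow> topspace T" by (auto simp: ts)
    fix U assume U: "openin T U"
    show "openin T {x \<in> topspace T. inv\<^bsub>G\<^esub> x \<in> U}"
      unfolding oT Op_def ts
    proof (intro conjI ballI)
      fix x assume "x \<in> {x \<in> carrier G. inv\<^bsub>G\<^esub> x \<in> U}"
      then have x: "x \<in> carrier G" "inv\<^bsub>G\<^esub> x \<in> U" by auto
      then obtain H where H: "H \<in> B" "\<forall>h\<in>H. inv\<^bsub>G\<^esub> x \<otimes>\<^bsub>G\<^esub> h \<in> U" using U unfolding oT Op_def by blast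
      obtain K where K: "K \<in> B" "\<forall>k\<in>K. inv\<^bsub>G\<^esub> (inv\<^bsub>G\<^esub> x) \<otimes>\<^bsub>G\<^esub> k \<otimes>\<^bsub>G\<^esub> inv\<^bsub>G\<^esub> x \<in> H"
        using conj_in[of "inv\<^bsub>G\<^esub> x" H] x H by blast
      have "x \<otimes>\<^bsub>G\<^esub> k \<in> {x \<in> carrier G. inv\<^bsub>G\<^esub> x \<in> U}" if k: "k \<in> K" for k
      proof -
        have c: "k \<in> carrier G" "inv\<^bsub>G\<^esub> k \<in> K" using k sgc(1)[OF K(1)] sgc(4)[OF K(1)] by auto
        have "inv\<^bsub>G\<^esub> (x \<otimes>\<^bsub>G\<^esub> k) = inv\<^bsub>G\<^esub> x \<otimes>\<^bsub>G\<^esub> (inv\<^bsub>G\<^esub> (inv\<^bsub>G\<^esub> x) \<otimes>\<^bsub>G\<^esub> inv\<^bsub>G\<^esub> k \<otimes>\<^bsub>G\<^esub> inv\<^bsub>G\<^esub> x)"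
        proof -
          have "inv\<^bsub>G\<^esub> x \<otimes>\<^bsub>G\<^esub> (inv\<^bsub>G\<^esub> (inv\<^bsub>G\<^esub> x) \<otimes>\<^bsub>G\<^esub> inv\<^bsub>G\<^esub> k \<otimes>\<^bsub>G\<^esub> inv\<^bsub>G\<^esub> x)
              = (inv\<^bsub>G\<^esub> x \<otimes>\<^bsub>G\<^esub> inv\<^bsub>G\<^esub> (inv\<^bsub>G\<^esub> x)) \<otimes>\<^bsub>G\<^esub> (inv\<^bsub>G\<^esub> k \<otimes>\<^bsub>G\<^esub> inv\<^bsub>G\<^esub> x)"
            using c x by (simp only: m_assoc inv_closed m_closed)
          then show ?thesis using c x by (simp add: inv_mult_group)
        qed
        then show ?thesis using H K c x by simp
      qed
      then show "\<exists>K\<in>B. \<forall>k\<in>K. x \<otimes>\<^bsub>G\<^esub> k \<in> {x \<in> carrier G. inv\<^bsub>G\<^esub> x \<in> U}" using K by blast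
    qed blast
  qed
  have "topological_group G T" using cm ci ts by (simp add: topological_group_def is_group)
  moreover have "T' = T" if T': "topological_group G T' \<and> nhds_basis T' \<one>\<^bsub>G\<^esub> B" for T'
  proof -
    have ts': "topspace T' = carrier G"
      and cm': "continuous_map (prod_topology T' T') T' (\<lambda>(x, y). x \<otimes>\<^bsub>G\<^esub> y)"
      and nb1: "\<And>H. H \<in> B \<Longrightarrow> \<exists>U. openin T' U \<and> \<one>\<^bsub>G\<^esub> \<in> U \<and> U \<subseteq> H"
      and nb2: "\<And>U. openin T' U \<Longrightarrow> \<one>\<^bsub>G\<^esub> \<in> U \<Longrightarrow> \<exists>H\<in>B. H \<subseteq> U"
      using T' by (auto simp: topological_group_def nhds_basis_def)
    have tr: "continuous_map T' T' (\<lambda>y. x \<otimes>\<^bsub>G\<^esub> y)" if "x \<in> carrier G" for x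
      using continuous_map_compose[OF _ cm', of T' "\<lambda>y. (x, y)"] that
      by (simp add: o_def continuous_map_pairwise ts')
    have "openin T' U \<longleftrightarrow> Op U" for U
    proof
      assume U: "openin T' U"
      then have sub: "U \<subseteq> carrier G" using openin_subset ts' by blast
      have "\<exists>H\<in>B. \<forall>h\<in>H. x \<otimes>\<^bsub>G\<^esub> h \<in> U" if "x \<in> U" for x
      proof -
        have "openin T' {y \<in> topspace T'. x \<otimes>\<^bsub>G\<^esub> y \<in> U}"
          using openin_continuous_map_preimage[OF tr U] sub that by blast
        moreover have "\<one>\<^bsub>G\<^esub> \<in> {y \<in> topspace T'. x \<otimes>\<^bsub>G\<^esub> y \<in> U}" using sub that ts' by auto
        ultimately obtain H where "H \<in> B" "H \<subseteq> {y \<in> topspace T'. x \<otimes>\<^bsub>G\<^esub> y \<in> U}"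
          using nb2[of "{y \<in> topspace T'. x \<otimes>\<^bsub>G\<^esub> y \<in> U}"] by auto
        then show ?thesis by (intro bexI[of _ H]) auto
      qed
      then show "Op U" using sub unfolding Op_def by blast
    next
      assume U: "Op U"
      show "openin T' U"
      proof (subst openin_subopen, intro ballI)
        fix x assume x: "x \<in> U"
        then have xc: "x \<in> carrier G" using U unfolding Op_def by blast
        obtain H where H: "H \<in> B" "\<forall>h\<in>H. x \<otimes>\<^bsub>G\<^esub> h \<in> U" using U x unfolding Op_def by blast
        obtain V where V: "openin T' V" "\<one>\<^bsub>G\<^esub> \<in> V" "V \<subseteq> H" using nb1[OF H(1)] by blast
        let ?W = "{y \<in> topspace T'. inv\<^bsub>G\<^esub> x \<otimes>\<^bsub>G\<^esub> y \<in> V}"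
        have "openin T' ?W" using openin_continuous_map_preimage[OF tr V(1)] xc by blast
        moreover have "x \<in> ?W" using xc V ts' by simp
        moreover have "?W \<subseteq> U"
        proof
          fix y assume "y \<in> ?W"
          then have "y \<in> carrier G" "x \<otimes>\<^bsub>G\<^esub> (inv\<^bsub>G\<^esub> x \<otimes>\<^bsub>G\<^esub> y) \<in> U" using H V ts' by auto
          then show "y \<in> U" using xc by (simp add: m_assoc[symmetric])
        qed
        ultimately show "\<exists>T. openin T' T \<and> x \<in> T \<and> T \<subseteq> U" by blast
      qed
    qed
    then show "T' = T" by (simp add: topology_eq oT)
  qed
  ultimately show ?thesis using nb by blast
qed

definition base_topology :: "('g, 'z) monoid_scheme \<Rightarrow> 'g set set \<Rightarrow> 'g topology" where
  "base_topology G B = (THE T. topological_group G T \<and> nhds_basis T \<one>\<^bsub>G\<^esub> B)"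

type_synonym ('g, 'x) gset = "'x set \<times> ('g \<Rightarrow> 'x \<Rightarrow> 'x)"

definition continuous_action :: "('g, 'z) monoid_scheme \<Rightarrow> 'g topology \<Rightarrow> ('g, 'x) gset \<Rightarrow> bool" where
  "continuous_action G T = (\<lambda>(X, \<phi>).
     group_action G X \<phi> \<and>
     continuous_map (prod_topology T (discrete_topology X)) (discrete_topology X) (\<lambda>(g, x). \<phi> g x))"

definition Cont :: "'v set set \<Rightarrow> ('g, 'z) monoid_scheme \<Rightarrow> 'g topology \<Rightarrow>
    (('g, 'x) gset, ('g, 'x) gset \<times> ('g, 'x) gset \<times> ('x \<Rightarrow> 'x)) cat" where
  "Cont \<U> G T =
     \<lparr>obj = {(X, \<phi>). small \<U> X \<and> \<phi> \<in> extensional (carrier G) \<and> continuous_action G T (X, \<phi>)},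
      arr = {((X, \<phi>), (Y, \<psi>), f).
               small \<U> X \<and> \<phi> \<in> extensional (carrier G) \<and> continuous_action G T (X, \<phi>) \<and>
               small \<U> Y \<and> \<psi> \<in> extensional (carrier G) \<and> continuous_action G T (Y, \<psi>) \<and>
               f \<in> X \<rightarrow>\<^sub>E Y \<and> (\<forall>g\<in>carrier G. \<forall>x\<in>X. f (\<phi> g x) = \<psi> g (f x))},
      src = (\<lambda>(X, Y, f). X),
      trg = (\<lambda>(X, Y, f). Y),
      ide = (\<lambda>X. (X, X, \<lambda>x\<in>fst X. x)),
      cmp = (\<lambda>(Y', Z, g) (X, Y, f). (X, Z, \<lambda>x\<in>fst X. g (f x)))\<rparr>"

definition Cont_t :: "'v set set \<Rightarrow> ('g, 'z) monoid_scheme \<Rightarrow> 'g topology \<Rightarrow>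
    (('g, 'x) gset, ('g, 'x) gset \<times> ('g, 'x) gset \<times> ('x \<Rightarrow> 'x)) cat" where
  "Cont_t \<U> G T = full_sub (Cont \<U> G T) {(X, \<phi>). X \<noteq> {} \<and> transitive_action G X \<phi>}"


section \<open>The automorphism group and the functor \<open>F\<close>\<close>

definition Aut :: "('o, 'm) cat \<Rightarrow> 'o \<Rightarrow> 'm monoid" where
  "Aut D u = \<lparr>carrier = iso D u u, mult = cmp D, one = ide D u\<rparr>"

text \<open>Below, \<open>E: C \<rightarrow> D\<close> is the embedding; the case of interest is \<open>yoneda C: C \<rightarrow> Ind \<U> C\<close>.\<close>

definition fixator :: "('o, 'm) cat \<Rightarrow> 'o \<Rightarrow> 'm \<Rightarrow> 'm set" where
  "fixator D u \<chi> = {f \<in> carrier (Aut D u). cmp D f \<chi> = \<chi>}"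

definition fixators ::
    "('o, 'm) cat \<Rightarrow> ('p, 'n) cat \<Rightarrow> ('o, 'm, 'p, 'n) ftor \<Rightarrow> 'p \<Rightarrow> 'n set set" where
  "fixators C D E u = {fixator D u \<chi> | c \<chi>. c \<in> obj C \<and> \<chi> \<in> homs D (fob E c) u}"

definition Aut_topology ::
    "('o, 'm) cat \<Rightarrow> ('p, 'n) cat \<Rightarrow> ('o, 'm, 'p, 'n) ftor \<Rightarrow> 'p \<Rightarrow> 'n topology" where
  "Aut_topology C D E u = base_topology (Aut D u) (fixators C D E u)"

definition hom_gset :: "('p, 'n) cat \<Rightarrow> 'p \<Rightarrow> 'p \<Rightarrow> ('n, 'n) gset" where
  "hom_gset D x u = (homs D x u, \<lambda>g\<in>carrier (Aut D u). \<lambda>\<chi>\<in>homs D x u. cmp D g \<chi>)"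

definition orbit_functor :: "('o, 'm) cat \<Rightarrow> ('p, 'n) cat \<Rightarrow> ('o, 'm, 'p, 'n) ftor \<Rightarrow> 'p \<Rightarrow>
    ('o, 'm, ('n, 'n) gset, ('n, 'n) gset \<times> ('n, 'n) gset \<times> ('n \<Rightarrow> 'n)) ftor" where
  "orbit_functor C D E u =
     \<lparr>fob = (\<lambda>c\<in>obj C. hom_gset D (fob E c) u),
      far = (\<lambda>f\<in>arr C.
        (hom_gset D (fob E (trg C f)) u, hom_gset D (fob E (src C f)) u,
         \<lambda>\<chi>\<in>homs D (fob E (trg C f)) u. cmp D \<chi> (far E f)))\<rparr>"

end

theory Submission
  imports Defs
begin

text \<open>
  Since \<open>u\<close> is a filtered colimit of representables, its category of elements (pairs of an object \<open>c\<close> and an arrow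
  \<open>\<chi>: c \<rightarrow> u\<close>) is filtered; this and homogeneity are the only properties of \<open>u\<close> that matter. Domination of two
  elements gives the algebraic base, and homogeneity makes each \<open>F c = Hom(c, u)\<close> transitive, so that an
  equivariant map out of \<open>F c\<close> is determined by its value at a single \<open>\<chi>\<close>, which may be any point fixed by
  \<open>I\<^sub>\<chi>\<close>. Every continuous action is therefore covered by the \<open>F c\<close>, whence \<open>X \<mapsto> Hom(F -, X)\<close> is fully faithful.
  A sheaf \<open>P\<close> for the atomic topology is the same as a functor on \<open>C\<close> for which each \<open>P f\<close> is injective, with
  image the elements equalized by all pairs \<open>h, h'\<close> such that \<open>h \<circ> f = h' \<circ> f\<close>. Homogeneity translates this
  condition into invariance under \<open>I\<^sub>\<chi>\<close>, so that \<open>P\<close> is recovered from the action on the colimit of \<open>P\<close> over the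
  elements of \<open>u\<close>.
\<close>


section \<open>Categories\<close>

lemma homsD:
  assumes "f \<in> homs C a b"
  shows "f \<in> arr C" "src C f = a" "trg C f = b"
  using assms by (auto simp: homs_def)

lemma arr_homs: "f \<in> arr C \<Longrightarrow> f \<in> homs C (src C f) (trg C f)"
  by (simp add: homs_def)

lemma (in category) homs_obj:
  assumes "f \<in> homs C a b"
  shows "a \<in> obj C" "b \<in> obj C"
  using assms src_obj trg_obj by (auto simp: homs_def)

lemma opp_simps [simp]:
  "obj (opp C) = obj C" "arr (opp C) = arr C" "src (opp C) = trg C" "trg (opp C) = src C"
  "ide (opp C) = ide C" "cmp (opp C) g f = cmp C f g"
  by (simp_all add: opp_def)

lemma homs_opp [simp]: "homs (opp C) a b = homs C b a"
  by (auto simp: homs_def)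

lemma category_opp:
  assumes "category C"
  shows "category (opp C)"
proof -
  interpret category C by fact
  show ?thesis
    by unfold_locales (auto intro: src_obj trg_obj ide_homs cmp_homs cmp_ide_left cmp_ide_right simp: cmp_assoc)
qed

lemma full_sub_simps [simp]:
  "obj (full_sub C X) = obj C \<inter> X" "src (full_sub C X) = src C" "trg (full_sub C X) = trg C"
  "ide (full_sub C X) = ide C" "cmp (full_sub C X) = cmp C"
  by (simp_all add: full_sub_def)

lemma homs_full_sub: "homs (full_sub C X) a b = (if a \<in> X \<and> b \<in> X then homs C a b else {})"
  by (auto simp: homs_def full_sub_def)

lemma category_full_sub:
  assumes "category C"
  shows "category (full_sub C X)"
proof -
  interpret category C by fact
  show ?thesis
    by unfold_locales
      (auto intro: src_obj trg_obj ide_homs cmp_homs cmp_ide_left cmp_ide_right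
        simp: cmp_assoc homs_full_sub full_sub_def[of C X, THEN arg_cong[of _ _ arr], simplified] split: if_splits)
qed

lemma is_functor_full_sub:
  assumes "is_functor A B F" and "\<And>a. a \<in> obj A \<Longrightarrow> fob F a \<in> X"
  shows "is_functor A (full_sub B X) F"
proof -
  interpret is_functor A B F by fact
  interpret S: category "full_sub B X" by (rule category_full_sub) unfold_locales
  show ?thesis
    by unfold_locales
      (use assms(2) fob_ext far_ext fob_obj far_homs far_ide far_cmp A.homs_obj in
        \<open>auto simp: homs_full_sub\<close>)
qed

lemma is_functor_id: "category C \<Longrightarrow> is_functor C C (id_ftor C)"
proof -
  assume "category C"
  then interpret category C .
  show ?thesis
    by unfold_locales
      (use homs_obj in \<open>auto simp: id_ftor_def ide_homs cmp_homs homsD(1) homsD(1)[OF ide_homs] homsD(1)[OF cmp_homs]\<close>)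
qed

lemma is_functor_comp:
  assumes "is_functor A B F" and "is_functor B C G"
  shows "is_functor A C (comp_ftor A G F)"
proof -
  interpret F: is_functor A B F by fact
  interpret G: is_functor B C G by fact
  show ?thesis
  proof unfold_locales
    fix f g a b c assume f: "f \<in> homs A a b" and g: "g \<in> homs A b c"
    show "far (comp_ftor A G F) (cmp A g f) = cmp C (far (comp_ftor A G F) g) (far (comp_ftor A G F) f)"
      using homsD(1)[OF F.A.cmp_homs[OF f g]] homsD(1)[OF f] homsD(1)[OF g]
        F.far_cmp[OF f g] G.far_cmp[OF F.far_homs[OF f] F.far_homs[OF g]]
      by (simp add: comp_ftor_def)
  next
    fix f a b assume f: "f \<in> homs A a b"
    show "far (comp_ftor A G F) f \<in> homs C (fob (comp_ftor A G F) a) (fob (comp_ftor A G F) b)"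
      using G.far_homs[OF F.far_homs[OF f]] homsD(1)[OF f] F.A.homs_obj[OF f]
      by (simp add: comp_ftor_def)
  next
    fix a assume "a \<in> obj A"
    then show "far (comp_ftor A G F) (ide A a) = ide C (fob (comp_ftor A G F) a)"
      using homsD(1)[OF F.A.ide_homs] F.far_ide F.fob_obj G.far_ide by (simp add: comp_ftor_def)
  qed (auto simp: comp_ftor_def F.fob_obj G.fob_obj)
qed

lemma nat_transD:
  assumes "nat_trans A B F G \<tau>"
  shows "is_functor A B F" "is_functor A B G" "\<tau> \<in> extensional (obj A)"
    "a \<in> obj A \<Longrightarrow> \<tau> a \<in> homs B (fob F a) (fob G a)"
    "f \<in> homs A a b \<Longrightarrow> cmp B (\<tau> b) (far F f) = cmp B (far G f) (\<tau> a)"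
  using assms by (auto simp: nat_trans_def homs_def)

lemma nat_transI:
  assumes "is_functor A B F" "is_functor A B G" "\<tau> \<in> extensional (obj A)"
    "\<And>a. a \<in> obj A \<Longrightarrow> \<tau> a \<in> homs B (fob F a) (fob G a)"
    "\<And>f a b. f \<in> homs A a b \<Longrightarrow> cmp B (\<tau> b) (far F f) = cmp B (far G f) (\<tau> a)"
  shows "nat_trans A B F G \<tau>"
  using assms by (auto simp: nat_trans_def homs_def)

lemma homs_Fun: "homs (Fun A B) F G = {(F, G, \<tau>) | \<tau>. nat_trans A B F G \<tau>}"
  by (auto simp: homs_def Fun_def)

lemma Fun_simps [simp]:
  "F \<in> obj (Fun A B) \<longleftrightarrow> is_functor A B F"
  "ide (Fun A B) F = (F, F, \<lambda>a\<in>obj A. ide B (fob F a))"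
  "cmp (Fun A B) (G', H, \<sigma>) (F, G, \<tau>) = (F, H, \<lambda>a\<in>obj A. cmp B (\<sigma> a) (\<tau> a))"
  by (simp_all add: Fun_def)

lemma nat_trans_comp:
  assumes "nat_trans A B F G \<tau>" "nat_trans A B G H \<sigma>"
  shows "nat_trans A B F H (\<lambda>a\<in>obj A. cmp B (\<sigma> a) (\<tau> a))"
proof (rule nat_transI)
  interpret F: is_functor A B F using nat_transD(1)[OF assms(1)] .
  interpret G: is_functor A B G using nat_transD(1)[OF assms(2)] .
  interpret H: is_functor A B H using nat_transD(2)[OF assms(2)] .
  show "is_functor A B F" "is_functor A B H" by unfold_locales
  note t = nat_transD(4,5)[OF assms(1)] and s = nat_transD(4,5)[OF assms(2)]
  show "(\<lambda>a\<in>obj A. cmp B (\<sigma> a) (\<tau> a)) a \<in> homs B (fob F a) (fob H a)" if "a \<in> obj A" for a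
    using that F.B.cmp_homs[OF t(1) s(1)] by simp
  fix f a b assume f: "f \<in> homs A a b"
  note ab = F.A.homs_obj[OF f]
  have "cmp B (cmp B (\<sigma> b) (\<tau> b)) (far F f) = cmp B (\<sigma> b) (cmp B (\<tau> b) (far F f))"
    using F.B.cmp_assoc[OF F.far_homs[OF f] t(1) s(1)] ab by simp
  also have "\<dots> = cmp B (\<sigma> b) (cmp B (far G f) (\<tau> a))" using t(2)[OF f] by simp
  also have "\<dots> = cmp B (cmp B (\<sigma> b) (far G f)) (\<tau> a)"
    using F.B.cmp_assoc[OF t(1) G.far_homs[OF f] s(1)] ab by simp
  also have "\<dots> = cmp B (cmp B (far H f) (\<sigma> a)) (\<tau> a)" using s(2)[OF f] by simp
  also have "\<dots> = cmp B (far H f) (cmp B (\<sigma> a) (\<tau> a))"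
    using F.B.cmp_assoc[OF t(1) s(1) H.far_homs[OF f]] ab by simp
  finally show "cmp B ((\<lambda>a\<in>obj A. cmp B (\<sigma> a) (\<tau> a)) b) (far F f) =
    cmp B (far H f) ((\<lambda>a\<in>obj A. cmp B (\<sigma> a) (\<tau> a)) a)" using ab by simp
qed simp

lemma nat_trans_ide:
  assumes "is_functor A B F"
  shows "nat_trans A B F F (\<lambda>a\<in>obj A. ide B (fob F a))"
proof -
  interpret is_functor A B F by fact
  show ?thesis
  proof (rule nat_transI)
    fix f a b assume f: "f \<in> homs A a b"
    then show "cmp B ((\<lambda>a\<in>obj A. ide B (fob F a)) b) (far F f) =
      cmp B (far F f) ((\<lambda>a\<in>obj A. ide B (fob F a)) a)"
      using A.homs_obj[OF f] B.cmp_ide_left[OF far_homs] B.cmp_ide_right[OF far_homs] by simp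
  qed (use assms B.ide_homs fob_obj in auto)
qed

lemma category_Fun:
  assumes "category A" "category B"
  shows "category (Fun A B)"
proof -
  interpret A: category A by fact
  interpret B: category B by fact
  show ?thesis
  proof unfold_locales
    fix f assume "f \<in> arr (Fun A B)"
    then show "src (Fun A B) f \<in> obj (Fun A B)" "trg (Fun A B) f \<in> obj (Fun A B)"
      by (auto simp: Fun_def nat_trans_def)
  next
    fix F assume "F \<in> obj (Fun A B)"
    then show "ide (Fun A B) F \<in> homs (Fun A B) F F" by (simp add: homs_Fun nat_trans_ide)
  next
    fix f g F G H assume "f \<in> homs (Fun A B) F G" "g \<in> homs (Fun A B) G H"
    then show "cmp (Fun A B) g f \<in> homs (Fun A B) F H" by (auto simp: homs_Fun nat_trans_comp)
  next
    fix f F G assume "f \<in> homs (Fun A B) F G"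
    then obtain \<tau> where t: "f = (F, G, \<tau>)" "nat_trans A B F G \<tau>" by (auto simp: homs_Fun)
    have "(\<lambda>a\<in>obj A. cmp B (ide B (fob G a)) (\<tau> a)) = \<tau>"
      "(\<lambda>a\<in>obj A. cmp B (\<tau> a) (ide B (fob F a))) = \<tau>"
      by (rule extensionalityI[OF _ nat_transD(3)[OF t(2)]];
        simp add: B.cmp_ide_left[OF nat_transD(4)[OF t(2)]] B.cmp_ide_right[OF nat_transD(4)[OF t(2)]])+
    then show "cmp (Fun A B) (ide (Fun A B) G) f = f" "cmp (Fun A B) f (ide (Fun A B) F) = f"
      unfolding t(1) by (simp_all cong: restrict_cong)
  next
    fix f g h F G H K
    assume "f \<in> homs (Fun A B) F G" "g \<in> homs (Fun A B) G H" "h \<in> homs (Fun A B) H K"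
    then show "cmp (Fun A B) h (cmp (Fun A B) g f) = cmp (Fun A B) (cmp (Fun A B) h g) f"
      using B.cmp_assoc[OF nat_transD(4) nat_transD(4) nat_transD(4)]
      by (auto simp: homs_Fun intro!: extensionalityI[of _ "obj A"])
  qed
qed

lemma isomorphic_FunI:
  assumes \<tau>: "nat_trans A B F G \<tau>" and iso: "\<And>a. a \<in> obj A \<Longrightarrow> \<tau> a \<in> iso B (fob F a) (fob G a)"
  shows "isomorphic (Fun A B) F G"
proof -
  interpret F: is_functor A B F using nat_transD(1)[OF \<tau>] .
  interpret G: is_functor A B G using nat_transD(2)[OF \<tau>] .
  note t = nat_transD(4,5)[OF \<tau>]
  have "\<forall>a\<in>obj A. \<exists>s. s \<in> homs B (fob G a) (fob F a) \<and>
    cmp B s (\<tau> a) = ide B (fob F a) \<and> cmp B (\<tau> a) s = ide B (fob G a)"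
    using iso unfolding iso_def by blast
  then obtain s where s: "\<And>a. a \<in> obj A \<Longrightarrow> s a \<in> homs B (fob G a) (fob F a)"
    and st: "\<And>a. a \<in> obj A \<Longrightarrow> cmp B (s a) (\<tau> a) = ide B (fob F a)"
    and ts: "\<And>a. a \<in> obj A \<Longrightarrow> cmp B (\<tau> a) (s a) = ide B (fob G a)" by metis
  define \<sigma> where "\<sigma> = restrict s (obj A)"
  have "nat_trans A B G F \<sigma>"
  proof (rule nat_transI)
    show "is_functor A B G" "is_functor A B F" by unfold_locales
    fix f a b assume f: "f \<in> homs A a b"
    note ab = F.A.homs_obj[OF f] and Ff = F.far_homs[OF f] and Gf = G.far_homs[OF f]
    have "cmp B (s b) (far G f) = cmp B (s b) (cmp B (far G f) (cmp B (\<tau> a) (s a)))"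
      using ts ab F.B.cmp_ide_right[OF Gf] by simp
    also have "\<dots> = cmp B (s b) (cmp B (cmp B (\<tau> b) (far F f)) (s a))"
      using F.B.cmp_assoc[OF s t(1) Gf] ab t(2)[OF f] by simp
    also have "\<dots> = cmp B (s b) (cmp B (\<tau> b) (cmp B (far F f) (s a)))"
      using F.B.cmp_assoc[OF s Ff t(1)] ab by simp
    also have "\<dots> = cmp B (cmp B (s b) (\<tau> b)) (cmp B (far F f) (s a))"
      using F.B.cmp_assoc[OF F.B.cmp_homs[OF s Ff] t(1) s] ab by simp
    also have "\<dots> = cmp B (far F f) (s a)"
      using st ab F.B.cmp_ide_left[OF F.B.cmp_homs[OF s Ff]] by simp
    finally show "cmp B (\<sigma> b) (far G f) = cmp B (far F f) (\<sigma> a)" using ab by (simp add: \<sigma>_def)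
  qed (use s in \<open>auto simp: \<sigma>_def\<close>)
  then have "(F, G, \<tau>) \<in> iso (Fun A B) F G"
    using \<tau> st ts by (auto simp: iso_def homs_Fun \<sigma>_def intro!: exI[of _ \<sigma>])
  then show ?thesis using F.is_functor_axioms G.is_functor_axioms by (auto simp: isomorphic_def)
qed

lemma is_equivalenceI:
  assumes F: "is_functor A B F"
    and ff: "\<And>X Y. X \<in> obj A \<Longrightarrow> Y \<in> obj A \<Longrightarrow>
      bij_betw (far F) (homs A X Y) (homs B (fob F X) (fob F Y))"
    and es: "\<And>Z. Z \<in> obj B \<Longrightarrow> \<exists>X\<in>obj A. iso B (fob F X) Z \<noteq> {}"
  shows "is_equivalence A B F"
proof -
  interpret F: is_functor A B F by fact
  have "\<forall>Z\<in>obj B. \<exists>X i j. X \<in> obj A \<and> i \<in> homs B (fob F X) Z \<and> j \<in> homs B Z (fob F X) \<and>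
    cmp B j i = ide B (fob F X) \<and> cmp B i j = ide B Z"
    using es unfolding iso_def by blast
  then obtain g i j where g: "\<And>Z. Z \<in> obj B \<Longrightarrow> g Z \<in> obj A"
    and i: "\<And>Z. Z \<in> obj B \<Longrightarrow> i Z \<in> homs B (fob F (g Z)) Z"
    and j: "\<And>Z. Z \<in> obj B \<Longrightarrow> j Z \<in> homs B Z (fob F (g Z))"
    and ji: "\<And>Z. Z \<in> obj B \<Longrightarrow> cmp B (j Z) (i Z) = ide B (fob F (g Z))"
    and ij: "\<And>Z. Z \<in> obj B \<Longrightarrow> cmp B (i Z) (j Z) = ide B Z" by metis
  define L where "L X Y = inv_into (homs A X Y) (far F)" for X Y
  have L: "L X Y k \<in> homs A X Y" "far F (L X Y k) = k"
    if "X \<in> obj A" "Y \<in> obj A" "k \<in> homs B (fob F X) (fob F Y)" for X Y k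
    using bij_betwE[OF bij_betw_inv_into[OF ff]] f_inv_into_f[of k "far F" "homs A X Y"]
      bij_betw_imp_surj_on[OF ff[of X Y]] that by (auto simp: L_def)
  have inj: "p = q" if "p \<in> homs A X Y" "q \<in> homs A X Y" "far F p = far F q" for p q X Y
    using bij_betw_imp_inj_on[OF ff[of X Y]] that F.A.homs_obj[OF that(1)] by (auto dest: inj_onD)
  define t where "t f = cmp B (j (trg B f)) (cmp B f (i (src B f)))" for f
  have t: "t f \<in> homs B (fob F (g Z)) (fob F (g W))" if f: "f \<in> homs B Z W" for f Z W
    using F.B.cmp_homs[OF F.B.cmp_homs[OF i f] j] F.B.homs_obj[OF f] homsD[OF f] by (simp add: t_def)
  have it: "cmp B (i W) (t f) = cmp B f (i Z)" if f: "f \<in> homs B Z W" for f Z W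
    using F.B.cmp_assoc[OF F.B.cmp_homs[OF i f] j i] F.B.homs_obj[OF f] homsD[OF f]
      ij F.B.cmp_ide_left[OF F.B.cmp_homs[OF i f]] by (simp add: t_def)
  have i_cancel: "p = q" if p: "p \<in> homs B a (fob F (g Z))" and q: "q \<in> homs B a (fob F (g Z))"
    and Z: "Z \<in> obj B" and eq: "cmp B (i Z) p = cmp B (i Z) q" for p q a Z
  proof -
    have "p = cmp B (cmp B (j Z) (i Z)) p" using F.B.cmp_ide_left[OF p] ji[OF Z] by simp
    also have "\<dots> = cmp B (j Z) (cmp B (i Z) q)" using F.B.cmp_assoc[OF p i[OF Z] j[OF Z]] eq by simp
    also have "\<dots> = cmp B (cmp B (j Z) (i Z)) q" by (rule F.B.cmp_assoc[OF q i[OF Z] j[OF Z]])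
    also have "\<dots> = q" using F.B.cmp_ide_left[OF q] ji[OF Z] by simp
    finally show ?thesis .
  qed
  define G where "G = \<lparr>fob = (\<lambda>Z\<in>obj B. g Z), far = (\<lambda>f\<in>arr B. L (g (src B f)) (g (trg B f)) (t f))\<rparr>"
  have G_ob: "fob G Z = g Z" if "Z \<in> obj B" for Z using that by (simp add: G_def)
  have G_ar: "far G f \<in> homs A (g Z) (g W)" "far F (far G f) = t f" if f: "f \<in> homs B Z W" for f Z W
    using L[OF g g t[OF f]] F.B.homs_obj[OF f] homsD[OF f] by (auto simp: G_def)
  have GF: "is_functor B A G"
  proof unfold_locales
    fix f a b assume f: "f \<in> homs B a b"
    then show "far G f \<in> homs A (fob G a) (fob G b)" using G_ar G_ob F.B.homs_obj[OF f] by simp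
  next
    fix a assume a: "a \<in> obj B"
    have "far F (far G (ide B a)) = far F (ide A (g a))"
      using G_ar(2)[OF F.B.ide_homs[OF a]] homsD[OF F.B.ide_homs[OF a]] F.B.cmp_ide_left[OF i[OF a]]
        ji a F.far_ide[OF g] by (simp add: t_def)
    then show "far G (ide B a) = ide A (fob G a)"
      using inj[OF G_ar(1)[OF F.B.ide_homs[OF a]] F.A.ide_homs[OF g]] a G_ob by simp
  next
    fix f h a b c assume f: "f \<in> homs B a b" and h: "h \<in> homs B b c"
    note hf = F.B.cmp_homs[OF f h] and ob = F.B.homs_obj[OF f] F.B.homs_obj[OF h]
    have GG: "cmp A (far G h) (far G f) \<in> homs A (g a) (g c)"
      using F.A.cmp_homs[OF G_ar(1)[OF f] G_ar(1)[OF h]] .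
    have "t (cmp B h f) = cmp B (t h) (t f)"
    proof (rule i_cancel)
      have "cmp B (i c) (cmp B (t h) (t f)) = cmp B (cmp B h (i b)) (t f)"
        using F.B.cmp_assoc[OF t[OF f] t[OF h] i] ob it[OF h] by simp
      also have "\<dots> = cmp B h (cmp B f (i a))"
        using F.B.cmp_assoc[OF t[OF f] i h] ob it[OF f] by simp
      also have "\<dots> = cmp B (i c) (t (cmp B h f))"
        using F.B.cmp_assoc[OF i f h] ob it[OF hf] by simp
      finally show "cmp B (i c) (t (cmp B h f)) = cmp B (i c) (cmp B (t h) (t f))" by simp
    qed (use t[OF hf] F.B.cmp_homs[OF t[OF f] t[OF h]] ob in auto)
    then show "far G (cmp B h f) = cmp A (far G h) (far G f)"
      using inj[OF G_ar(1)[OF hf] GG] G_ar(2)[OF hf] G_ar(2)[OF f] G_ar(2)[OF h]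
        F.far_cmp[OF G_ar(1)[OF f] G_ar(1)[OF h]] by simp
  qed (auto simp: G_def g)
  interpret G: is_functor B A G by fact
  have GcF: "fob (comp_ftor A G F) X = g (fob F X)" if "X \<in> obj A" for X
    using that F.fob_obj G_ob by (simp add: comp_ftor_def)
  have FcG: "fob (comp_ftor B F G) Z = fob F (g Z)" if "Z \<in> obj B" for Z
    using that G_ob by (simp add: comp_ftor_def)
  define \<eta> where "\<eta> = (\<lambda>X\<in>obj A. L X (g (fob F X)) (j (fob F X)))"
  have \<eta>: "\<eta> X \<in> homs A X (g (fob F X))" "far F (\<eta> X) = j (fob F X)" if "X \<in> obj A" for X
    using L[OF that g j] F.fob_obj[OF that] that by (auto simp: \<eta>_def)
  have "isomorphic (Fun A A) (id_ftor A) (comp_ftor A G F)"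
  proof (rule isomorphic_FunI[of _ _ _ _ \<eta>])
    fix X assume X: "X \<in> obj A"
    note FX = F.fob_obj[OF X]
    let ?m = "L (g (fob F X)) X (i (fob F X))"
    have m: "?m \<in> homs A (g (fob F X)) X" "far F ?m = i (fob F X)"
      using L[OF g[OF FX] X i[OF FX]] by auto
    have "cmp A ?m (\<eta> X) = ide A X"
      using inj[OF F.A.cmp_homs[OF \<eta>(1)[OF X] m(1)] F.A.ide_homs[OF X]]
        F.far_cmp[OF \<eta>(1)[OF X] m(1)] m(2) \<eta>(2)[OF X] ij[OF FX] F.far_ide[OF X] by simp
    moreover have "cmp A (\<eta> X) ?m = ide A (g (fob F X))"
      using inj[OF F.A.cmp_homs[OF m(1) \<eta>(1)[OF X]] F.A.ide_homs[OF g[OF FX]]]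
        F.far_cmp[OF m(1) \<eta>(1)[OF X]] m(2) \<eta>(2)[OF X] ji[OF FX] F.far_ide[OF g[OF FX]] by simp
    ultimately show "\<eta> X \<in> iso A (fob (id_ftor A) X) (fob (comp_ftor A G F) X)"
      using \<eta>(1)[OF X] m(1) X GcF[OF X] by (auto simp: iso_def id_ftor_def)
  next
    show "nat_trans A A (id_ftor A) (comp_ftor A G F) \<eta>"
    proof (rule nat_transI)
      show "is_functor A A (id_ftor A)" by (rule is_functor_id) unfold_locales
      show "is_functor A A (comp_ftor A G F)" by (rule is_functor_comp[OF F GF])
      fix f X Y assume f: "f \<in> homs A X Y"
      note XY = F.A.homs_obj[OF f] and Ff = F.far_homs[OF f]
      have FX: "fob F X \<in> obj B" "fob F Y \<in> obj B" using XY F.fob_obj by auto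
      have "cmp B (t (far F f)) (j (fob F X)) = cmp B (j (fob F Y)) (far F f)"
      proof (rule i_cancel[OF F.B.cmp_homs[OF j t[OF Ff]] F.B.cmp_homs[OF Ff j]])
        have "cmp B (i (fob F Y)) (cmp B (t (far F f)) (j (fob F X))) = cmp B (cmp B (far F f) (i (fob F X))) (j (fob F X))"
          using F.B.cmp_assoc[OF j t[OF Ff] i] FX it[OF Ff] by simp
        also have "\<dots> = far F f"
          using F.B.cmp_assoc[OF j i Ff] FX ij F.B.cmp_ide_right[OF Ff] by simp
        also have "\<dots> = cmp B (i (fob F Y)) (cmp B (j (fob F Y)) (far F f))"
          using F.B.cmp_assoc[OF Ff j i] FX ij F.B.cmp_ide_left[OF Ff] by simp
        finally show "cmp B (i (fob F Y)) (cmp B (t (far F f)) (j (fob F X))) =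
          cmp B (i (fob F Y)) (cmp B (j (fob F Y)) (far F f))" .
      qed (use FX in auto)
      then have "cmp A (\<eta> Y) f = cmp A (far G (far F f)) (\<eta> X)"
        using inj[OF F.A.cmp_homs[OF f \<eta>(1)] F.A.cmp_homs[OF \<eta>(1) G_ar(1)[OF Ff]]] XY
          F.far_cmp[OF f \<eta>(1)] F.far_cmp[OF \<eta>(1) G_ar(1)[OF Ff]] \<eta>(2) G_ar(2)[OF Ff] by simp
      then show "cmp A (\<eta> Y) (far (id_ftor A) f) = cmp A (far (comp_ftor A G F) f) (\<eta> X)"
        using homsD(1)[OF f] by (simp add: id_ftor_def comp_ftor_def)
    qed (use \<eta>(1) GcF in \<open>auto simp: id_ftor_def \<eta>_def\<close>)
  qed
  moreover have "isomorphic (Fun B B) (comp_ftor B F G) (id_ftor B)"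
  proof (rule isomorphic_FunI[of _ _ _ _ "restrict i (obj B)"])
    fix Z assume Z: "Z \<in> obj B"
    then show "restrict i (obj B) Z \<in> iso B (fob (comp_ftor B F G) Z) (fob (id_ftor B) Z)"
      using i[OF Z] j[OF Z] ij[OF Z] ji[OF Z] FcG[OF Z] by (auto simp: iso_def id_ftor_def)
  next
    show "nat_trans B B (comp_ftor B F G) (id_ftor B) (restrict i (obj B))"
    proof (rule nat_transI)
      show "is_functor B B (id_ftor B)" by (rule is_functor_id) unfold_locales
      show "is_functor B B (comp_ftor B F G)" by (rule is_functor_comp[OF GF F])
      fix f Z W assume f: "f \<in> homs B Z W"
      then show "cmp B (restrict i (obj B) W) (far (comp_ftor B F G) f) =
          cmp B (far (id_ftor B) f) (restrict i (obj B) Z)"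
        using F.B.homs_obj[OF f] homsD(1)[OF f] it[OF f] G_ar(2)[OF f]
        by (simp add: id_ftor_def comp_ftor_def)
    qed (use i FcG in \<open>auto simp: id_ftor_def\<close>)
  qed
  ultimately show ?thesis using F GF unfolding is_equivalence_def by blast
qed

section \<open>Smallness\<close>

lemma small_lepoll: "small \<U> B \<Longrightarrow> A \<lesssim> B \<Longrightarrow> small \<U> A"
  unfolding small_def by (blast intro: lepoll_trans)

lemma small_image: "small \<U> A \<Longrightarrow> small \<U> (f ` A)"
  by (rule small_lepoll[OF _ image_lepoll])

lemma small_subset: "small \<U> B \<Longrightarrow> A \<subseteq> B \<Longrightarrow> small \<U> A"
  by (rule small_lepoll[OF _ subset_imp_lepoll])

lemma small_inj_on: "small \<U> B \<Longrightarrow> inj_on f A \<Longrightarrow> f ` A \<subseteq> B \<Longrightarrow> small \<U> A"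
  by (rule small_lepoll) (auto simp: lepoll_def)

lemma small_in: "A \<in> \<U> \<Longrightarrow> small \<U> A"
  unfolding small_def by blast

lemma small_inj_exists:
  assumes "small (\<U> :: 'v set set) A"
  shows "\<exists>f :: 'a \<Rightarrow> 'v. inj_on f A"
  using assms unfolding small_def lepoll_def by blast

lemma universe_lepoll: "universe \<U> \<Longrightarrow> A \<in> \<U> \<Longrightarrow> B \<lesssim> A \<Longrightarrow> B \<in> \<U>"
  unfolding universe_def by simp

lemma universe_UN: "universe \<U> \<Longrightarrow> I \<in> \<U> \<Longrightarrow> (\<And>i. i \<in> I \<Longrightarrow> A i \<in> \<U>) \<Longrightarrow> (\<Union>i\<in>I. A i) \<in> \<U>"
  unfolding universe_def by simp

lemma universe_Un:
  assumes U: "universe \<U>" and A: "A \<in> \<U>" and B: "B \<in> \<U>"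
  shows "A \<union> B \<in> \<U>"
proof -
  obtain N where N: "N \<in> \<U>" "infinite N" using U unfolding universe_def by blast
  obtain x y where xy: "x \<in> N" "y \<in> N" "x \<noteq> y"
    using N(2) by (metis finite.emptyI finite_insert finite_subset insertCI subsetI)
  have "{x, y} \<in> \<U>" using xy by (intro universe_lepoll[OF U N(1)] subset_imp_lepoll) auto
  then have "(\<Union>i\<in>{x, y}. if i = x then A else B) \<in> \<U>"
    by (rule universe_UN[OF U]) (use A B in auto)
  then show ?thesis using xy by (auto simp: Un_commute)
qed

lemma times_self_lepoll: "infinite A \<Longrightarrow> A \<times> A \<lesssim> A"
  using card_of_Times_same_infinite[of A] unfolding card_of_ordIso[symmetric]
  by (auto simp: bij_betw_def lepoll_def)

lemma universe_Times:
  assumes U: "universe \<U>" and A: "A \<in> \<U>" and B: "B \<in> \<U>"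
  shows "small \<U> (A \<times> B)"
proof -
  obtain N where N: "N \<in> \<U>" "infinite N" using U unfolding universe_def by blast
  let ?W = "A \<union> (B \<union> N)"
  have "?W \<in> \<U>" using universe_Un[OF U A universe_Un[OF U B N(1)]] .
  then have "small \<U> (?W \<times> ?W)"
    using times_self_lepoll[of ?W] N(2) unfolding small_def by blast
  then show ?thesis by (rule small_subset) auto
qed

lemma small_code:
  fixes \<U> :: "'v set set"
  assumes U: "universe \<U>" and A: "small \<U> A"
  shows "\<exists>f :: 'a \<Rightarrow> 'v. inj_on f A \<and> f ` A \<in> \<U>"
proof -
  obtain B f where f: "B \<in> \<U>" "inj_on f A" "f ` A \<subseteq> B"
    using A unfolding small_def lepoll_def by blast
  have "f ` A \<lesssim> B" using f(3) by (rule subset_imp_lepoll)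
  then have "f ` A \<in> \<U>" by (rule universe_lepoll[OF U f(1)])
  then show ?thesis using f(2) by blast
qed

lemma small_Sigma:
  fixes \<U> :: "'v set set"
  assumes U: "universe \<U>" and I: "small \<U> I" and A: "\<And>i. i \<in> I \<Longrightarrow> small \<U> (A i)"
  shows "small \<U> (Sigma I A)"
proof -
  obtain f :: "_ \<Rightarrow> 'v" where f: "inj_on f I" "f ` I \<in> \<U>"
    using small_code[OF U I] by blast
  have "\<forall>i. \<exists>h. i \<in> I \<longrightarrow> inj_on h (A i) \<and> h ` A i \<in> \<U>"
    using small_code[OF U A] by blast
  then obtain h where h: "\<And>i. i \<in> I \<Longrightarrow> inj_on (h i) (A i)" "\<And>i. i \<in> I \<Longrightarrow> h i ` A i \<in> \<U>"
    unfolding choice_iff by blast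
  define K where "K = (\<Union>j\<in>f ` I. h (inv_into I f j) ` A (inv_into I f j))"
  have "K \<in> \<U>" unfolding K_def by (rule universe_UN[OF U f(2)]) (use h(2) f(1) in auto)
  then have "small \<U> (f ` I \<times> K)" using universe_Times[OF U f(2)] by blast
  moreover have "inj_on (\<lambda>(i, a). (f i, h i a)) (Sigma I A)"
    using f(1) h(1) by (auto simp: inj_on_def)
  moreover have "(\<lambda>(i, a). (f i, h i a)) ` Sigma I A \<subseteq> f ` I \<times> K"
    using f(1) by (auto simp: K_def)
  ultimately show ?thesis by (rule small_inj_on)
qed

lemma small_quotient:
  assumes "small (\<U> :: 'v set set) S"
    and refl: "\<And>x. x \<in> S \<Longrightarrow> R x x"
    and sym: "\<And>x y. x \<in> S \<Longrightarrow> y \<in> S \<Longrightarrow> R x y \<Longrightarrow> R y x"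
    and trans: "\<And>x y z. x \<in> S \<Longrightarrow> y \<in> S \<Longrightarrow> z \<in> S \<Longrightarrow> R x y \<Longrightarrow> R y z \<Longrightarrow> R x z"
  shows "\<exists>q :: 'a \<Rightarrow> 'v. \<forall>x\<in>S. \<forall>y\<in>S. q x = q y \<longleftrightarrow> R x y"
proof -
  obtain e :: "'a \<Rightarrow> 'v" where e: "inj_on e S" using small_inj_exists[OF assms(1)] by blast
  define r where "r x = (SOME y. y \<in> S \<and> R x y)" for x
  have r: "r x \<in> S \<and> R x (r x)" if "x \<in> S" for x
    unfolding r_def using someI[of "\<lambda>y. y \<in> S \<and> R x y" x] refl that by blast
  have "e (r x) = e (r y) \<longleftrightarrow> R x y" if "x \<in> S" "y \<in> S" for x y
  proof
    assume "e (r x) = e (r y)"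
    then have "r x = r y" using r that e by (auto dest: inj_onD)
    then have "r x \<in> S" "R x (r x)" "R y (r x)" using r[OF that(1)] r[OF that(2)] by auto
    then show "R x y" using sym[OF that(2)] trans[OF that(1) _ that(2)] by blast
  next
    assume "R x y"
    then have "(z \<in> S \<and> R x z) = (z \<in> S \<and> R y z)" for z
      using trans[OF that(2,1), of z] trans[OF that(1,2), of z] sym[OF that] by blast
    then show "e (r x) = e (r y)" by (simp add: r_def)
  qed
  then show ?thesis by (intro exI[of _ "\<lambda>x. e (r x)"]) simp
qed

definition lift :: "'a set \<Rightarrow> ('a \<Rightarrow> 'b) \<Rightarrow> ('a \<Rightarrow> 'c) \<Rightarrow> 'b \<Rightarrow> 'c" where
  "lift S q f z = f (inv_into S q z)"

lemma lift_eq: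
  assumes "\<And>y. y \<in> S \<Longrightarrow> q y = q x \<Longrightarrow> f y = f x" and "x \<in> S"
  shows "lift S q f (q x) = f x"
  unfolding lift_def using assms(2) by (intro assms(1) inv_into_into f_inv_into_f) auto


section \<open>Presheaves\<close>

lemma SetC_simps [simp]:
  "X \<in> obj (SetC \<U>) \<longleftrightarrow> small \<U> X"
  "ide (SetC \<U>) X = (X, X, \<lambda>x\<in>X. x)"
  "cmp (SetC \<U>) (Y', Z, g) (X, Y, f) = (X, Z, \<lambda>x\<in>X. g (f x))"
  by (simp_all add: SetC_def)

lemma homs_SetC:
  "homs (SetC \<U>) X Y = {(X, Y, f) | f. small \<U> X \<and> small \<U> Y \<and> f \<in> X \<rightarrow>\<^sub>E Y}"
  by (auto simp: homs_def SetC_def)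

lemma app_simp [simp]: "app (X, Y, f) x = f x"
  by (simp add: app_def)

lemma category_SetC: "category (SetC \<U>)"
proof unfold_locales
  fix f assume "f \<in> arr (SetC \<U>)"
  then show "src (SetC \<U>) f \<in> obj (SetC \<U>)" "trg (SetC \<U>) f \<in> obj (SetC \<U>)"
    by (auto simp: SetC_def)
next
  fix a :: "'a set" assume "a \<in> obj (SetC \<U>)"
  then show "ide (SetC \<U>) a \<in> homs (SetC \<U>) a a" by (auto simp: homs_SetC)
next
  fix f g and a b c :: "'a set" assume "f \<in> homs (SetC \<U>) a b" "g \<in> homs (SetC \<U>) b c"
  then show "cmp (SetC \<U>) g f \<in> homs (SetC \<U>) a c" by (fastforce simp: homs_SetC)
next
  fix f and a b :: "'a set" assume "f \<in> homs (SetC \<U>) a b"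
  then show "cmp (SetC \<U>) (ide (SetC \<U>) b) f = f" "cmp (SetC \<U>) f (ide (SetC \<U>) a) = f"
    by (auto simp: homs_SetC fun_eq_iff PiE_def extensional_def)
next
  fix f g h and a b c d :: "'a set"
  assume "f \<in> homs (SetC \<U>) a b" "g \<in> homs (SetC \<U>) b c" "h \<in> homs (SetC \<U>) c d"
  then show "cmp (SetC \<U>) h (cmp (SetC \<U>) g f) = cmp (SetC \<U>) (cmp (SetC \<U>) h g) f"
    by (auto simp: homs_SetC fun_eq_iff)
qed

lemma app_homs: "t \<in> homs (SetC \<U>) X Y \<Longrightarrow> x \<in> X \<Longrightarrow> app t x \<in> Y"
  by (auto simp: homs_SetC)

lemma app_cmp:
  "t \<in> homs (SetC \<U>) X Y \<Longrightarrow> s \<in> homs (SetC \<U>) Y Z \<Longrightarrow> x \<in> X \<Longrightarrow>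
    app (cmp (SetC \<U>) s t) x = app s (app t x)"
  by (auto simp: homs_SetC)

lemma SetC_ext:
  "t \<in> homs (SetC \<U>) X Y \<Longrightarrow> s \<in> homs (SetC \<U>) X Y \<Longrightarrow> (\<And>x. x \<in> X \<Longrightarrow> app t x = app s x) \<Longrightarrow> t = s"
  by (clarsimp simp: homs_SetC) (erule PiE_ext, assumption, simp)

lemma SetC_homsI:
  "small \<U> X \<Longrightarrow> small \<U> Y \<Longrightarrow> (\<And>x. x \<in> X \<Longrightarrow> f x \<in> Y) \<Longrightarrow>
    (X, Y, \<lambda>x\<in>X. f x) \<in> homs (SetC \<U>) X Y"
  by (auto simp: homs_SetC)

lemma SetC_isoI:
  assumes t: "t \<in> homs (SetC \<U>) X Y" and b: "bij_betw (app t) X Y"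
  shows "t \<in> iso (SetC \<U>) X Y"
proof -
  let ?s = "(Y, X, \<lambda>y\<in>Y. inv_into X (app t) y)"
  have sm: "small \<U> X" "small \<U> Y" using t by (auto simp: homs_SetC)
  have s: "?s \<in> homs (SetC \<U>) Y X"
    using SetC_homsI[OF sm(2,1)] bij_betwE[OF bij_betw_inv_into[OF b]] by blast
  interpret category "SetC \<U>" by (rule category_SetC)
  have "cmp (SetC \<U>) ?s t = ide (SetC \<U>) X"
    by (rule SetC_ext[OF cmp_homs[OF t s] ide_homs])
      (use sm t b bij_betw_inv_into_left[OF b] in \<open>auto simp: app_cmp[OF t s] app_homs\<close>)
  moreover have "cmp (SetC \<U>) t ?s = ide (SetC \<U>) Y"
    by (rule SetC_ext[OF cmp_homs[OF s t] ide_homs])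
      (use sm bij_betw_inv_into_right[OF b] in \<open>auto simp: app_cmp[OF s t]\<close>)
  ultimately show ?thesis using t s unfolding iso_def by blast
qed

lemma category_PSh: "category A \<Longrightarrow> category (PSh \<U> A)"
  unfolding PSh_def by (intro category_Fun category_opp category_SetC)

lemma homs_PSh: "homs (PSh \<U> A) P Q = {(P, Q, \<tau>) | \<tau>. nat_trans (opp A) (SetC \<U>) P Q \<tau>}"
  by (simp add: PSh_def homs_Fun)

lemma presheafD:
  assumes "is_functor (opp A) (SetC \<U>) P"
  shows "a \<in> obj A \<Longrightarrow> small \<U> (fob P a)"
    "f \<in> homs A a b \<Longrightarrow> far P f \<in> homs (SetC \<U>) (fob P b) (fob P a)"
    "f \<in> homs A a b \<Longrightarrow> x \<in> fob P b \<Longrightarrow> app (far P f) x \<in> fob P a"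
    "a \<in> obj A \<Longrightarrow> x \<in> fob P a \<Longrightarrow> app (far P (ide A a)) x = x"
    "f \<in> homs A a b \<Longrightarrow> g \<in> homs A b c \<Longrightarrow> x \<in> fob P c \<Longrightarrow>
      app (far P (cmp A g f)) x = app (far P f) (app (far P g) x)"
proof -
  interpret is_functor "opp A" "SetC \<U>" P by fact
  show "a \<in> obj A \<Longrightarrow> small \<U> (fob P a)" using fob_obj[of a] by simp
  show h: "f \<in> homs A a b \<Longrightarrow> far P f \<in> homs (SetC \<U>) (fob P b) (fob P a)" for f a b
    using far_homs[of f b a] by simp
  show "f \<in> homs A a b \<Longrightarrow> x \<in> fob P b \<Longrightarrow> app (far P f) x \<in> fob P a"
    using h app_homs by metis
  show "a \<in> obj A \<Longrightarrow> x \<in> fob P a \<Longrightarrow> app (far P (ide A a)) x = x"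
    using far_ide[of a] by simp
  show "f \<in> homs A a b \<Longrightarrow> g \<in> homs A b c \<Longrightarrow> x \<in> fob P c \<Longrightarrow>
      app (far P (cmp A g f)) x = app (far P f) (app (far P g) x)"
    using far_cmp[of g c b f a] app_cmp[OF h h] by simp
qed

lemma presheafI:
  assumes "category A"
    and S: "\<And>a. a \<in> obj A \<Longrightarrow> small \<U> (S a)"
    and r: "\<And>f a b x. f \<in> homs A a b \<Longrightarrow> x \<in> S b \<Longrightarrow> r f x \<in> S a"
    and r_ide: "\<And>a x. a \<in> obj A \<Longrightarrow> x \<in> S a \<Longrightarrow> r (ide A a) x = x"
    and r_cmp: "\<And>f g a b c x. f \<in> homs A a b \<Longrightarrow> g \<in> homs A b c \<Longrightarrow> x \<in> S c \<Longrightarrow>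
      r (cmp A g f) x = r f (r g x)"
  shows "is_functor (opp A) (SetC \<U>)
    \<lparr>fob = (\<lambda>a\<in>obj A. S a), far = (\<lambda>f\<in>arr A. (S (trg A f), S (src A f), \<lambda>x\<in>S (trg A f). r f x))\<rparr>"
proof -
  interpret A: category A by fact
  interpret A': category "opp A" by (rule category_opp) fact
  interpret S: category "SetC \<U>" by (rule category_SetC)
  show ?thesis
  proof unfold_locales
    fix f a b assume "f \<in> homs (opp A) a b"
    then have f: "f \<in> homs A b a" by simp
    then show "far \<lparr>fob = (\<lambda>a\<in>obj A. S a), far = (\<lambda>f\<in>arr A. (S (trg A f), S (src A f), \<lambda>x\<in>S (trg A f). r f x))\<rparr> f
      \<in> homs (SetC \<U>) (fob \<lparr>fob = (\<lambda>a\<in>obj A. S a), far = (\<lambda>f\<in>arr A. (S (trg A f), S (src A f), \<lambda>x\<in>S (trg A f). r f x))\<rparr> a)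
         (fob \<lparr>fob = (\<lambda>a\<in>obj A. S a), far = (\<lambda>f\<in>arr A. (S (trg A f), S (src A f), \<lambda>x\<in>S (trg A f). r f x))\<rparr> b)"
      using homsD[OF f] A.homs_obj[OF f] S r[OF f] by (auto simp: homs_SetC)
  next
    fix a assume "a \<in> obj (opp A)"
    then have a: "a \<in> obj A" by simp
    then show "far \<lparr>fob = (\<lambda>a\<in>obj A. S a), far = (\<lambda>f\<in>arr A. (S (trg A f), S (src A f), \<lambda>x\<in>S (trg A f). r f x))\<rparr> (ide (opp A) a)
      = ide (SetC \<U>) (fob \<lparr>fob = (\<lambda>a\<in>obj A. S a), far = (\<lambda>f\<in>arr A. (S (trg A f), S (src A f), \<lambda>x\<in>S (trg A f). r f x))\<rparr> a)"
      using homsD[OF A.ide_homs[OF a]] r_ide[OF a] by (simp cong: restrict_cong)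
  next
    fix f g a b c assume "f \<in> homs (opp A) a b" "g \<in> homs (opp A) b c"
    then have f: "f \<in> homs A b a" and g: "g \<in> homs A c b" by simp_all
    show "far \<lparr>fob = (\<lambda>a\<in>obj A. S a), far = (\<lambda>f\<in>arr A. (S (trg A f), S (src A f), \<lambda>x\<in>S (trg A f). r f x))\<rparr> (cmp (opp A) g f)
      = cmp (SetC \<U>) (far \<lparr>fob = (\<lambda>a\<in>obj A. S a), far = (\<lambda>f\<in>arr A. (S (trg A f), S (src A f), \<lambda>x\<in>S (trg A f). r f x))\<rparr> g)
          (far \<lparr>fob = (\<lambda>a\<in>obj A. S a), far = (\<lambda>f\<in>arr A. (S (trg A f), S (src A f), \<lambda>x\<in>S (trg A f). r f x))\<rparr> f)"
      using homsD[OF f] homsD[OF g] homsD[OF A.cmp_homs[OF g f]] r[OF f] r_cmp[OF g f]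
      by (simp cong: restrict_cong)
  qed (auto simp: S)
qed

lemma presheaf_homD:
  assumes "(P, Q, \<tau>) \<in> homs (PSh \<U> A) P Q"
  shows "is_functor (opp A) (SetC \<U>) P" "is_functor (opp A) (SetC \<U>) Q"
    "a \<in> obj A \<Longrightarrow> \<tau> a \<in> homs (SetC \<U>) (fob P a) (fob Q a)"
    "a \<in> obj A \<Longrightarrow> x \<in> fob P a \<Longrightarrow> app (\<tau> a) x \<in> fob Q a"
    "f \<in> homs A a b \<Longrightarrow> x \<in> fob P b \<Longrightarrow> app (\<tau> a) (app (far P f) x) = app (far Q f) (app (\<tau> b) x)"
proof -
  have n: "nat_trans (opp A) (SetC \<U>) P Q \<tau>" using assms by (simp add: homs_PSh)
  note d = nat_transD[OF n]
  show "is_functor (opp A) (SetC \<U>) P" "is_functor (opp A) (SetC \<U>) Q" using d(1,2) .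
  show t: "a \<in> obj A \<Longrightarrow> \<tau> a \<in> homs (SetC \<U>) (fob P a) (fob Q a)" for a using d(4)[of a] by simp
  show "a \<in> obj A \<Longrightarrow> x \<in> fob P a \<Longrightarrow> app (\<tau> a) x \<in> fob Q a" using t app_homs by metis
  assume f: "f \<in> homs A a b" and x: "x \<in> fob P b"
  interpret is_functor "opp A" "SetC \<U>" P by (fact d(1))
  have ab: "a \<in> obj A" "b \<in> obj A" using A.homs_obj[of f b a] f by auto
  show "app (\<tau> a) (app (far P f) x) = app (far Q f) (app (\<tau> b) x)"
    using d(5)[of f b a] f app_cmp[OF presheafD(2)[OF d(1) f] t[OF ab(1)] x]
      app_cmp[OF t[OF ab(2)] presheafD(2)[OF d(2) f] x] by simp
qed

lemma presheaf_homI: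
  assumes P: "is_functor (opp A) (SetC \<U>) P" and Q: "is_functor (opp A) (SetC \<U>) Q"
    and t: "\<And>a x. a \<in> obj A \<Longrightarrow> x \<in> fob P a \<Longrightarrow> t a x \<in> fob Q a"
    and nat: "\<And>f a b x. f \<in> homs A a b \<Longrightarrow> x \<in> fob P b \<Longrightarrow> t a (app (far P f) x) = app (far Q f) (t b x)"
  shows "(P, Q, \<lambda>a\<in>obj A. (fob P a, fob Q a, \<lambda>x\<in>fob P a. t a x)) \<in> homs (PSh \<U> A) P Q"
proof -
  interpret S: category "SetC \<U>" by (rule category_SetC)
  interpret is_functor "opp A" "SetC \<U>" P by (fact P)
  have h: "(fob P a, fob Q a, \<lambda>x\<in>fob P a. t a x) \<in> homs (SetC \<U>) (fob P a) (fob Q a)" if "a \<in> obj A" for a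
    using presheafD(1)[OF P that] presheafD(1)[OF Q that] t[OF that] by (rule SetC_homsI)
  have "nat_trans (opp A) (SetC \<U>) P Q (\<lambda>a\<in>obj A. (fob P a, fob Q a, \<lambda>x\<in>fob P a. t a x))"
  proof (rule nat_transI[OF P Q])
    fix f a b assume "f \<in> homs (opp A) a b"
    then have f: "f \<in> homs A b a" by simp
    have ab: "a \<in> obj A" "b \<in> obj A" using A.homs_obj[of f a b] f by auto
    note Pf = presheafD(2)[OF P f] and Qf = presheafD(2)[OF Q f]
    show "cmp (SetC \<U>) ((\<lambda>a\<in>obj A. (fob P a, fob Q a, \<lambda>x\<in>fob P a. t a x)) b) (far P f)
      = cmp (SetC \<U>) (far Q f) ((\<lambda>a\<in>obj A. (fob P a, fob Q a, \<lambda>x\<in>fob P a. t a x)) a)"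
    proof (rule SetC_ext)
      fix x assume x: "x \<in> fob P a"
      show "app (cmp (SetC \<U>) ((\<lambda>a\<in>obj A. (fob P a, fob Q a, \<lambda>x\<in>fob P a. t a x)) b) (far P f)) x
        = app (cmp (SetC \<U>) (far Q f) ((\<lambda>a\<in>obj A. (fob P a, fob Q a, \<lambda>x\<in>fob P a. t a x)) a)) x"
        using nat[OF f x] x ab app_cmp[OF Pf h[OF ab(2)] x] app_cmp[OF h[OF ab(1)] Qf x]
          presheafD(3)[OF P f x] by simp
    qed (use S.cmp_homs[OF Pf h] S.cmp_homs[OF h Qf] ab in auto)
  qed (use h in auto)
  then show ?thesis by (simp add: homs_PSh)
qed

lemma presheaf_hom_ext:
  assumes "(P, Q, \<tau>) \<in> homs (PSh \<U> A) P Q" "(P, Q, \<sigma>) \<in> homs (PSh \<U> A) P Q"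
    and "\<And>a x. a \<in> obj A \<Longrightarrow> x \<in> fob P a \<Longrightarrow> app (\<tau> a) x = app (\<sigma> a) x"
  shows "\<tau> = \<sigma>"
proof (rule extensionalityI[of _ "obj A"])
  show "\<tau> \<in> extensional (obj A)" "\<sigma> \<in> extensional (obj A)"
    using assms(1,2) nat_transD(3) by (fastforce simp: homs_PSh)+
  fix a assume a: "a \<in> obj A"
  show "\<tau> a = \<sigma> a"
    by (rule SetC_ext[OF presheaf_homD(3)[OF assms(1) a] presheaf_homD(3)[OF assms(2) a]])
      (use assms(3) a in auto)
qed

lemma presheaf_isoI:
  assumes t: "(P, Q, \<tau>) \<in> homs (PSh \<U> A) P Q"
    and b: "\<And>a. a \<in> obj A \<Longrightarrow> bij_betw (app (\<tau> a)) (fob P a) (fob Q a)"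
  shows "iso (PSh \<U> A) P Q \<noteq> {}"
proof -
  have "isomorphic (Fun (opp A) (SetC \<U>)) P Q"
    by (rule isomorphic_FunI[of _ _ _ _ \<tau>])
      (use t SetC_isoI[OF presheaf_homD(3)[OF t] b] in \<open>auto simp: homs_PSh\<close>)
  then show ?thesis by (simp add: isomorphic_def PSh_def)
qed

lemma iso_full_sub: "a \<in> X \<Longrightarrow> b \<in> X \<Longrightarrow> iso (full_sub C X) a b = iso C a b"
  by (simp add: iso_def homs_full_sub)

lemma is_functor_hom_presheaf:
  assumes "is_functor A B F" and "X \<in> obj B"
    and small: "\<And>a. a \<in> obj A \<Longrightarrow> small \<U> (homs B (fob F a) X)"
  shows "is_functor (opp A) (SetC \<U>) (hom_presheaf A B F X)"
proof -
  interpret is_functor A B F by fact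
  show ?thesis unfolding hom_presheaf_def
  proof (rule presheafI)
    show "category A" by unfold_locales
    show "a \<in> obj A \<Longrightarrow> small \<U> (homs B (fob F a) X)" for a by (fact small)
    show "cmp B x (far F f) \<in> homs B (fob F a) X" if "f \<in> homs A a b" "x \<in> homs B (fob F b) X" for f a b x
      using B.cmp_homs[OF far_homs[OF that(1)] that(2)] .
    show "cmp B x (far F (ide A a)) = x" if "a \<in> obj A" "x \<in> homs B (fob F a) X" for a x
      using far_ide[OF that(1)] B.cmp_ide_right[OF that(2)] by simp
    show "cmp B x (far F (cmp A g f)) = cmp B (cmp B x (far F g)) (far F f)"
      if "f \<in> homs A a b" "g \<in> homs A b c" "x \<in> homs B (fob F c) X" for f g a b c x
      using far_cmp[OF that(1,2)] B.cmp_assoc[OF far_homs[OF that(1)] far_homs[OF that(2)] that(3)] by simp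
  qed
qed

lemma fob_hom_presheaf: "a \<in> obj A \<Longrightarrow> fob (hom_presheaf A B F X) a = homs B (fob F a) X"
  by (simp add: hom_presheaf_def)

lemma far_hom_presheaf:
  "f \<in> homs A a b \<Longrightarrow> h \<in> homs B (fob F b) X \<Longrightarrow> app (far (hom_presheaf A B F X) f) h = cmp B h (far F f)"
  by (auto simp: hom_presheaf_def homs_def)

lemma hom_functor_simps:
  "X \<in> obj B \<Longrightarrow> fob (hom_functor A B F) X = hom_presheaf A B F X"
  "g \<in> homs B X Y \<Longrightarrow> far (hom_functor A B F) g =
    (hom_presheaf A B F X, hom_presheaf A B F Y,
     \<lambda>a\<in>obj A. (homs B (fob F a) X, homs B (fob F a) Y, \<lambda>h\<in>homs B (fob F a) X. cmp B g h))"
  by (auto simp: hom_functor_def homs_def)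

lemma is_functor_hom_functor:
  assumes F: "is_functor A B F"
    and small: "\<And>a X. a \<in> obj A \<Longrightarrow> X \<in> obj B \<Longrightarrow> small \<U> (homs B (fob F a) X)"
  shows "is_functor B (PSh \<U> A) (hom_functor A B F)"
proof -
  interpret is_functor A B F by fact
  interpret P: category "PSh \<U> A" by (rule category_PSh) unfold_locales
  have hp: "is_functor (opp A) (SetC \<U>) (hom_presheaf A B F X)" if "X \<in> obj B" for X
    using is_functor_hom_presheaf[OF F that small[OF _ that]] .
  have hh: "far (hom_functor A B F) g \<in> homs (PSh \<U> A) (fob (hom_functor A B F) X) (fob (hom_functor A B F) Y)"
    if g: "g \<in> homs B X Y" for g X Y
  proof -
    note XY = B.homs_obj[OF g]
    have "(hom_presheaf A B F X, hom_presheaf A B F Y,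
        \<lambda>a\<in>obj A. (fob (hom_presheaf A B F X) a, fob (hom_presheaf A B F Y) a,
          \<lambda>h\<in>fob (hom_presheaf A B F X) a. cmp B g h))
      \<in> homs (PSh \<U> A) (hom_presheaf A B F X) (hom_presheaf A B F Y)"
    proof (rule presheaf_homI[OF hp[OF XY(1)] hp[OF XY(2)]])
      fix a x assume "a \<in> obj A" "x \<in> fob (hom_presheaf A B F X) a"
      then show "cmp B g x \<in> fob (hom_presheaf A B F Y) a"
        using B.cmp_homs[OF _ g] by (simp add: fob_hom_presheaf)
    next
      fix f a b x assume f: "f \<in> homs A a b" and "x \<in> fob (hom_presheaf A B F X) b"
      then have x: "x \<in> homs B (fob F b) X" using A.homs_obj[OF f] by (simp add: fob_hom_presheaf)
      show "cmp B g (app (far (hom_presheaf A B F X) f) x) = app (far (hom_presheaf A B F Y) f) (cmp B g x)"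
        using far_hom_presheaf[OF f x] far_hom_presheaf[OF f B.cmp_homs[OF x g]]
          B.cmp_assoc[OF far_homs[OF f] x g] by simp
    qed
    moreover have "(\<lambda>a\<in>obj A. (fob (hom_presheaf A B F X) a, fob (hom_presheaf A B F Y) a,
          \<lambda>h\<in>fob (hom_presheaf A B F X) a. cmp B g h)) =
      (\<lambda>a\<in>obj A. (homs B (fob F a) X, homs B (fob F a) Y, \<lambda>h\<in>homs B (fob F a) X. cmp B g h))"
      by (simp add: fob_hom_presheaf cong: restrict_cong)
    ultimately show ?thesis using XY by (simp add: hom_functor_simps(1) hom_functor_simps(2)[OF g])
  qed
  show ?thesis
  proof unfold_locales
    fix f X Y assume "f \<in> homs B X Y"
    then show "far (hom_functor A B F) f \<in> homs (PSh \<U> A) (fob (hom_functor A B F) X) (fob (hom_functor A B F) Y)"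
      by (rule hh)
  next
    fix X assume X: "X \<in> obj B"
    then show "far (hom_functor A B F) (ide B X) = ide (PSh \<U> A) (fob (hom_functor A B F) X)"
      using B.cmp_ide_left
      by (simp add: hom_functor_simps(1) hom_functor_simps(2)[OF B.ide_homs] PSh_def fob_hom_presheaf cong: restrict_cong)
  next
    fix f g X Y Z assume f: "f \<in> homs B X Y" and g: "g \<in> homs B Y Z"
    show "far (hom_functor A B F) (cmp B g f) =
      cmp (PSh \<U> A) (far (hom_functor A B F) g) (far (hom_functor A B F) f)"
      using B.cmp_assoc[OF _ f g] B.cmp_homs[OF _ f]
      by (simp add: hom_functor_simps(2)[OF f] hom_functor_simps(2)[OF g] hom_functor_simps(2)[OF B.cmp_homs[OF f g]]
          PSh_def cong: restrict_cong)
  qed (auto simp: hom_functor_def PSh_def hp)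
qed


section \<open>Continuous actions\<close>

lemma group_Aut:
  assumes "category D" and "u \<in> obj D"
  shows "group (Aut D u)"
proof -
  interpret category D by fact
  have isoD: "f \<in> homs D u u" if "f \<in> iso D u u" for f using that by (simp add: iso_def)
  show ?thesis
  proof (rule groupI)
    fix x y assume "x \<in> carrier (Aut D u)" "y \<in> carrier (Aut D u)"
    then obtain x' y' where x: "x \<in> homs D u u" "x' \<in> homs D u u" "cmp D x' x = ide D u" "cmp D x x' = ide D u"
      and y: "y \<in> homs D u u" "y' \<in> homs D u u" "cmp D y' y = ide D u" "cmp D y y' = ide D u"
      by (auto simp: Aut_def iso_def)
    have inv: "cmp D (cmp D q' p') (cmp D p q) = ide D u"
      if "p \<in> homs D u u" "p' \<in> homs D u u" "q \<in> homs D u u" "q' \<in> homs D u u"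
        "cmp D p' p = ide D u" "cmp D q' q = ide D u" for p p' q q'
    proof -
      have "cmp D (cmp D q' p') (cmp D p q) = cmp D q' (cmp D p' (cmp D p q))"
        by (rule cmp_assoc[OF cmp_homs[OF that(3,1)] that(2,4), symmetric])
      also have "cmp D p' (cmp D p q) = cmp D (cmp D p' p) q" by (rule cmp_assoc[OF that(3,1,2)])
      also have "\<dots> = q" using that cmp_ide_left by simp
      finally show ?thesis using that by simp
    qed
    show "x \<otimes>\<^bsub>Aut D u\<^esub> y \<in> carrier (Aut D u)"
      using inv[of x x' y y'] inv[of y' y x' x] x y cmp_homs[OF y(1) x(1)] cmp_homs[OF x(2) y(2)]
      by (auto simp: Aut_def iso_def intro!: bexI[of _ "cmp D y' x'"])
  next
    fix x assume "x \<in> carrier (Aut D u)"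
    then show "\<exists>y\<in>carrier (Aut D u). y \<otimes>\<^bsub>Aut D u\<^esub> x = \<one>\<^bsub>Aut D u\<^esub>"
      by (auto simp: Aut_def iso_def)
  next
    fix x y z assume "x \<in> carrier (Aut D u)" "y \<in> carrier (Aut D u)" "z \<in> carrier (Aut D u)"
    then have "x \<in> homs D u u" "y \<in> homs D u u" "z \<in> homs D u u" by (auto simp: Aut_def isoD)
    then show "x \<otimes>\<^bsub>Aut D u\<^esub> y \<otimes>\<^bsub>Aut D u\<^esub> z = x \<otimes>\<^bsub>Aut D u\<^esub> (y \<otimes>\<^bsub>Aut D u\<^esub> z)"
      by (simp add: Aut_def cmp_assoc)
  next
    show "\<one>\<^bsub>Aut D u\<^esub> \<in> carrier (Aut D u)"
      using ide_homs[OF assms(2)] cmp_ide_left[OF ide_homs[OF assms(2)]] by (auto simp: Aut_def iso_def)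
    fix x assume "x \<in> carrier (Aut D u)"
    then show "\<one>\<^bsub>Aut D u\<^esub> \<otimes>\<^bsub>Aut D u\<^esub> x = x" by (simp add: Aut_def cmp_ide_left[OF isoD])
  qed
qed

lemma group_actionI:
  assumes "group G"
    and closed: "\<And>g x. g \<in> carrier G \<Longrightarrow> x \<in> X \<Longrightarrow> \<phi> g x \<in> X"
    and ext: "\<And>g. g \<in> carrier G \<Longrightarrow> \<phi> g \<in> extensional X"
    and one: "\<And>x. x \<in> X \<Longrightarrow> \<phi> \<one>\<^bsub>G\<^esub> x = x"
    and mult: "\<And>g h x. g \<in> carrier G \<Longrightarrow> h \<in> carrier G \<Longrightarrow> x \<in> X \<Longrightarrow> \<phi> (g \<otimes>\<^bsub>G\<^esub> h) x = \<phi> g (\<phi> h x)"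
  shows "group_action G X \<phi>"
proof -
  interpret group G by fact
  have bij: "\<phi> g \<in> Bij X" if g: "g \<in> carrier G" for g
  proof -
    have "bij_betw (\<phi> g) X X"
      by (rule bij_betw_byWitness[of _ "\<phi> (inv\<^bsub>G\<^esub> g)"])
        (use g closed one mult[OF inv_closed[OF g] g] mult[OF g inv_closed[OF g]] in auto)
    then show ?thesis using ext[OF g] by (simp add: Bij_def)
  qed
  have "group_hom G (BijGroup X) \<phi>"
  proof (intro group_hom.intro group_hom_axioms.intro homI)
    show "group (BijGroup X)" by (rule group_BijGroup)
    show "g \<in> carrier G \<Longrightarrow> \<phi> g \<in> carrier (BijGroup X)" for g using bij by (simp add: BijGroup_def)
    fix g h assume gh: "g \<in> carrier G" "h \<in> carrier G"
    have "\<phi> (g \<otimes>\<^bsub>G\<^esub> h) = compose X (\<phi> g) (\<phi> h)"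
      by (rule extensionalityI[of _ X]) (use ext[OF m_closed[OF gh]] mult[OF gh] in \<open>auto simp: compose_def\<close>)
    then show "\<phi> (g \<otimes>\<^bsub>G\<^esub> h) = \<phi> g \<otimes>\<^bsub>BijGroup X\<^esub> \<phi> h" using gh bij by (simp add: BijGroup_def)
  qed (rule assms(1))
  then show ?thesis by (simp add: group_action_def)
qed

lemma group_actionD:
  assumes "group_action G X \<phi>"
  shows "g \<in> carrier G \<Longrightarrow> x \<in> X \<Longrightarrow> \<phi> g x \<in> X"
    "g \<in> carrier G \<Longrightarrow> \<phi> g \<in> extensional X"
    "x \<in> X \<Longrightarrow> \<phi> \<one>\<^bsub>G\<^esub> x = x"
    "g \<in> carrier G \<Longrightarrow> h \<in> carrier G \<Longrightarrow> x \<in> X \<Longrightarrow> \<phi> (g \<otimes>\<^bsub>G\<^esub> h) x = \<phi> g (\<phi> h x)"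
    "g \<in> carrier G \<Longrightarrow> x \<in> X \<Longrightarrow> \<phi> (inv\<^bsub>G\<^esub> g) (\<phi> g x) = x"
proof -
  interpret group_action G X \<phi> by fact
  show "g \<in> carrier G \<Longrightarrow> x \<in> X \<Longrightarrow> \<phi> g x \<in> X" using element_image by blast
  show "g \<in> carrier G \<Longrightarrow> \<phi> g \<in> extensional X" using bij_prop0 by (auto simp: Bij_def)
  show "x \<in> X \<Longrightarrow> \<phi> \<one>\<^bsub>G\<^esub> x = x" using id_eq_one by (metis restrict_apply')
  show "g \<in> carrier G \<Longrightarrow> h \<in> carrier G \<Longrightarrow> x \<in> X \<Longrightarrow> \<phi> (g \<otimes>\<^bsub>G\<^esub> h) x = \<phi> g (\<phi> h x)"
    using composition_rule by blast
  show "g \<in> carrier G \<Longrightarrow> x \<in> X \<Longrightarrow> \<phi> (inv\<^bsub>G\<^esub> g) (\<phi> g x) = x" using orbit_sym_aux by blast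
qed

lemma continuous_action_iff:
  assumes B: "algebraic_base G B"
  shows "continuous_action G (base_topology G B) (X, \<phi>) \<longleftrightarrow>
    group_action G X \<phi> \<and> (\<forall>x\<in>X. \<exists>H\<in>B. \<forall>h\<in>H. \<phi> h x = x)"
proof -
  define T where "T = base_topology G B"
  have T: "topological_group G T" "nhds_basis T \<one>\<^bsub>G\<^esub> B"
    using theI'[OF base_topology_ex1[OF B]] by (simp_all add: T_def base_topology_def)
  interpret group G using B by (simp add: algebraic_base_def)
  have nb1: "\<exists>U. openin T U \<and> \<one>\<^bsub>G\<^esub> \<in> U \<and> U \<subseteq> H" if "H \<in> B" for H
    using T(2) that by (simp add: nhds_basis_def)
  have nb2: "\<exists>H\<in>B. H \<subseteq> U" if "openin T U" "\<one>\<^bsub>G\<^esub> \<in> U" for U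
    using T(2) that by (simp add: nhds_basis_def)
  have ts: "topspace T = carrier G" using T(1) by (simp add: topological_group_def)
  have cm: "continuous_map (prod_topology T T) T (\<lambda>(x, y). x \<otimes>\<^bsub>G\<^esub> y)"
    using T(1) by (simp add: topological_group_def)
  have tr: "continuous_map T T (\<lambda>y. x \<otimes>\<^bsub>G\<^esub> y)" if "x \<in> carrier G" for x
    using continuous_map_compose[OF _ cm, of T "\<lambda>y. (x, y)"] that
    by (simp add: o_def continuous_map_pairwise ts)
  have sub: "H \<subseteq> carrier G" if "H \<in> B" for H
    using B that subgroup.subset unfolding algebraic_base_def by blast
  have "continuous_map (prod_topology T (discrete_topology X)) (discrete_topology X) (\<lambda>(g, x). \<phi> g x)
    \<longleftrightarrow> (\<forall>x\<in>X. \<exists>H\<in>B. \<forall>h\<in>H. \<phi> h x = x)" (is "?c \<longleftrightarrow> _") if act: "group_action G X \<phi>"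
  proof
    assume c: ?c
    show "\<forall>x\<in>X. \<exists>H\<in>B. \<forall>h\<in>H. \<phi> h x = x"
    proof
      fix x assume x: "x \<in> X"
      have "continuous_map T (discrete_topology X) (\<lambda>g. \<phi> g x)"
        using continuous_map_compose[OF _ c, of T "\<lambda>g. (g, x)"] x
        by (simp add: o_def continuous_map_pairwise)
      then have "openin T {g \<in> topspace T. \<phi> g x \<in> {x}}"
        by (rule openin_continuous_map_preimage) (use x in simp)
      moreover have "\<one>\<^bsub>G\<^esub> \<in> {g \<in> topspace T. \<phi> g x \<in> {x}}"
        using group_actionD(3)[OF act x] ts by simp
      ultimately obtain H where "H \<in> B" "H \<subseteq> {g \<in> topspace T. \<phi> g x \<in> {x}}" using nb2 by metis
      then show "\<exists>H\<in>B. \<forall>h\<in>H. \<phi> h x = x" by auto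
    qed
  next
    assume st: "\<forall>x\<in>X. \<exists>H\<in>B. \<forall>h\<in>H. \<phi> h x = x"
    show ?c unfolding continuous_map_def
    proof (intro conjI allI impI)
      show "(\<lambda>(g, x). \<phi> g x) \<in> topspace (prod_topology T (discrete_topology X)) \<rightarrow> topspace (discrete_topology X)"
        using group_actionD(1)[OF act] by (auto simp: ts)
      fix U assume U: "openin (discrete_topology X) U"
      show "openin (prod_topology T (discrete_topology X))
        {p \<in> topspace (prod_topology T (discrete_topology X)). (case p of (g, x) \<Rightarrow> \<phi> g x) \<in> U}"
        unfolding openin_prod_topology_alt
      proof (intro allI impI)
        fix g x assume "(g, x) \<in> {p \<in> topspace (prod_topology T (discrete_topology X)). (case p of (g, x) \<Rightarrow> \<phi> g x) \<in> U}"
        then have gx: "g \<in> carrier G" "x \<in> X" "\<phi> g x \<in> U" by (auto simp: ts)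
        then obtain H where H: "H \<in> B" "\<forall>h\<in>H. \<phi> h x = x" using st by blast
        obtain V where V: "openin T V" "\<one>\<^bsub>G\<^esub> \<in> V" "V \<subseteq> H" using nb1[OF H(1)] by blast
        let ?W = "{y \<in> topspace T. inv\<^bsub>G\<^esub> g \<otimes>\<^bsub>G\<^esub> y \<in> V}"
        have "openin T ?W" using openin_continuous_map_preimage[OF tr V(1)] gx by simp
        moreover have "g \<in> ?W" using gx V ts by simp
        moreover have "\<phi> y x \<in> U" if "y \<in> ?W" for y
        proof -
          have y: "y \<in> carrier G" "inv\<^bsub>G\<^esub> g \<otimes>\<^bsub>G\<^esub> y \<in> H" using that V(3) ts by auto
          have "\<phi> (g \<otimes>\<^bsub>G\<^esub> (inv\<^bsub>G\<^esub> g \<otimes>\<^bsub>G\<^esub> y)) x = \<phi> g x"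
            using group_actionD(4)[OF act gx(1) m_closed[OF inv_closed[OF gx(1)] y(1)] gx(2)] H(2) y(2) by simp
          then show ?thesis using gx y by (simp add: m_assoc[symmetric])
        qed
        ultimately show "\<exists>V W. openin T V \<and> openin (discrete_topology X) W \<and> g \<in> V \<and> x \<in> W \<and>
          V \<times> W \<subseteq> {p \<in> topspace (prod_topology T (discrete_topology X)). (case p of (g, x) \<Rightarrow> \<phi> g x) \<in> U}"
          using gx by (intro exI[of _ ?W] exI[of _ "{x}"]) (auto simp: ts)
      qed
    qed
  qed
  then show ?thesis unfolding continuous_action_def T_def by auto
qed

definition gapp :: "'a \<times> 'b \<times> ('x \<Rightarrow> 'x) \<Rightarrow> 'x \<Rightarrow> 'x" where
  "gapp t x = snd (snd t) x"

lemma gapp_simp [simp]: "gapp (X, Y, f) x = f x"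
  by (simp add: gapp_def)

lemma obj_Cont: "(X, \<phi>) \<in> obj (Cont \<U> G T) \<longleftrightarrow>
    small \<U> X \<and> \<phi> \<in> extensional (carrier G) \<and> continuous_action G T (X, \<phi>)"
  by (simp add: Cont_def)

lemma Cont_simps [simp]:
  "ide (Cont \<U> G T) X = (X, X, \<lambda>x\<in>fst X. x)"
  "cmp (Cont \<U> G T) (Y', Z, g) (X, Y, f) = (X, Z, \<lambda>x\<in>fst X. g (f x))"
  by (simp_all add: Cont_def)

lemma homs_Cont: "homs (Cont \<U> G T) X Y =
  {(X, Y, f) | f. X \<in> obj (Cont \<U> G T) \<and> Y \<in> obj (Cont \<U> G T) \<and> f \<in> fst X \<rightarrow>\<^sub>E fst Y \<and>
    (\<forall>g\<in>carrier G. \<forall>x\<in>fst X. f (snd X g x) = snd Y g (f x))}"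
  by (cases X, cases Y) (auto simp: homs_def Cont_def)

lemma Cont_action:
  assumes "X \<in> obj (Cont \<U> G T)"
  shows "group_action G (fst X) (snd X)"
  using assms by (auto simp: Cont_def continuous_action_def)

lemmas Cont_actionD = group_actionD[OF Cont_action]

lemma gapp_homs: "t \<in> homs (Cont \<U> G T) X Y \<Longrightarrow> x \<in> fst X \<Longrightarrow> gapp t x \<in> fst Y"
  by (auto simp: homs_Cont)

lemma gapp_act: "t \<in> homs (Cont \<U> G T) X Y \<Longrightarrow> g \<in> carrier G \<Longrightarrow> x \<in> fst X \<Longrightarrow>
    gapp t (snd X g x) = snd Y g (gapp t x)"
  by (auto simp: homs_Cont)

lemma gapp_cmp: "t \<in> homs (Cont \<U> G T) X Y \<Longrightarrow> s \<in> homs (Cont \<U> G T) Y Z \<Longrightarrow> x \<in> fst X \<Longrightarrow>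
    gapp (cmp (Cont \<U> G T) s t) x = gapp s (gapp t x)"
  by (auto simp: homs_Cont)

lemma gapp_ext: "t \<in> homs (Cont \<U> G T) X Y \<Longrightarrow> s \<in> homs (Cont \<U> G T) X Y \<Longrightarrow>
    (\<And>x. x \<in> fst X \<Longrightarrow> gapp t x = gapp s x) \<Longrightarrow> t = s"
  by (clarsimp simp: homs_Cont) (erule PiE_ext, assumption, simp)

lemma Cont_homsI: "X \<in> obj (Cont \<U> G T) \<Longrightarrow> Y \<in> obj (Cont \<U> G T) \<Longrightarrow>
    (\<And>x. x \<in> fst X \<Longrightarrow> f x \<in> fst Y) \<Longrightarrow>
    (\<And>g x. g \<in> carrier G \<Longrightarrow> x \<in> fst X \<Longrightarrow> f (snd X g x) = snd Y g (f x)) \<Longrightarrow>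
    (X, Y, \<lambda>x\<in>fst X. f x) \<in> homs (Cont \<U> G T) X Y"
  by (auto simp: homs_Cont Cont_actionD(1))

lemma Cont_ide_homs: "X \<in> obj (Cont \<U> G T) \<Longrightarrow> ide (Cont \<U> G T) X \<in> homs (Cont \<U> G T) X X"
  unfolding Cont_simps by (rule Cont_homsI) simp_all

lemma Cont_cmp_homs:
  assumes f: "f \<in> homs (Cont \<U> G T) X Y" and g: "g \<in> homs (Cont \<U> G T) Y Z"
  shows "cmp (Cont \<U> G T) g f \<in> homs (Cont \<U> G T) X Z"
proof -
  have X: "X \<in> obj (Cont \<U> G T)" and Z: "Z \<in> obj (Cont \<U> G T)" using f g by (auto simp: homs_Cont)
  have "cmp (Cont \<U> G T) g f = (X, Z, \<lambda>x\<in>fst X. gapp g (gapp f x))"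
    using f g by (auto simp: homs_Cont)
  also have "\<dots> \<in> homs (Cont \<U> G T) X Z"
    by (rule Cont_homsI[OF X Z]) (simp_all add: gapp_homs[OF f] gapp_homs[OF g] gapp_act[OF f] gapp_act[OF g])
  finally show ?thesis .
qed

lemma gapp_ide: "x \<in> fst X \<Longrightarrow> gapp (ide (Cont \<U> G T) X) x = x"
  by simp

lemma category_Cont:
  fixes G :: "('g, 'z) monoid_scheme"
  shows "category (Cont \<U> G T :: (('g, 'e) gset, _) cat)"
proof unfold_locales
  fix f :: "('g, 'e) gset \<times> ('g, 'e) gset \<times> ('e \<Rightarrow> 'e)" assume "f \<in> arr (Cont \<U> G T)"
  then show "src (Cont \<U> G T) f \<in> obj (Cont \<U> G T)" "trg (Cont \<U> G T) f \<in> obj (Cont \<U> G T)"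
    by (auto simp: Cont_def)
next
  fix f and X Y :: "('g, 'e) gset" assume f: "f \<in> homs (Cont \<U> G T) X Y"
  then have X: "X \<in> obj (Cont \<U> G T)" and Y: "Y \<in> obj (Cont \<U> G T)" by (auto simp: homs_Cont)
  show "cmp (Cont \<U> G T) (ide (Cont \<U> G T) Y) f = f"
    by (rule gapp_ext[OF Cont_cmp_homs[OF f Cont_ide_homs[OF Y]] f])
      (simp only: gapp_cmp[OF f Cont_ide_homs[OF Y]] gapp_ide gapp_homs[OF f])
  show "cmp (Cont \<U> G T) f (ide (Cont \<U> G T) X) = f"
    by (rule gapp_ext[OF Cont_cmp_homs[OF Cont_ide_homs[OF X] f] f])
      (simp only: gapp_cmp[OF Cont_ide_homs[OF X] f] gapp_ide)
next
  fix f g h and X Y Z W :: "('g, 'e) gset"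
  assume f: "f \<in> homs (Cont \<U> G T) X Y" and g: "g \<in> homs (Cont \<U> G T) Y Z" and h: "h \<in> homs (Cont \<U> G T) Z W"
  note gf = Cont_cmp_homs[OF f g] and hg = Cont_cmp_homs[OF g h]
  show "cmp (Cont \<U> G T) h (cmp (Cont \<U> G T) g f) = cmp (Cont \<U> G T) (cmp (Cont \<U> G T) h g) f"
    by (rule gapp_ext[OF Cont_cmp_homs[OF gf h] Cont_cmp_homs[OF f hg]])
      (simp only: gapp_cmp[OF gf h] gapp_cmp[OF f hg] gapp_cmp[OF f g] gapp_cmp[OF g h] gapp_homs[OF f])
next
  fix X :: "('g, 'e) gset" assume "X \<in> obj (Cont \<U> G T)"
  then show "ide (Cont \<U> G T) X \<in> homs (Cont \<U> G T) X X" by (rule Cont_ide_homs)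
next
  fix f g and X Y Z :: "('g, 'e) gset"
  assume "f \<in> homs (Cont \<U> G T) X Y" and "g \<in> homs (Cont \<U> G T) Y Z"
  then show "cmp (Cont \<U> G T) g f \<in> homs (Cont \<U> G T) X Z" by (rule Cont_cmp_homs)
qed

section \<open>Representables and filtered colimits\<close>

lemma fob_id_ftor [simp]: "a \<in> obj C \<Longrightarrow> fob (id_ftor C) a = a"
  by (simp add: id_ftor_def)

lemma far_id_ftor: "f \<in> homs C a b \<Longrightarrow> far (id_ftor C) f = f"
  by (simp add: id_ftor_def homs_def)

lemma fob_fob_yoneda:
  "c \<in> obj C \<Longrightarrow> a \<in> obj C \<Longrightarrow> fob (fob (yoneda C) c) a = homs C a c"
  by (simp add: yoneda_def hom_functor_simps(1) fob_hom_presheaf)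

lemma far_fob_yoneda:
  assumes "category C" "f \<in> homs C a b" "h \<in> homs C b c"
  shows "app (far (fob (yoneda C) c) f) h = cmp C h f"
  using category.homs_obj[OF assms(1)] assms
  by (simp add: yoneda_def hom_functor_simps(1) far_hom_presheaf far_id_ftor)

lemma app_far_yoneda:
  assumes "category C" "f \<in> homs C a b" "h \<in> homs C c a"
  shows "app (snd (snd (far (yoneda C) f)) c) h = cmp C f h"
  using category.homs_obj[OF assms(1)] assms
  by (simp add: yoneda_def hom_functor_simps(2)[OF assms(2)])

lemma is_functor_yoneda:
  assumes "category C" "arr C \<in> \<U>"
  shows "is_functor C (PSh \<U> C) (yoneda C)"
  unfolding yoneda_def
proof (rule is_functor_hom_functor[OF is_functor_id[OF assms(1)]])
  fix a X
  have "homs C (fob (id_ftor C) a) X \<subseteq> arr C" by (auto simp: homs_def)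
  then show "small \<U> (homs C (fob (id_ftor C) a) X)" using small_subset[OF small_in[OF assms(2)]] by blast
qed

lemma PSh_cmp_app:
  assumes "t \<in> homs (PSh \<U> C) P Q" "s \<in> homs (PSh \<U> C) Q R" "a \<in> obj C" "x \<in> fob P a"
  shows "app (snd (snd (cmp (PSh \<U> C) s t)) a) x = app (snd (snd s) a) (app (snd (snd t) a) x)"
proof -
  obtain \<tau> \<sigma> where t: "t = (P, Q, \<tau>)" and s: "s = (Q, R, \<sigma>)" using assms(1,2) by (auto simp: homs_PSh)
  show ?thesis
    using app_cmp[OF presheaf_homD(3)[OF assms(1)[unfolded t] assms(3)]
        presheaf_homD(3)[OF assms(2)[unfolded s] assms(3)] assms(4)] assms(3)
    by (simp add: t s PSh_def)
qed

lemma PSh_app_in: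
  assumes "t \<in> homs (PSh \<U> C) P Q" "a \<in> obj C" "x \<in> fob P a"
  shows "app (snd (snd t) a) x \<in> fob Q a"
proof -
  obtain \<tau> where t: "t = (P, Q, \<tau>)" using assms(1) by (auto simp: homs_PSh)
  show ?thesis using presheaf_homD(4)[OF assms(1)[unfolded t] assms(2,3)] by (simp add: t)
qed

lemma PSh_app_nat:
  assumes "t \<in> homs (PSh \<U> C) P Q" "f \<in> homs C a b" "x \<in> fob P b"
  shows "app (snd (snd t) a) (app (far P f) x) = app (far Q f) (app (snd (snd t) b) x)"
proof -
  obtain \<tau> where t: "t = (P, Q, \<tau>)" using assms(1) by (auto simp: homs_PSh)
  show ?thesis using presheaf_homD(5)[OF assms(1)[unfolded t] assms(2,3)] by (simp add: t)
qed

lemma PSh_ext: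
  assumes "t \<in> homs (PSh \<U> C) P Q" "s \<in> homs (PSh \<U> C) P Q"
    and "\<And>a x. a \<in> obj C \<Longrightarrow> x \<in> fob P a \<Longrightarrow> app (snd (snd t) a) x = app (snd (snd s) a) x"
  shows "t = s"
proof -
  obtain \<tau> \<sigma> where t: "t = (P, Q, \<tau>)" and s: "s = (P, Q, \<sigma>)" using assms(1,2) by (auto simp: homs_PSh)
  show ?thesis using presheaf_hom_ext[OF assms(1)[unfolded t] assms(2)[unfolded s]] assms(3) by (simp add: t s)
qed

definition yel :: "('o, 'm) cat \<Rightarrow> 'o \<Rightarrow> 'x \<times> 'y \<times> ('o \<Rightarrow> 'm sarr) \<Rightarrow> 'm" where
  "yel C c t = app (snd (snd t) c) (ide C c)"

lemma app_yel:
  assumes C: "category C" and t: "t \<in> homs (PSh \<U> C) (fob (yoneda C) c) P" and c: "c \<in> obj C"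
    and h: "h \<in> homs C a c"
  shows "app (snd (snd t) a) h = app (far P h) (yel C c t)"
proof -
  interpret category C by fact
  have "app (far (fob (yoneda C) c) h) (ide C c) = h"
    using far_fob_yoneda[OF C h ide_homs[OF c]] cmp_ide_left[OF h] by simp
  then show ?thesis
    using PSh_app_nat[OF t h, of "ide C c"] ide_homs[OF c] fob_fob_yoneda[OF c c] by (simp add: yel_def)
qed

lemma yel_in:
  assumes C: "category C" and t: "t \<in> homs (PSh \<U> C) (fob (yoneda C) c) P" and c: "c \<in> obj C"
  shows "yel C c t \<in> fob P c"
  using PSh_app_in[OF t c] category.ide_homs[OF C c] fob_fob_yoneda[OF c c] by (simp add: yel_def)

lemma yel_inj:
  assumes C: "category C" and t: "t \<in> homs (PSh \<U> C) (fob (yoneda C) c) P"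
    and s: "s \<in> homs (PSh \<U> C) (fob (yoneda C) c) P" and c: "c \<in> obj C" and eq: "yel C c t = yel C c s"
  shows "t = s"
  by (rule PSh_ext[OF t s]) (use app_yel[OF C t c] app_yel[OF C s c] eq fob_fob_yoneda[OF c] in auto)

lemma yel_cmp_far:
  assumes C: "category C" and A: "arr C \<in> \<U>" and t: "t \<in> homs (PSh \<U> C) (fob (yoneda C) b) P"
    and f: "f \<in> homs C a b"
  shows "yel C a (cmp (PSh \<U> C) t (far (yoneda C) f)) = app (snd (snd t) a) f"
proof -
  interpret category C by fact
  interpret y: is_functor C "PSh \<U> C" "yoneda C" by (rule is_functor_yoneda[OF C A])
  have a: "a \<in> obj C" using homs_obj[OF f] by simp
  show ?thesis unfolding yel_def
    using PSh_cmp_app[OF y.far_homs[OF f] t a, of "ide C a"] app_far_yoneda[OF C f ide_homs[OF a]]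
      ide_homs[OF a] cmp_ide_right[OF f] fob_fob_yoneda[OF a a] by simp
qed

locale filtered_diagram =
  C: category C + I: category I + D: is_functor I C D
  for \<U> :: "'v set set" and C :: "('v, 'v) cat" and I :: "('v, 'v) cat" and D +
  fixes u :: "('v, 'v, 'v set, 'v sarr) ftor" and \<tau>
  assumes univ: "universe \<U>" and arr_C: "arr C \<in> \<U>" and obj_I: "obj I \<in> \<U>" and filt: "filtered I"
    and colim: "is_colimit I (PSh \<U> C) (comp_ftor I (yoneda C) D) u \<tau>"
begin

sublocale P: category "PSh \<U> C" by (rule category_PSh) unfold_locales

sublocale y: is_functor C "PSh \<U> C" "yoneda C" by (rule is_functor_yoneda[OF _ arr_C]) unfold_locales

lemma comp_simps:
  "i \<in> obj I \<Longrightarrow> fob (comp_ftor I (yoneda C) D) i = fob (yoneda C) (fob D i)"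
  "p \<in> homs I i j \<Longrightarrow> far (comp_ftor I (yoneda C) D) p = far (yoneda C) (far D p)"
  by (auto simp: comp_ftor_def homs_def)

lemma cocone: "is_cocone I (PSh \<U> C) (comp_ftor I (yoneda C) D) u \<tau>"
  using colim by (simp add: is_colimit_def)

lemma tau_homs:
  assumes i: "i \<in> obj I"
  shows "\<tau> i \<in> homs (PSh \<U> C) (fob (yoneda C) (fob D i)) u"
proof -
  have "\<tau> i \<in> homs (PSh \<U> C) (fob (comp_ftor I (yoneda C) D) i) u"
    using cocone i unfolding is_cocone_def by blast
  then show ?thesis by (simp only: comp_simps(1)[OF i])
qed

lemma tau_cmp:
  assumes p: "p \<in> homs I i j"
  shows "cmp (PSh \<U> C) (\<tau> j) (far (yoneda C) (far D p)) = \<tau> i"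
proof -
  have "cmp (PSh \<U> C) (\<tau> (trg I p)) (far (comp_ftor I (yoneda C) D) p) = \<tau> (src I p)"
    using cocone homsD(1)[OF p] unfolding is_cocone_def by blast
  then show ?thesis by (simp only: comp_simps(2)[OF p] homsD(2,3)[OF p])
qed

lemma u_presheaf: "is_functor (opp C) (SetC \<U>) u"
  using cocone by (simp add: is_cocone_def PSh_def)

lemma dominate:
  assumes "i \<in> obj I" "j \<in> obj I"
  obtains k p q where "k \<in> obj I" "p \<in> homs I i k" "q \<in> homs I j k"
  using filt assms unfolding filtered_def by blast

lemma equalize:
  assumes "p \<in> homs I i j" "q \<in> homs I i j"
  obtains k r where "k \<in> obj I" "r \<in> homs I j k" "cmp I r p = cmp I r q"
  using filt assms I.homs_obj[OF assms(1)] unfolding filtered_def by blast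

definition pairs :: "'v \<Rightarrow> ('v \<times> 'v) set" where
  "pairs c = {(i, f). i \<in> obj I \<and> f \<in> homs C c (fob D i)}"

definition germ :: "'v \<times> 'v \<Rightarrow> 'v \<times> 'v \<Rightarrow> bool" where
  "germ = (\<lambda>(i, f) (j, g). \<exists>k p q. p \<in> homs I i k \<and> q \<in> homs I j k \<and>
     cmp C (far D p) f = cmp C (far D q) g)"

lemma germ_trans:
  assumes x: "x \<in> pairs c" and y: "y \<in> pairs c" and z: "z \<in> pairs c" and xy: "germ x y" and yz: "germ y z"
  shows "germ x z"
proof -
  obtain i f j g l h where [simp]: "x = (i, f)" "y = (j, g)" "z = (l, h)" by (cases x, cases y, cases z)
  have f: "f \<in> homs C c (fob D i)" and g: "g \<in> homs C c (fob D j)" and h: "h \<in> homs C c (fob D l)"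
    using x y z by (auto simp: pairs_def)
  obtain k p q where p: "p \<in> homs I i k" and q: "q \<in> homs I j k" and pq: "cmp C (far D p) f = cmp C (far D q) g"
    using xy by (auto simp: germ_def)
  obtain k' p' q' where p': "p' \<in> homs I j k'" and q': "q' \<in> homs I l k'"
    and pq': "cmp C (far D p') g = cmp C (far D q') h"
    using yz by (auto simp: germ_def)
  obtain m a b where a: "a \<in> homs I k m" and b: "b \<in> homs I k' m"
    using dominate[of k k'] I.homs_obj[OF p] I.homs_obj[OF p'] by blast
  obtain n e where e: "e \<in> homs I m n" and eq: "cmp I e (cmp I a q) = cmp I e (cmp I b p')"
    using equalize[OF I.cmp_homs[OF q a] I.cmp_homs[OF p' b]] by blast
  have push: "cmp C (far D (cmp I r s)) w = cmp C (far D r) (cmp C (far D s) w)"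
    if "w \<in> homs C c (fob D i1)" "s \<in> homs I i1 i2" "r \<in> homs I i2 i3" for w r s i1 i2 i3
    using D.far_cmp[OF that(2,3)] C.cmp_assoc[OF that(1) D.far_homs[OF that(2)] D.far_homs[OF that(3)]] by simp
  note ea = I.cmp_homs[OF a e] and eb = I.cmp_homs[OF b e]
  have "cmp C (far D (cmp I (cmp I e a) p)) f = cmp C (far D (cmp I (cmp I e a) q)) g"
    using push[OF f p ea] push[OF g q ea] pq by simp
  also have "cmp I (cmp I e a) q = cmp I (cmp I e b) p'"
    using eq I.cmp_assoc[OF q a e] I.cmp_assoc[OF p' b e] by simp
  also have "cmp C (far D (cmp I (cmp I e b) p')) g = cmp C (far D (cmp I (cmp I e b) q')) h"
    using push[OF g p' eb] push[OF h q' eb] pq' by simp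
  finally show ?thesis using I.cmp_homs[OF p ea] I.cmp_homs[OF q' eb] unfolding germ_def by auto
qed

lemma germ_refl: "x \<in> pairs c \<Longrightarrow> germ x x"
  using I.ide_homs unfolding germ_def pairs_def by fast

lemma germ_sym: "germ x y \<Longrightarrow> germ y x"
  unfolding germ_def by (cases x, cases y) (clarsimp, metis)

lemma germ_push:
  assumes p: "p \<in> homs I i j" and f: "f \<in> homs C c (fob D i)"
  shows "germ (i, f) (j, cmp C (far D p) f)"
proof -
  have j: "j \<in> obj I" using I.homs_obj[OF p] by simp
  have "cmp C (far D (ide I j)) (cmp C (far D p) f) = cmp C (far D p) f"
    using D.far_ide[OF j] C.cmp_ide_left[OF C.cmp_homs[OF f D.far_homs[OF p]]] by simp
  then show ?thesis
    unfolding germ_def prod.case by (intro exI[of _ j] exI[of _ p] exI[of _ "ide I j"]) (simp add: p I.ide_homs[OF j])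
qed

lemma germ_restrict:
  assumes x: "(i, f) \<in> pairs b" "(j, g) \<in> pairs b" and h: "h \<in> homs C a b" and "germ (i, f) (j, g)"
  shows "germ (i, cmp C f h) (j, cmp C g h)"
proof -
  obtain k p q where p: "p \<in> homs I i k" and q: "q \<in> homs I j k" and pq: "cmp C (far D p) f = cmp C (far D q) g"
    using assms(4) by (auto simp: germ_def)
  have "cmp C (far D p) (cmp C f h) = cmp C (far D q) (cmp C g h)"
    using C.cmp_assoc[OF h _ D.far_homs[OF p]] C.cmp_assoc[OF h _ D.far_homs[OF q]] x pq
    by (simp add: pairs_def)
  then show ?thesis using p q unfolding germ_def by auto
qed

lemma pairs_restrict: "(i, f) \<in> pairs b \<Longrightarrow> h \<in> homs C a b \<Longrightarrow> (i, cmp C f h) \<in> pairs a"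
  using C.cmp_homs by (auto simp: pairs_def)

lemma small_pairs: "small \<U> (pairs c)"
proof (rule small_subset)
  show "small \<U> (obj I \<times> arr C)" by (rule universe_Times[OF univ obj_I arr_C])
  show "pairs c \<subseteq> obj I \<times> arr C" by (auto simp: pairs_def homs_def)
qed

text \<open>Sending a pair \<open>(i, f)\<close> to its germ is a cocone, and the map out of \<open>u\<close> that it induces compares \<open>u\<close>
  with the usual construction of filtered colimits of sets.\<close>

lemma germs_of_elements:
  shows "x \<in> fob u c \<Longrightarrow> c \<in> obj C \<Longrightarrow> \<exists>i f. (i, f) \<in> pairs c \<and> x = app (snd (snd (\<tau> i)) c) f"
    and "(i, f) \<in> pairs c \<Longrightarrow> (j, g) \<in> pairs c \<Longrightarrow> c \<in> obj C \<Longrightarrow>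
      app (snd (snd (\<tau> i)) c) f = app (snd (snd (\<tau> j)) c) g \<Longrightarrow> germ (i, f) (j, g)"
proof -
  have "\<exists>q :: 'v \<times> 'v \<Rightarrow> 'v. \<forall>x\<in>pairs c. \<forall>y\<in>pairs c. q x = q y \<longleftrightarrow> germ x y" for c
    by (rule small_quotient[OF small_pairs]) (blast intro: germ_refl germ_sym germ_trans)+
  then obtain q :: "'v \<Rightarrow> 'v \<times> 'v \<Rightarrow> 'v"
    where q: "\<And>c x y. x \<in> pairs c \<Longrightarrow> y \<in> pairs c \<Longrightarrow> q c x = q c y \<longleftrightarrow> germ x y"
    by metis
  define S where "S c = q c ` pairs c" for c
  define r where "r h = lift (pairs (trg C h)) (q (trg C h)) (\<lambda>(i, f). q (src C h) (i, cmp C f h))" for h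
  have r: "r h (q b (i, f)) = q a (i, cmp C f h)" if h: "h \<in> homs C a b" and x: "(i, f) \<in> pairs b" for h a b i f
    unfolding r_def homsD(2,3)[OF h]
    by (subst lift_eq[OF _ x]) (use q germ_restrict[OF _ x h] pairs_restrict[OF _ h] x in \<open>auto simp: q\<close>)
  define Q where "Q = \<lparr>fob = (\<lambda>a\<in>obj C. S a), far = (\<lambda>f\<in>arr C. (S (trg C f), S (src C f), \<lambda>x\<in>S (trg C f). r f x))\<rparr>"
  have Q: "is_functor (opp C) (SetC \<U>) Q" unfolding Q_def
  proof (rule presheafI)
    show "category C" by unfold_locales
    show "small \<U> (S a)" for a unfolding S_def by (rule small_image[OF small_pairs])
    show "r f x \<in> S a" if "f \<in> homs C a b" "x \<in> S b" for f a b x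
      using that r[OF that(1)] pairs_restrict[OF _ that(1)] by (auto simp: S_def)
    show "r (ide C a) x = x" if "a \<in> obj C" "x \<in> S a" for a x
      using that r[OF C.ide_homs[OF that(1)]] C.cmp_ide_right by (auto simp: S_def pairs_def)
    show "r (cmp C g f) x = r f (r g x)" if "f \<in> homs C a b" "g \<in> homs C b c" "x \<in> S c" for f g a b c x
      using that r[OF that(1)] r[OF that(2)] r[OF C.cmp_homs[OF that(1,2)]] pairs_restrict[OF _ that(2)]
        C.cmp_assoc[OF that(1,2)] by (auto simp: S_def pairs_def)
  qed
  have Q_ob: "fob Q a = S a" if "a \<in> obj C" for a using that by (simp add: Q_def)
  have Q_ar: "app (far Q h) (q b (i, f)) = q a (i, cmp C f h)"
    if "h \<in> homs C a b" "(i, f) \<in> pairs b" for h a b i f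
    using that r[OF that] homsD[OF that(1)] by (auto simp: Q_def S_def)
  have y_ob: "fob (fob (yoneda C) (fob D i)) a = homs C a (fob D i)" if "i \<in> obj I" "a \<in> obj C" for i a
    using fob_fob_yoneda[OF D.fob_obj[OF that(1)] that(2)] .
  have y_pre: "is_functor (opp C) (SetC \<U>) (fob (yoneda C) (fob D i))" if "i \<in> obj I" for i
    using y.fob_obj[OF D.fob_obj[OF that]] by (simp add: PSh_def)
  define \<sigma> where "\<sigma> i = (fob (yoneda C) (fob D i), Q, \<lambda>a\<in>obj C. (fob (fob (yoneda C) (fob D i)) a, fob Q a,
     \<lambda>f\<in>fob (fob (yoneda C) (fob D i)) a. q a (i, f)))" for i
  have \<sigma>: "\<sigma> i \<in> homs (PSh \<U> C) (fob (yoneda C) (fob D i)) Q" if i: "i \<in> obj I" for i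
    unfolding \<sigma>_def
  proof (rule presheaf_homI[OF y_pre[OF i] Q])
    fix a f assume "a \<in> obj C" "f \<in> fob (fob (yoneda C) (fob D i)) a"
    then show "q a (i, f) \<in> fob Q a" using i y_ob[OF i] Q_ob by (auto simp: S_def pairs_def)
  next
    fix h a b f assume h: "h \<in> homs C a b" and "f \<in> fob (fob (yoneda C) (fob D i)) b"
    then have f: "f \<in> homs C b (fob D i)" using y_ob[OF i] C.homs_obj[OF h] by simp
    then have "(i, f) \<in> pairs b" using i by (simp add: pairs_def)
    then show "q a (i, app (far (fob (yoneda C) (fob D i)) h) f) = app (far Q h) (q b (i, f))"
      using far_fob_yoneda[OF C.category_axioms h f] Q_ar[OF h] by simp
  qed
  have \<sigma>_app: "app (snd (snd (\<sigma> i)) a) f = q a (i, f)" if "(i, f) \<in> pairs a" "a \<in> obj C" for i f a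
    using that y_ob by (auto simp: \<sigma>_def pairs_def)
  have "is_cocone I (PSh \<U> C) (comp_ftor I (yoneda C) D) Q \<sigma>"
    unfolding is_cocone_def
  proof (intro conjI ballI)
    show "Q \<in> obj (PSh \<U> C)" using Q by (simp add: PSh_def)
    show "\<sigma> i \<in> homs (PSh \<U> C) (fob (comp_ftor I (yoneda C) D) i) Q" if "i \<in> obj I" for i
      using \<sigma>[OF that] comp_simps(1)[OF that] by simp
    fix p assume "p \<in> arr I"
    then obtain i j where p: "p \<in> homs I i j" using arr_homs[of p I] by simp
    note ij = I.homs_obj[OF p] and yp = y.far_homs[OF D.far_homs[OF p]]
    have "cmp (PSh \<U> C) (\<sigma> j) (far (yoneda C) (far D p)) = \<sigma> i"
    proof (rule PSh_ext[OF P.cmp_homs[OF yp \<sigma>[OF ij(2)]] \<sigma>[OF ij(1)]])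
      fix a f assume a: "a \<in> obj C" and f': "f \<in> fob (fob (yoneda C) (fob D i)) a"
      then have f: "f \<in> homs C a (fob D i)" using y_ob[OF ij(1)] by simp
      have pi: "(i, f) \<in> pairs a" "(j, cmp C (far D p) f) \<in> pairs a"
        using ij f C.cmp_homs[OF f D.far_homs[OF p]] by (auto simp: pairs_def)
      show "app (snd (snd (cmp (PSh \<U> C) (\<sigma> j) (far (yoneda C) (far D p)))) a) f = app (snd (snd (\<sigma> i)) a) f"
        using PSh_cmp_app[OF yp \<sigma>[OF ij(2)] a f'] app_far_yoneda[OF C.category_axioms D.far_homs[OF p] f]
          \<sigma>_app[OF pi(1) a] \<sigma>_app[OF pi(2) a] germ_push[OF p f] q[OF pi] by simp
    qed
    then show "cmp (PSh \<U> C) (\<sigma> (trg I p)) (far (comp_ftor I (yoneda C) D) p) = \<sigma> (src I p)"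
      using comp_simps(2)[OF p] homsD[OF p] by simp
  qed
  then obtain h where h: "h \<in> homs (PSh \<U> C) u Q" and h\<sigma>: "\<And>i. i \<in> obj I \<Longrightarrow> cmp (PSh \<U> C) h (\<tau> i) = \<sigma> i"
    using colim unfolding is_colimit_def by blast
  have h_app: "app (snd (snd h) a) (app (snd (snd (\<tau> i)) a) f) = q a (i, f)"
    if x: "(i, f) \<in> pairs a" and a: "a \<in> obj C" for i f a
    using PSh_cmp_app[OF tau_homs h a, of i f] h\<sigma>[of i] \<sigma>_app[OF x a] x y_ob[OF _ a, of i] by (auto simp: pairs_def)
  have germ_eq: "app (snd (snd (\<tau> i)) a) f = app (snd (snd (\<tau> j)) a) g"
    if x: "(i, f) \<in> pairs a" and y: "(j, g) \<in> pairs a" and a: "a \<in> obj C" and g: "germ (i, f) (j, g)" for i f j g a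
  proof -
    obtain k p q where p: "p \<in> homs I i k" and q: "q \<in> homs I j k" and pq: "cmp C (far D p) f = cmp C (far D q) g"
      using g by (auto simp: germ_def)
    have "app (snd (snd (\<tau> i')) a) f' = app (snd (snd (\<tau> k)) a) (cmp C (far D p') f')"
      if p': "p' \<in> homs I i' k" and f: "f' \<in> homs C a (fob D i')" for p' i' f'
      using PSh_cmp_app[OF y.far_homs[OF D.far_homs[OF p']] tau_homs a, of f'] tau_cmp[OF p'] I.homs_obj[OF p'] f
        app_far_yoneda[OF C.category_axioms D.far_homs[OF p'] f] y_ob[OF _ a] by simp
    then show ?thesis using p q pq x y by (simp add: pairs_def)
  qed
  define s where "s a = lift (pairs a) (q a) (\<lambda>(i, f). app (snd (snd (\<tau> i)) a) f)" for a
  have s: "s a (q a (i, f)) = app (snd (snd (\<tau> i)) a) f" if x: "(i, f) \<in> pairs a" and a: "a \<in> obj C" for a i f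
    unfolding s_def by (subst lift_eq[OF _ x]) (use q germ_eq[OF _ x a] x in \<open>auto simp: q\<close>)
  define l where "l = (Q, u, \<lambda>a\<in>obj C. (fob Q a, fob u a, \<lambda>x\<in>fob Q a. s a x))"
  have l: "l \<in> homs (PSh \<U> C) Q u" unfolding l_def
  proof (rule presheaf_homI[OF Q u_presheaf])
    fix a x assume a: "a \<in> obj C" and "x \<in> fob Q a"
    then obtain i f where x: "x = q a (i, f)" "(i, f) \<in> pairs a" using Q_ob by (auto simp: S_def)
    then show "s a x \<in> fob u a"
      using s[OF x(2) a] PSh_app_in[OF tau_homs a, of i f] y_ob[OF _ a, of i] by (auto simp: pairs_def)
  next
    fix h a b x assume h: "h \<in> homs C a b" and "x \<in> fob Q b"
    then obtain i f where x: "x = q b (i, f)" "(i, f) \<in> pairs b" using Q_ob C.homs_obj[OF h] by (auto simp: S_def)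
    then have f: "i \<in> obj I" "f \<in> homs C b (fob D i)" by (auto simp: pairs_def)
    note ab = C.homs_obj[OF h]
    show "s a (app (far Q h) x) = app (far u h) (s b x)"
      using Q_ar[OF h x(2)] s[OF pairs_restrict[OF x(2) h] ab(1)] s[OF x(2) ab(2)] x(1)
        PSh_app_nat[OF tau_homs[OF f(1)] h, of f] y_ob[OF f(1) ab(2)] f(2)
        far_fob_yoneda[OF C.category_axioms h f(2)] by simp
  qed
  have l_app: "app (snd (snd l) a) (q a (i, f)) = app (snd (snd (\<tau> i)) a) f" if "(i, f) \<in> pairs a" "a \<in> obj C" for a i f
    using s[OF that] that Q_ob by (simp add: l_def S_def)
  have lh: "cmp (PSh \<U> C) l h = ide (PSh \<U> C) u"
  proof -
    have u: "u \<in> obj (PSh \<U> C)" using u_presheaf by (simp add: PSh_def)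
    have "cmp (PSh \<U> C) (cmp (PSh \<U> C) l h) (\<tau> i) = \<tau> i" if i: "i \<in> obj I" for i
    proof -
      have "cmp (PSh \<U> C) l (\<sigma> i) = \<tau> i"
      proof (rule PSh_ext[OF P.cmp_homs[OF \<sigma>[OF i] l] tau_homs[OF i]])
        fix a f assume a: "a \<in> obj C" and f: "f \<in> fob (fob (yoneda C) (fob D i)) a"
        then have x: "(i, f) \<in> pairs a" using i y_ob by (simp add: pairs_def)
        show "app (snd (snd (cmp (PSh \<U> C) l (\<sigma> i))) a) f = app (snd (snd (\<tau> i)) a) f"
          using PSh_cmp_app[OF \<sigma>[OF i] l a f] \<sigma>_app[OF x a] l_app[OF x a] by simp
      qed
      then show ?thesis using P.cmp_assoc[OF tau_homs[OF i] h l] h\<sigma>[OF i] by simp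
    qed
    moreover have "cmp (PSh \<U> C) (ide (PSh \<U> C) u) (\<tau> i) = \<tau> i" if "i \<in> obj I" for i
      using P.cmp_ide_left[OF tau_homs[OF that]] .
    moreover have "\<exists>!h. h \<in> homs (PSh \<U> C) u u \<and> (\<forall>i\<in>obj I. cmp (PSh \<U> C) h (\<tau> i) = \<tau> i)"
      using colim cocone unfolding is_colimit_def by blast
    ultimately show ?thesis using P.cmp_homs[OF h l] P.ide_homs[OF u] by metis
  qed
  show "\<exists>i f. (i, f) \<in> pairs c \<and> x = app (snd (snd (\<tau> i)) c) f" if x: "x \<in> fob u c" and c: "c \<in> obj C"
  proof -
    obtain i f where if': "(i, f) \<in> pairs c" "app (snd (snd h) c) x = q c (i, f)"
      using PSh_app_in[OF h c x] Q_ob[OF c] by (auto simp: S_def)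
    have "x = app (snd (snd (cmp (PSh \<U> C) l h)) c) x" unfolding lh using x c by (simp add: PSh_def)
    also have "\<dots> = app (snd (snd (\<tau> i)) c) f" using PSh_cmp_app[OF h l c x] if'(2) l_app[OF if'(1) c] by simp
    finally show ?thesis using if'(1) by blast
  qed
  show "germ (i, f) (j, g)"
    if "(i, f) \<in> pairs c" "(j, g) \<in> pairs c" "c \<in> obj C"
      "app (snd (snd (\<tau> i)) c) f = app (snd (snd (\<tau> j)) c) g"
    using h_app[OF that(1,3)] h_app[OF that(2,3)] that(4) q[OF that(1,2)] by simp
qed

lemma factor_representable:
  assumes c: "c \<in> obj C" and \<chi>: "\<chi> \<in> homs (PSh \<U> C) (fob (yoneda C) c) u"
  obtains i f where "i \<in> obj I" "f \<in> homs C c (fob D i)" "\<chi> = cmp (PSh \<U> C) (\<tau> i) (far (yoneda C) f)"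
proof -
  obtain i f where x: "(i, f) \<in> pairs c" and eq: "yel C c \<chi> = app (snd (snd (\<tau> i)) c) f"
    using germs_of_elements(1)[OF yel_in[OF C.category_axioms \<chi> c] c] by blast
  then have f: "i \<in> obj I" "f \<in> homs C c (fob D i)" by (auto simp: pairs_def)
  have "\<chi> = cmp (PSh \<U> C) (\<tau> i) (far (yoneda C) f)"
    by (rule yel_inj[OF C.category_axioms \<chi> P.cmp_homs[OF y.far_homs[OF f(2)] tau_homs[OF f(1)]] c])
      (simp add: eq yel_cmp_far[OF C.category_axioms arr_C tau_homs[OF f(1)] f(2)])
  then show thesis using that f by blast
qed

lemma tau_push:
  assumes p: "p \<in> homs I i k" and f: "f \<in> homs C c (fob D i)"
  shows "cmp (PSh \<U> C) (\<tau> k) (far (yoneda C) (cmp C (far D p) f)) = cmp (PSh \<U> C) (\<tau> i) (far (yoneda C) f)"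
  using y.far_cmp[OF f D.far_homs[OF p]] tau_cmp[OF p] I.homs_obj[OF p]
    P.cmp_assoc[OF y.far_homs[OF f] y.far_homs[OF D.far_homs[OF p]] tau_homs] by simp

lemma elements_dominate:
  assumes a: "a \<in> obj C" and b: "b \<in> obj C"
    and \<chi>: "\<chi> \<in> homs (PSh \<U> C) (fob (yoneda C) a) u" and \<xi>: "\<xi> \<in> homs (PSh \<U> C) (fob (yoneda C) b) u"
  shows "\<exists>e\<in>obj C. \<exists>\<zeta>\<in>homs (PSh \<U> C) (fob (yoneda C) e) u. \<exists>f\<in>homs C a e. \<exists>g\<in>homs C b e.
    \<chi> = cmp (PSh \<U> C) \<zeta> (far (yoneda C) f) \<and> \<xi> = cmp (PSh \<U> C) \<zeta> (far (yoneda C) g)"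
proof -
  obtain i f where i: "i \<in> obj I" and f: "f \<in> homs C a (fob D i)" and \<chi>f: "\<chi> = cmp (PSh \<U> C) (\<tau> i) (far (yoneda C) f)"
    using factor_representable[OF a \<chi>] .
  obtain j g where j: "j \<in> obj I" and g: "g \<in> homs C b (fob D j)" and \<xi>g: "\<xi> = cmp (PSh \<U> C) (\<tau> j) (far (yoneda C) g)"
    using factor_representable[OF b \<xi>] .
  obtain k p q where k: "k \<in> obj I" and p: "p \<in> homs I i k" and q: "q \<in> homs I j k" using dominate[OF i j] .
  show ?thesis
    using D.fob_obj[OF k] tau_homs[OF k] C.cmp_homs[OF f D.far_homs[OF p]] C.cmp_homs[OF g D.far_homs[OF q]]
      tau_push[OF p f] tau_push[OF q g] \<chi>f \<xi>g by metis
qed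

lemma elements_equalize:
  assumes f: "f \<in> homs C a b" and g: "g \<in> homs C a b" and \<zeta>: "\<zeta> \<in> homs (PSh \<U> C) (fob (yoneda C) b) u"
    and eq: "cmp (PSh \<U> C) \<zeta> (far (yoneda C) f) = cmp (PSh \<U> C) \<zeta> (far (yoneda C) g)"
  shows "\<exists>e\<in>obj C. \<exists>h\<in>homs C b e. \<exists>\<zeta>'\<in>homs (PSh \<U> C) (fob (yoneda C) e) u.
    \<zeta> = cmp (PSh \<U> C) \<zeta>' (far (yoneda C) h) \<and> cmp C h f = cmp C h g"
proof -
  have ab: "a \<in> obj C" "b \<in> obj C" using C.homs_obj[OF f] by auto
  obtain i h where i: "i \<in> obj I" and h: "h \<in> homs C b (fob D i)" and \<zeta>h: "\<zeta> = cmp (PSh \<U> C) (\<tau> i) (far (yoneda C) h)"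
    using factor_representable[OF ab(2) \<zeta>] .
  note hf = C.cmp_homs[OF f h] and hg = C.cmp_homs[OF g h]
  have "yel C a (cmp (PSh \<U> C) (\<tau> i) (far (yoneda C) (cmp C h f))) =
      yel C a (cmp (PSh \<U> C) (\<tau> i) (far (yoneda C) (cmp C h g)))"
    using eq unfolding \<zeta>h y.far_cmp[OF f h] y.far_cmp[OF g h]
    by (simp add: P.cmp_assoc[OF y.far_homs[OF f] y.far_homs[OF h] tau_homs[OF i]]
        P.cmp_assoc[OF y.far_homs[OF g] y.far_homs[OF h] tau_homs[OF i]])
  then have "germ (i, cmp C h f) (i, cmp C h g)"
    using germs_of_elements(2)[of i "cmp C h f" a i "cmp C h g"] i hf hg ab
    by (simp add: pairs_def yel_cmp_far[OF C.category_axioms arr_C tau_homs[OF i]])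
  then obtain k p q where p: "p \<in> homs I i k" and q: "q \<in> homs I i k"
    and pq: "cmp C (far D p) (cmp C h f) = cmp C (far D q) (cmp C h g)" by (auto simp: germ_def)
  obtain m r where m: "m \<in> obj I" and r: "r \<in> homs I k m" and rpq: "cmp I r p = cmp I r q" using equalize[OF p q] .
  have push: "cmp C (far D (cmp I r s)) w = cmp C (far D r) (cmp C (far D s) w)"
    if "w \<in> homs C a (fob D i)" "s \<in> homs I i k" for w s
    using D.far_cmp[OF that(2) r] C.cmp_assoc[OF that(1) D.far_homs[OF that(2)] D.far_homs[OF r]] by simp
  note rp = I.cmp_homs[OF p r]
  have "cmp C (cmp C (far D (cmp I r p)) h) f = cmp C (cmp C (far D (cmp I r p)) h) g"
    unfolding C.cmp_assoc[OF f h D.far_homs[OF rp], symmetric] C.cmp_assoc[OF g h D.far_homs[OF rp], symmetric]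
    using push[OF hf p] push[OF hg q] rpq pq by simp
  moreover have "\<zeta> = cmp (PSh \<U> C) (\<tau> m) (far (yoneda C) (cmp C (far D (cmp I r p)) h))"
    using tau_push[OF rp h] \<zeta>h by simp
  ultimately show ?thesis
    using D.fob_obj[OF m] tau_homs[OF m] C.cmp_homs[OF h D.far_homs[OF rp]] by blast
qed

end

section \<open>Sheaves for the atomic topology\<close>

lemmas copresheafD = presheafD[where A = "opp C" for C, unfolded opp_opp homs_opp opp_simps]

lemma atomic_sheaf_iff:
  assumes C: "category C" and AP: "AP C" and P: "is_functor C (SetC \<U>) P"
  shows "is_sheaf (opp C) (atomic_topology (opp C)) P \<longleftrightarrow>
    (\<forall>c d. \<forall>f\<in>homs C c d. \<forall>p\<in>fob P c. \<forall>p'\<in>fob P c. app (far P f) p = app (far P f) p' \<longrightarrow> p = p') \<and>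
    (\<forall>c d. \<forall>f\<in>homs C c d. \<forall>q\<in>fob P d.
      (\<forall>e. \<forall>h\<in>homs C d e. \<forall>h'\<in>homs C d e. cmp C h f = cmp C h' f \<longrightarrow> app (far P h) q = app (far P h') q) \<longrightarrow>
      (\<exists>p\<in>fob P c. app (far P f) p = q))"
  (is "?sheaf \<longleftrightarrow> ?sep \<and> ?desc")
proof -
  interpret category C by fact
  note Pin = copresheafD(3)[OF P]
  have Pcmp: "app (far P (cmp C g f)) p = app (far P g) (app (far P f) p)"
    if "f \<in> homs C a b" "g \<in> homs C b c" "p \<in> fob P a" for f g a b c p
    by (rule copresheafD(5)[OF P that(2,1,3)])
  define gen where "gen f = {k. \<exists>e. \<exists>h\<in>homs C (trg C f) e. k = cmp C h f}" for f
  have gen: "gen f \<in> atomic_topology (opp C) c" "f \<in> gen f" if f: "f \<in> homs C c d" for f c d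
  proof -
    have d: "d \<in> obj C" "trg C f = d" using homs_obj[OF f] homsD[OF f] by auto
    then show *: "f \<in> gen f" using ide_homs cmp_ide_left[OF f] unfolding gen_def by (metis (mono_tags, lifting) mem_Collect_eq)
    have "sieve (opp C) c (gen f)"
      unfolding sieve_def
    proof (intro conjI ballI impI subsetI)
      fix k assume "k \<in> gen f"
      then obtain e h where h: "h \<in> homs C d e" "k = cmp C h f" using d by (auto simp: gen_def)
      then have k: "k \<in> homs C c e" using cmp_homs[OF f] by simp
      then show "k \<in> {f \<in> arr (opp C). trg (opp C) f = c}" by (simp add: homs_def)
      fix g assume "g \<in> arr (opp C)" "trg (opp C) g = src (opp C) k"
      then have g: "g \<in> homs C e (trg C g)" using k by (simp add: homs_def)
      then have "cmp (opp C) k g = cmp C (cmp C g h) f" using cmp_assoc[OF f h(1) g] h(2) by simp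
      then show "cmp (opp C) k g \<in> gen f" using cmp_homs[OF h(1) g] d unfolding gen_def by blast
    qed
    then show "gen f \<in> atomic_topology (opp C) c" using * by (auto simp: atomic_topology_def)
  qed
  show ?thesis
  proof
    assume sh: ?sheaf
    have sheaf: "\<exists>!p. p \<in> fob P c \<and> (\<forall>f\<in>S. app (far P f) p = x f)"
      if "c \<in> obj C" "S \<in> atomic_topology (opp C) c" "\<And>f. f \<in> S \<Longrightarrow> x f \<in> fob P (trg C f)"
        "\<And>f g. f \<in> S \<Longrightarrow> g \<in> arr C \<Longrightarrow> src C g = trg C f \<Longrightarrow> app (far P g) (x f) = x (cmp C g f)" for c S x
      using sh that unfolding is_sheaf_def by simp
    have glue: "\<exists>!p. p \<in> fob P c \<and> (\<forall>k\<in>gen f. app (far P k) p = x k)"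
      if f: "f \<in> homs C c d" and x: "\<And>h e. h \<in> homs C d e \<Longrightarrow> x (cmp C h f) = app (far P h) q" and q: "q \<in> fob P d"
      for f c d q x
    proof (rule sheaf)
      show "c \<in> obj C" "gen f \<in> atomic_topology (opp C) c" using homs_obj[OF f] gen[OF f] by auto
      have d: "trg C f = d" using homsD[OF f] by simp
      fix k assume "k \<in> gen f"
      then obtain e h where h: "h \<in> homs C d e" and k: "k = cmp C h f" using d by (auto simp: gen_def)
      have te: "trg C k = e" using homsD[OF cmp_homs[OF f h]] k by simp
      then show "x k \<in> fob P (trg C k)" using x[OF h] k Pin[OF h q] by simp
      fix g assume "g \<in> arr C" "src C g = trg C k"
      then have g: "g \<in> homs C e (trg C g)" using te by (simp add: homs_def)
      show "app (far P g) (x k) = x (cmp C g k)"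
        using x[OF h] x[OF cmp_homs[OF h g]] Pcmp[OF h g q] cmp_assoc[OF f h g] k by simp
    qed
    have ?sep
    proof (intro allI ballI impI)
      fix c d f p p' assume f: "f \<in> homs C c d" and p: "p \<in> fob P c" and p': "p' \<in> fob P c"
        and eq: "app (far P f) p = app (far P f) p'"
      have "\<exists>!r. r \<in> fob P c \<and> (\<forall>k\<in>gen f. app (far P k) r = app (far P k) p)"
        by (rule glue[OF f _ Pin[OF f p]]) (rule Pcmp[OF f _ p])
      moreover have "\<forall>k\<in>gen f. app (far P k) p' = app (far P k) p"
        using eq Pcmp[OF f _ p] Pcmp[OF f _ p'] homsD[OF f] by (auto simp: gen_def)
      ultimately show "p = p'" using p p' by blast
    qed
    moreover have ?desc
    proof (intro allI ballI impI)
      fix c d f q assume f: "f \<in> homs C c d" and q: "q \<in> fob P d"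
        and inv: "\<forall>e. \<forall>h\<in>homs C d e. \<forall>h'\<in>homs C d e. cmp C h f = cmp C h' f \<longrightarrow> app (far P h) q = app (far P h') q"
      define x where "x k = app (far P (SOME h. h \<in> homs C d (trg C k) \<and> k = cmp C h f)) q" for k
      have x: "x (cmp C h f) = app (far P h) q" if h: "h \<in> homs C d e" for h e
      proof -
        have "trg C (cmp C h f) = e" using homsD[OF cmp_homs[OF f h]] by simp
        then have x_eq: "x (cmp C h f) = app (far P (SOME h'. h' \<in> homs C d e \<and> cmp C h f = cmp C h' f)) q"
          by (simp add: x_def)
        define h' where "h' = (SOME h'. h' \<in> homs C d e \<and> cmp C h f = cmp C h' f)"
        have h': "h' \<in> homs C d e \<and> cmp C h f = cmp C h' f"
          unfolding h'_def by (rule someI[of _ h]) (simp add: h)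
        then have "app (far P h) q = app (far P h') q" using inv h by blast
        then show ?thesis unfolding x_eq h'_def by simp
      qed
      have "\<exists>!p. p \<in> fob P c \<and> (\<forall>k\<in>gen f. app (far P k) p = x k)" by (rule glue[OF f _ q]) (rule x)
      then obtain p where p: "p \<in> fob P c" "app (far P f) p = x f" using gen(2)[OF f] by blast
      have d: "d \<in> obj C" using homs_obj[OF f] by simp
      have "x f = q" using x[OF ide_homs[OF d]] cmp_ide_left[OF f] copresheafD(4)[OF P d q] by simp
      then show "\<exists>p\<in>fob P c. app (far P f) p = q" using p by blast
    qed
    ultimately show "?sep \<and> ?desc" ..
  next
    assume a: "?sep \<and> ?desc"
    have sep: "p = p'" if "f \<in> homs C c d" "p \<in> fob P c" "p' \<in> fob P c" "app (far P f) p = app (far P f) p'"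
      for c d f p p' using a that by blast
    have desc: "\<exists>p\<in>fob P c. app (far P f) p = q" if "f \<in> homs C c d" "q \<in> fob P d"
      "\<And>e h h'. h \<in> homs C d e \<Longrightarrow> h' \<in> homs C d e \<Longrightarrow> cmp C h f = cmp C h' f \<Longrightarrow> app (far P h) q = app (far P h') q"
      for c d f q using conjunct2[OF a] that by blast
    show ?sheaf unfolding is_sheaf_def
    proof (intro ballI allI impI)
      fix c S x assume c: "c \<in> obj (opp C)" and S: "S \<in> atomic_topology (opp C) c"
        and x': "(\<forall>f\<in>S. x f \<in> fob P (src (opp C) f)) \<and> (\<forall>f\<in>S. \<forall>g\<in>arr (opp C). trg (opp C) g = src (opp C) f \<longrightarrow>
          app (far P g) (x f) = x (cmp (opp C) f g))"
      have Sh: "f \<in> homs C c (trg C f)" if "f \<in> S" for f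
        using S that by (auto simp: atomic_topology_def sieve_def homs_def)
      have x: "x f \<in> fob P d" if "f \<in> S" "f \<in> homs C c d" for f d
        using x' that homsD[OF that(2)] by auto
      have xc: "app (far P g) (x f) = x (cmp C g f)" if "f \<in> S" "f \<in> homs C c d" "g \<in> homs C d e" for f g d e
        using x' that homsD[OF that(2)] homsD[OF that(3)] by auto
      obtain f where fS: "f \<in> S" using S by (auto simp: atomic_topology_def)
      define d where "d = trg C f"
      have f: "f \<in> homs C c d" using Sh[OF fS] by (simp add: d_def)
      obtain p where p: "p \<in> fob P c" "app (far P f) p = x f"
        using desc[OF f x[OF fS f]] xc[OF fS f] by metis
      have "app (far P f') p = x f'" if f'S: "f' \<in> S" for f'
      proof -
        define d' where "d' = trg C f'"
        have f': "f' \<in> homs C c d'" using Sh[OF f'S] by (simp add: d'_def)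
        obtain e h h' where h: "h \<in> homs C d e" and h': "h' \<in> homs C d' e" and eq: "cmp C h f = cmp C h' f'"
          using AP f f' homs_obj[OF f] homs_obj[OF f'] unfolding AP_def by blast
        have "app (far P h') (app (far P f') p) = app (far P h) (app (far P f) p)"
          using Pcmp[OF f h p(1)] Pcmp[OF f' h' p(1)] eq by simp
        also have "\<dots> = app (far P h') (x f')" using p(2) xc[OF fS f h] xc[OF f'S f' h'] eq by simp
        finally show ?thesis using sep[OF h' Pin[OF f' p(1)] x[OF f'S f']] by blast
      qed
      moreover have "p' = p" if "p' \<in> fob P c" "\<forall>f\<in>S. app (far P f) p' = x f" for p'
        using sep[OF f that(1) p(1)] p(2) that(2) fS by simp
      ultimately show "\<exists>!p. p \<in> fob P c \<and> (\<forall>f\<in>S. app (far P f) p = x f)" using p(1) by blast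
    qed
  qed
qed


section \<open>The automorphism group of a homogeneous object\<close>

locale homogeneous = C: category C + D: category D + E: is_functor C D E
  for \<U> :: "'v set set" and C :: "('o, 'm) cat" and D :: "('p, 'n) cat" and E +
  fixes u :: 'p
  assumes univ: "universe \<U>" and small_obj: "small \<U> (obj C)" and obj_ne: "obj C \<noteq> {}" and AP: "AP C"
    and embedding: "\<exists>e :: 'v \<Rightarrow> 'n. inj e"
    and hom_ne: "c \<in> obj C \<Longrightarrow> homs D (fob E c) u \<noteq> {}"
    and hom_small: "c \<in> obj C \<Longrightarrow> small \<U> (homs D (fob E c) u)"
    and homog: "ultrahomogeneous C D E u"
    and elements_dominate: "\<lbrakk>a \<in> obj C; b \<in> obj C; \<chi> \<in> homs D (fob E a) u; \<xi> \<in> homs D (fob E b) u\<rbrakk> \<Longrightarrow>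
      \<exists>e\<in>obj C. \<exists>\<zeta>\<in>homs D (fob E e) u. \<exists>f\<in>homs C a e. \<exists>g\<in>homs C b e.
        \<chi> = cmp D \<zeta> (far E f) \<and> \<xi> = cmp D \<zeta> (far E g)"
    and elements_equalize: "\<lbrakk>f \<in> homs C a b; g \<in> homs C a b; \<zeta> \<in> homs D (fob E b) u;
      cmp D \<zeta> (far E f) = cmp D \<zeta> (far E g)\<rbrakk> \<Longrightarrow>
      \<exists>e\<in>obj C. \<exists>h\<in>homs C b e. \<exists>\<zeta>'\<in>homs D (fob E e) u.
        \<zeta> = cmp D \<zeta>' (far E h) \<and> cmp C h f = cmp C h g"
begin

abbreviation H where "H c \<equiv> homs D (fob E c) u"
abbreviation res where "res \<chi> f \<equiv> cmp D \<chi> (far E f)"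
abbreviation G where "G \<equiv> Aut D u"
abbreviation B where "B \<equiv> fixators C D E u"
abbreviation T where "T \<equiv> Aut_topology C D E u"
abbreviation F where "F \<equiv> orbit_functor C D E u"
abbreviation CG :: "(('n, 'n) gset, ('n, 'n) gset \<times> ('n, 'n) gset \<times> ('n \<Rightarrow> 'n)) cat" where "CG \<equiv> Cont \<U> G T"

lemma u_obj: "u \<in> obj D"
  using homog by (simp add: ultrahomogeneous_def)

sublocale G: group G
  by (rule group_Aut[OF D.category_axioms u_obj])

lemma G_simps: "mult G = cmp D" "one G = ide D u"
  by (simp_all add: Aut_def)

lemma G_homs: "g \<in> carrier G \<Longrightarrow> g \<in> homs D u u"
  by (simp add: Aut_def iso_def)

lemma act_in: "g \<in> carrier G \<Longrightarrow> \<chi> \<in> H c \<Longrightarrow> cmp D g \<chi> \<in> H c"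
  using D.cmp_homs[OF _ G_homs] .

lemma res_in: "f \<in> homs C a b \<Longrightarrow> \<chi> \<in> H b \<Longrightarrow> res \<chi> f \<in> H a"
  using D.cmp_homs[OF E.far_homs] .

lemma act_res: "g \<in> carrier G \<Longrightarrow> \<chi> \<in> H b \<Longrightarrow> f \<in> homs C a b \<Longrightarrow> cmp D g (res \<chi> f) = res (cmp D g \<chi>) f"
  using D.cmp_assoc[OF E.far_homs _ G_homs] .

lemma res_cmp: "f \<in> homs C a b \<Longrightarrow> g \<in> homs C b c \<Longrightarrow> \<chi> \<in> H c \<Longrightarrow> res \<chi> (cmp C g f) = res (res \<chi> g) f"
  using D.cmp_assoc[OF E.far_homs E.far_homs] E.far_cmp by simp

lemma res_ide: "c \<in> obj C \<Longrightarrow> \<chi> \<in> H c \<Longrightarrow> res \<chi> (ide C c) = \<chi>"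
  using E.far_ide D.cmp_ide_right by simp

lemma act_mult: "g \<in> carrier G \<Longrightarrow> h \<in> carrier G \<Longrightarrow> \<chi> \<in> H c \<Longrightarrow>
    cmp D (g \<otimes>\<^bsub>G\<^esub> h) \<chi> = cmp D g (cmp D h \<chi>)"
  using D.cmp_assoc[OF _ G_homs G_homs] by (simp add: G_simps)

lemma act_one: "\<chi> \<in> H c \<Longrightarrow> cmp D \<one>\<^bsub>G\<^esub> \<chi> = \<chi>"
  using D.cmp_ide_left by (simp add: G_simps)

lemma act_inv:
  assumes "g \<in> carrier G" "\<chi> \<in> H c"
  shows "cmp D (inv\<^bsub>G\<^esub> g) (cmp D g \<chi>) = \<chi>" "cmp D g (cmp D (inv\<^bsub>G\<^esub> g) \<chi>) = \<chi>"
  using act_mult[of "inv\<^bsub>G\<^esub> g" g \<chi> c] act_mult[of g "inv\<^bsub>G\<^esub> g" \<chi> c] act_one assms by simp_all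

lemma homogeneous:
  assumes "j \<in> homs C a b" "\<chi> \<in> H a" "\<xi> \<in> H b"
  obtains g where "g \<in> carrier G" "cmp D g \<chi> = res \<xi> j"
  using homog assms C.homs_obj[OF assms(1)] unfolding ultrahomogeneous_def Aut_def by (metis partial_object.select_convs(1))

lemma transitive:
  assumes "c \<in> obj C" "\<chi> \<in> H c" "\<xi> \<in> H c"
  obtains g where "g \<in> carrier G" "cmp D g \<chi> = \<xi>"
  using homogeneous[OF C.ide_homs[OF assms(1)] assms(2,3)] res_ide[OF assms(1,3)] by auto

lemma extend:
  assumes f: "f \<in> homs C a b" and \<chi>: "\<chi> \<in> H a"
  obtains \<xi> where "\<xi> \<in> H b" "res \<xi> f = \<chi>"
proof -
  obtain \<xi>' where \<xi>': "\<xi>' \<in> H b" using hom_ne[of b] C.homs_obj[OF f] by blast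
  obtain g where g: "g \<in> carrier G" "cmp D g \<chi> = res \<xi>' f" using homogeneous[OF f \<chi> \<xi>'] .
  have "res (cmp D (inv\<^bsub>G\<^esub> g) \<xi>') f = \<chi>"
    using act_res[OF G.inv_closed[OF g(1)] \<xi>' f] act_inv(1)[OF g(1) \<chi>] g(2) by simp
  then show thesis using that act_in[OF G.inv_closed[OF g(1)] \<xi>'] by blast
qed

lemma fixator_iff: "g \<in> fixator D u \<chi> \<longleftrightarrow> g \<in> carrier G \<and> cmp D g \<chi> = \<chi>"
  by (simp add: fixator_def)

lemma fixator_in: "c \<in> obj C \<Longrightarrow> \<chi> \<in> H c \<Longrightarrow> fixator D u \<chi> \<in> B"
  by (auto simp: fixators_def)

lemma fixatorsE:
  assumes "K \<in> B"
  obtains c \<chi> where "c \<in> obj C" "\<chi> \<in> H c" "K = fixator D u \<chi>"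
  using assms by (auto simp: fixators_def)

lemma subgroup_fixator:
  assumes "\<chi> \<in> H c"
  shows "subgroup (fixator D u \<chi>) G"
proof (rule G.subgroupI)
  show "fixator D u \<chi> \<noteq> {}" using act_one[OF assms] G.one_closed unfolding fixator_def by blast
  show "inv\<^bsub>G\<^esub> g \<in> fixator D u \<chi>" if "g \<in> fixator D u \<chi>" for g
    using that act_inv(1)[of g \<chi> c] assms by (simp add: fixator_iff)
  show "g \<otimes>\<^bsub>G\<^esub> h \<in> fixator D u \<chi>" if "g \<in> fixator D u \<chi>" "h \<in> fixator D u \<chi>" for g h
    using that act_mult[of g h \<chi> c] assms by (simp add: fixator_iff)
qed (auto simp: fixator_iff)

lemma conjugate_fixator:
  assumes g: "g \<in> carrier G" and \<chi>: "\<chi> \<in> H c"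
  shows "g <#\<^bsub>G\<^esub> fixator D u \<chi> #>\<^bsub>G\<^esub> inv\<^bsub>G\<^esub> g = fixator D u (cmp D g \<chi>)"
proof (intro equalityI subsetI)
  note gi = G.inv_closed[OF g] and g\<chi> = act_in[OF g \<chi>]
  fix k assume "k \<in> g <#\<^bsub>G\<^esub> fixator D u \<chi> #>\<^bsub>G\<^esub> inv\<^bsub>G\<^esub> g"
  then obtain h where h: "h \<in> carrier G" "cmp D h \<chi> = \<chi>" "k = g \<otimes>\<^bsub>G\<^esub> h \<otimes>\<^bsub>G\<^esub> inv\<^bsub>G\<^esub> g"
    by (auto simp: l_coset_def r_coset_def fixator_iff)
  have "cmp D k (cmp D g \<chi>) = cmp D g (cmp D h (cmp D (inv\<^bsub>G\<^esub> g) (cmp D g \<chi>)))"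
    unfolding h(3) using act_mult[OF G.m_closed[OF g h(1)] gi g\<chi>] act_mult[OF g h(1) act_in[OF gi g\<chi>]] by simp
  then show "k \<in> fixator D u (cmp D g \<chi>)" using act_inv(1)[OF g \<chi>] h g by (simp add: fixator_iff)
next
  note gi = G.inv_closed[OF g] and g\<chi> = act_in[OF g \<chi>]
  fix k assume "k \<in> fixator D u (cmp D g \<chi>)"
  then have k: "k \<in> carrier G" "cmp D k (cmp D g \<chi>) = cmp D g \<chi>" by (auto simp: fixator_iff)
  let ?h = "inv\<^bsub>G\<^esub> g \<otimes>\<^bsub>G\<^esub> (k \<otimes>\<^bsub>G\<^esub> g)"
  have "cmp D ?h \<chi> = \<chi>"
    using act_mult[OF gi G.m_closed[OF k(1) g] \<chi>] act_mult[OF k(1) g \<chi>] k(2) act_inv(1)[OF g \<chi>] by simp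
  then have "?h \<in> fixator D u \<chi>" using g k by (simp add: fixator_iff)
  moreover have "g \<otimes>\<^bsub>G\<^esub> ?h = k \<otimes>\<^bsub>G\<^esub> g" using g k by (simp add: G.m_assoc[symmetric])
  then have "k = g \<otimes>\<^bsub>G\<^esub> ?h \<otimes>\<^bsub>G\<^esub> inv\<^bsub>G\<^esub> g" using g k by (simp add: G.m_assoc)
  ultimately show "k \<in> g <#\<^bsub>G\<^esub> fixator D u \<chi> #>\<^bsub>G\<^esub> inv\<^bsub>G\<^esub> g"
    unfolding l_coset_def r_coset_def by blast
qed

lemma base: "algebraic_base G B"
  unfolding algebraic_base_def
proof (intro conjI ballI)
  show "group G" by (rule G.is_group)
  show "B \<noteq> {}" using obj_ne hom_ne fixator_in by blast
  show "subgroup K G" if "K \<in> B" for K using that subgroup_fixator by (auto elim: fixatorsE)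
  show "\<exists>L\<in>B. L \<subseteq> K \<inter> K'" if K: "K \<in> B" and K': "K' \<in> B" for K K'
  proof -
    obtain a \<chi> where a: "a \<in> obj C" "\<chi> \<in> H a" "K = fixator D u \<chi>" using fixatorsE[OF K] .
    obtain b \<xi> where b: "b \<in> obj C" "\<xi> \<in> H b" "K' = fixator D u \<xi>" using fixatorsE[OF K'] .
    obtain e \<zeta> f g where e: "e \<in> obj C" "\<zeta> \<in> H e" "f \<in> homs C a e" "g \<in> homs C b e" "\<chi> = res \<zeta> f" "\<xi> = res \<zeta> g"
      using elements_dominate[OF a(1) b(1) a(2) b(2)] by blast
    have "fixator D u \<zeta> \<subseteq> K \<inter> K'"
      unfolding a b e(5,6) using act_res[OF _ e(2) e(3)] act_res[OF _ e(2) e(4)] by (auto simp: fixator_iff)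
    then show ?thesis using fixator_in[OF e(1,2)] by blast
  qed
  show "g <#\<^bsub>G\<^esub> K #>\<^bsub>G\<^esub> inv\<^bsub>G\<^esub> g \<in> B" if g: "g \<in> carrier G" and K: "K \<in> B" for g K
  proof -
    obtain a \<chi> where a: "a \<in> obj C" "\<chi> \<in> H a" "K = fixator D u \<chi>" using fixatorsE[OF K] .
    show ?thesis unfolding a(3) conjugate_fixator[OF g a(2)] by (rule fixator_in[OF a(1) act_in[OF g a(2)]])
  qed
qed

lemma continuous_iff:
  "continuous_action G T (X, \<phi>) \<longleftrightarrow> group_action G X \<phi> \<and> (\<forall>x\<in>X. \<exists>K\<in>B. \<forall>h\<in>K. \<phi> h x = x)"
  using continuous_action_iff[OF base] by (simp add: Aut_topology_def)

lemma stabilized: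
  assumes X: "X \<in> obj CG" and x: "x \<in> fst X"
  obtains c \<chi> where "c \<in> obj C" "\<chi> \<in> H c" "\<And>g. g \<in> carrier G \<Longrightarrow> cmp D g \<chi> = \<chi> \<Longrightarrow> snd X g x = x"
proof -
  have "continuous_action G T (fst X, snd X)" using X obj_Cont[of "fst X" "snd X" \<U> G T] by simp
  then obtain K where "K \<in> B" "\<forall>h\<in>K. snd X h x = x" using x unfolding continuous_iff by blast
  then show thesis using that by (elim fixatorsE) (auto simp: fixator_iff)
qed

lemma F_ob: "c \<in> obj C \<Longrightarrow> fob F c = hom_gset D (fob E c) u"
  by (simp add: orbit_functor_def)

lemma F_simps [simp]:
  "c \<in> obj C \<Longrightarrow> fst (fob F c) = H c"
  "c \<in> obj C \<Longrightarrow> g \<in> carrier G \<Longrightarrow> \<chi> \<in> H c \<Longrightarrow> snd (fob F c) g \<chi> = cmp D g \<chi>"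
  by (simp_all add: F_ob hom_gset_def)

lemma F_act: "c \<in> obj C \<Longrightarrow> group_action G (H c) (snd (fob F c))"
  by (rule group_actionI[OF G.is_group])
    (auto simp: act_in act_one act_mult, simp add: F_ob hom_gset_def)

lemma F_obj:
  assumes c: "c \<in> obj C"
  shows "fob F c \<in> obj CG"
proof -
  have "continuous_action G T (H c, snd (fob F c))"
    unfolding continuous_iff
  proof (intro conjI ballI F_act[OF c])
    fix \<chi> assume \<chi>: "\<chi> \<in> H c"
    show "\<exists>K\<in>B. \<forall>h\<in>K. snd (fob F c) h \<chi> = \<chi>"
      by (rule bexI[OF _ fixator_in[OF c \<chi>]]) (use c \<chi> in \<open>auto simp: fixator_iff\<close>)
  qed
  then show ?thesis
    using obj_Cont[of "H c" "snd (fob F c)" \<U> G T] hom_small[OF c] c by (simp add: F_ob hom_gset_def)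
qed

lemma F_transitive: "c \<in> obj C \<Longrightarrow> transitive_action G (H c) (snd (fob F c))"
  using F_act transitive by (auto simp: transitive_action_def transitive_action_axioms_def) (metis F_simps(2))

lemma F_ar:
  assumes f: "f \<in> homs C a b"
  shows "far F f \<in> homs CG (fob F b) (fob F a)" "\<chi> \<in> H b \<Longrightarrow> gapp (far F f) \<chi> = res \<chi> f"
proof -
  note ab = C.homs_obj[OF f]
  have eq: "far F f = (fob F b, fob F a, \<lambda>\<chi>\<in>fst (fob F b). res \<chi> f)"
    using homsD[OF f] ab by (simp add: orbit_functor_def hom_gset_def)
  show "far F f \<in> homs CG (fob F b) (fob F a)" unfolding eq
    by (rule Cont_homsI[OF F_obj[OF ab(2)] F_obj[OF ab(1)]])
      (use ab in \<open>auto simp: res_in[OF f] act_res[OF _ _ f] act_in\<close>)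
  show "\<chi> \<in> H b \<Longrightarrow> gapp (far F f) \<chi> = res \<chi> f" using ab by (simp add: eq)
qed

lemma is_functor_F: "is_functor (opp C) CG F"
proof -
  interpret Cop: category "opp C" by (rule category_opp) unfold_locales
  interpret CG: category CG by (rule category_Cont)
  show ?thesis
  proof unfold_locales
    fix a assume "a \<in> obj (opp C)"
    then have a: "a \<in> obj C" by simp
    then show "fob F a \<in> obj CG" by (rule F_obj)
    have "far F (ide C a) = ide CG (fob F a)"
      by (rule gapp_ext[OF F_ar(1)[OF C.ide_homs[OF a]] CG.ide_homs[OF F_obj[OF a]]])
        (use a F_ar(2)[OF C.ide_homs[OF a]] res_ide in simp)
    then show "far F (ide (opp C) a) = ide CG (fob F a)" by simp
  next
    fix f a b assume "f \<in> homs (opp C) a b"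
    then show "far F f \<in> homs CG (fob F a) (fob F b)" using F_ar(1)[of f b a] by simp
  next
    fix f g a b c assume "f \<in> homs (opp C) a b" "g \<in> homs (opp C) b c"
    then have f: "f \<in> homs C b a" and g: "g \<in> homs C c b" by simp_all
    note gf = C.cmp_homs[OF g f]
    have "far F (cmp C f g) = cmp CG (far F g) (far F f)"
    proof (rule gapp_ext[OF F_ar(1)[OF gf] CG.cmp_homs[OF F_ar(1)[OF f] F_ar(1)[OF g]]])
      fix \<chi> assume "\<chi> \<in> fst (fob F a)"
      then have \<chi>: "\<chi> \<in> H a" using C.homs_obj[OF f] by simp
      show "gapp (far F (cmp C f g)) \<chi> = gapp (cmp CG (far F g) (far F f)) \<chi>"
        using gapp_cmp[OF F_ar(1)[OF f] F_ar(1)[OF g], of \<chi>] \<chi> C.homs_obj[OF f] F_ar(2)[OF f \<chi>]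
          F_ar(2)[OF g res_in[OF f \<chi>]] F_ar(2)[OF gf \<chi>] res_cmp[OF g f \<chi>] by simp
    qed
    then show "far F (cmp (opp C) g f) = cmp CG (far F g) (far F f)" by simp
  qed (simp_all add: orbit_functor_def)
qed

lemma is_functor_F_transitive: "is_functor (opp C) (Cont_t \<U> G T) F"
  unfolding Cont_t_def
proof (rule is_functor_full_sub[OF is_functor_F])
  fix c assume "c \<in> obj (opp C)"
  then have c: "c \<in> obj C" by simp
  obtain X \<phi> where X: "fob F c = (X, \<phi>)" by fastforce
  show "fob F c \<in> {(X, \<phi>). X \<noteq> {} \<and> transitive_action G X \<phi>}"
    using F_transitive[OF c] hom_ne[OF c] F_simps(1)[OF c] by (simp add: X)
qed

lemma F_hom_ext:
  assumes c: "c \<in> obj C" and t: "t \<in> homs CG (fob F c) X" and s: "s \<in> homs CG (fob F c) X"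
    and \<chi>: "\<chi> \<in> H c" and eq: "gapp t \<chi> = gapp s \<chi>"
  shows "t = s"
proof (rule gapp_ext[OF t s])
  fix \<xi> assume "\<xi> \<in> fst (fob F c)"
  then have "\<xi> \<in> H c" using c by simp
  then obtain g where g: "g \<in> carrier G" "cmp D g \<chi> = \<xi>" using transitive[OF c \<chi>] by blast
  then show "gapp t \<xi> = gapp s \<xi>"
    using gapp_act[OF t g(1), of \<chi>] gapp_act[OF s g(1), of \<chi>] \<chi> c eq by simp
qed

lemma F_hom_exists:
  assumes c: "c \<in> obj C" and X: "X \<in> obj CG" and x: "x \<in> fst X" and \<chi>: "\<chi> \<in> H c"
    and st: "\<And>g. g \<in> carrier G \<Longrightarrow> cmp D g \<chi> = \<chi> \<Longrightarrow> snd X g x = x"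
  obtains t where "t \<in> homs CG (fob F c) X" "gapp t \<chi> = x"
proof -
  define s where "s \<xi> = (SOME g. g \<in> carrier G \<and> cmp D g \<chi> = \<xi>)" for \<xi>
  have s: "s \<xi> \<in> carrier G" "cmp D (s \<xi>) \<chi> = \<xi>" if \<xi>: "\<xi> \<in> H c" for \<xi>
    using someI_ex[of "\<lambda>g. g \<in> carrier G \<and> cmp D g \<chi> = \<xi>"] transitive[OF c \<chi> \<xi>] unfolding s_def by metis+
  have eq: "snd X (s (cmp D g \<chi>)) x = snd X g x" if g: "g \<in> carrier G" for g
  proof -
    let ?k = "s (cmp D g \<chi>)"
    have k: "?k \<in> carrier G" "cmp D ?k \<chi> = cmp D g \<chi>" using s[OF act_in[OF g \<chi>]] by auto
    have "cmp D (inv\<^bsub>G\<^esub> g \<otimes>\<^bsub>G\<^esub> ?k) \<chi> = \<chi>"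
      using act_mult[OF G.inv_closed[OF g] k(1) \<chi>] k(2) act_inv(1)[OF g \<chi>] by simp
    then have "snd X (inv\<^bsub>G\<^esub> g \<otimes>\<^bsub>G\<^esub> ?k) x = x" using st g k(1) by simp
    then have "snd X g x = snd X (g \<otimes>\<^bsub>G\<^esub> (inv\<^bsub>G\<^esub> g \<otimes>\<^bsub>G\<^esub> ?k)) x"
      using Cont_actionD(4)[OF X g G.m_closed[OF G.inv_closed[OF g] k(1)] x] by simp
    then show ?thesis using g k by (simp add: G.m_assoc[symmetric])
  qed
  have "(fob F c, X, \<lambda>\<xi>\<in>fst (fob F c). snd X (s \<xi>) x) \<in> homs CG (fob F c) X"
  proof (rule Cont_homsI[OF F_obj[OF c] X])
    show "snd X (s \<xi>) x \<in> fst X" if "\<xi> \<in> fst (fob F c)" for \<xi>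
      using Cont_actionD(1)[OF X s(1) x] that c by simp
    fix g \<xi> assume g: "g \<in> carrier G" and "\<xi> \<in> fst (fob F c)"
    then have \<xi>: "\<xi> \<in> H c" using c by simp
    have "cmp D g \<xi> = cmp D (g \<otimes>\<^bsub>G\<^esub> s \<xi>) \<chi>" using act_mult[OF g s(1)[OF \<xi>] \<chi>] s(2)[OF \<xi>] by simp
    then show "snd X (s (snd (fob F c) g \<xi>)) x = snd X g (snd X (s \<xi>) x)"
      using eq[OF G.m_closed[OF g s(1)[OF \<xi>]]] Cont_actionD(4)[OF X g s(1)[OF \<xi>] x] c g \<xi> by simp
  qed
  moreover have "gapp (fob F c, X, \<lambda>\<xi>\<in>fst (fob F c). snd X (s \<xi>) x) \<chi> = x"
    using eq[OF G.one_closed] act_one[OF \<chi>] Cont_actionD(3)[OF X x] c \<chi> by simp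
  ultimately show thesis using that by blast
qed

lemma F_covers:
  assumes X: "X \<in> obj CG" and x: "x \<in> fst X"
  obtains c \<chi> m where "c \<in> obj C" "\<chi> \<in> H c" "m \<in> homs CG (fob F c) X" "gapp m \<chi> = x"
  using stabilized[OF assms] F_hom_exists[OF _ assms] by metis

lemma small_F_homs:
  assumes c: "c \<in> obj C" and X: "X \<in> obj CG"
  shows "small \<U> (homs CG (fob F c) X)"
proof -
  obtain \<chi> where \<chi>: "\<chi> \<in> H c" using hom_ne[OF c] by blast
  show ?thesis
  proof (rule small_inj_on)
    show "small \<U> (fst X)" using X obj_Cont[of "fst X" "snd X" \<U> G T] by simp
    show "inj_on (\<lambda>t. gapp t \<chi>) (homs CG (fob F c) X)" by (rule inj_onI) (rule F_hom_ext[OF c _ _ \<chi>])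
    show "(\<lambda>t. gapp t \<chi>) ` homs CG (fob F c) X \<subseteq> fst X" using gapp_homs \<chi> c by fastforce
  qed
qed


section \<open>The equivalence\<close>

sublocale CG: category CG by (rule category_Cont)

sublocale F: is_functor "opp C" CG F by (rule is_functor_F)

abbreviation hom where "hom X \<equiv> hom_presheaf (opp C) CG F X"

lemma hom_simps:
  "c \<in> obj C \<Longrightarrow> fob (hom X) c = homs CG (fob F c) X"
  "f \<in> homs C c d \<Longrightarrow> m \<in> homs CG (fob F c) X \<Longrightarrow> app (far (hom X) f) m = cmp CG m (far F f)"
  using fob_hom_presheaf[of c "opp C" CG F X] far_hom_presheaf[of f "opp C" d c m CG F X] by simp_all

lemma gapp_res:
  assumes "f \<in> homs C c d" "m \<in> homs CG (fob F c) X" "\<xi> \<in> H d"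
  shows "gapp (cmp CG m (far F f)) \<xi> = gapp m (res \<xi> f)"
  using gapp_cmp[OF F_ar(1)[OF assms(1)] assms(2)] F_ar(2)[OF assms(1,3)] assms(3) C.homs_obj[OF assms(1)]
  by simp

lemma is_functor_hom: "X \<in> obj CG \<Longrightarrow> is_functor C (SetC \<U>) (hom X)"
  using is_functor_hom_presheaf[OF is_functor_F, of X \<U>] small_F_homs by simp

lemma hom_sheaf:
  assumes X: "X \<in> obj CG"
  shows "is_sheaf (opp C) (atomic_topology (opp C)) (hom X)"
  unfolding atomic_sheaf_iff[OF C.category_axioms AP is_functor_hom[OF X]]
proof (intro conjI allI ballI impI)
  fix c d f m m' assume f: "f \<in> homs C c d" and "m \<in> fob (hom X) c" "m' \<in> fob (hom X) c"
    and eq: "app (far (hom X) f) m = app (far (hom X) f) m'"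
  note cd = C.homs_obj[OF f]
  have m: "m \<in> homs CG (fob F c) X" "m' \<in> homs CG (fob F c) X"
    using \<open>m \<in> _\<close> \<open>m' \<in> _\<close> cd by (simp_all add: hom_simps)
  obtain \<xi> where \<xi>: "\<xi> \<in> H d" using hom_ne[OF cd(2)] by blast
  have "gapp m (res \<xi> f) = gapp m' (res \<xi> f)"
    using eq gapp_res[OF f m(1) \<xi>] gapp_res[OF f m(2) \<xi>] by (simp add: hom_simps(2)[OF f] m)
  then show "m = m'" by (rule F_hom_ext[OF cd(1) m res_in[OF f \<xi>]])
next
  fix c d f q assume f: "f \<in> homs C c d" and "q \<in> fob (hom X) d"
    and inv: "\<forall>e. \<forall>h\<in>homs C d e. \<forall>h'\<in>homs C d e. cmp C h f = cmp C h' f \<longrightarrow>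
      app (far (hom X) h) q = app (far (hom X) h') q"
  note cd = C.homs_obj[OF f]
  have q: "q \<in> homs CG (fob F d) X" using \<open>q \<in> _\<close> cd by (simp add: hom_simps)
  obtain \<xi> where \<xi>: "\<xi> \<in> H d" using hom_ne[OF cd(2)] by blast
  note \<xi>f = res_in[OF f \<xi>]
  have st: "snd X g (gapp q \<xi>) = gapp q \<xi>" if g: "g \<in> carrier G" and g_fix: "cmp D g (res \<xi> f) = res \<xi> f" for g
  proof -
    note g\<xi> = act_in[OF g \<xi>]
    obtain e \<zeta> h h' where \<zeta>: "\<zeta> \<in> H e" and h: "h \<in> homs C d e" "h' \<in> homs C d e" and eq: "\<xi> = res \<zeta> h" "cmp D g \<xi> = res \<zeta> h'"
      using elements_dominate[OF cd(2) cd(2) \<xi> g\<xi>] by blast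
    have "res \<zeta> (cmp C h f) = res \<zeta> (cmp C h' f)"
      using res_cmp[OF f h(1) \<zeta>] res_cmp[OF f h(2) \<zeta>] act_res[OF g \<xi> f] g_fix eq by simp
    then obtain e' k \<zeta>' where k: "k \<in> homs C e e'" and \<zeta>': "\<zeta>' \<in> H e'" and \<zeta>k: "\<zeta> = res \<zeta>' k"
      and keq: "cmp C k (cmp C h f) = cmp C k (cmp C h' f)"
      using elements_equalize[OF C.cmp_homs[OF f h(1)] C.cmp_homs[OF f h(2)] \<zeta>] by blast
    note kh = C.cmp_homs[OF h(1) k] and kh' = C.cmp_homs[OF h(2) k]
    have "app (far (hom X) (cmp C k h)) q = app (far (hom X) (cmp C k h')) q"
      using inv kh kh' keq C.cmp_assoc[OF f h(1) k] C.cmp_assoc[OF f h(2) k] by metis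
    then have "gapp q (res \<zeta>' (cmp C k h)) = gapp q (res \<zeta>' (cmp C k h'))"
      using gapp_res[OF kh q \<zeta>'] gapp_res[OF kh' q \<zeta>'] hom_simps(2)[OF kh q] hom_simps(2)[OF kh' q] by simp
    then have "gapp q \<xi> = gapp q (cmp D g \<xi>)"
      using res_cmp[OF h(1) k \<zeta>'] res_cmp[OF h(2) k \<zeta>'] \<zeta>k eq by simp
    then show ?thesis using gapp_act[OF q g, of \<xi>] \<xi> g cd by simp
  qed
  have "gapp q \<xi> \<in> fst X" using gapp_homs[OF q] \<xi> cd by simp
  then obtain p where p: "p \<in> homs CG (fob F c) X" "gapp p (res \<xi> f) = gapp q \<xi>"
    using F_hom_exists[OF cd(1) X _ \<xi>f st] by blast
  have "cmp CG p (far F f) = q"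
    by (rule F_hom_ext[OF cd(2) CG.cmp_homs[OF F_ar(1)[OF f] p(1)] q \<xi>]) (simp add: gapp_res[OF f p(1) \<xi>] p(2))
  then show "\<exists>p\<in>fob (hom X) c. app (far (hom X) f) p = q"
    using p(1) cd hom_simps(2)[OF f p(1)] by (auto simp: hom_simps(1))
qed

abbreviation SH where "SH \<equiv> Sh \<U> (opp C) (atomic_topology (opp C))"
abbreviation \<Phi> where "\<Phi> \<equiv> hom_functor (opp C) CG F"

lemma is_functor_\<Phi>_PSh: "is_functor CG (PSh \<U> (opp C)) \<Phi>"
  by (rule is_functor_hom_functor[OF is_functor_F]) (simp add: small_F_homs)

lemma is_functor_\<Phi>: "is_functor CG SH \<Phi>"
  unfolding Sh_def
  by (rule is_functor_full_sub[OF is_functor_\<Phi>_PSh]) (simp add: hom_functor_simps(1) hom_sheaf)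

lemma \<Phi>_app:
  assumes t: "t \<in> homs CG X Y" and c: "c \<in> obj C" and m: "m \<in> homs CG (fob F c) X"
  shows "app (snd (snd (far \<Phi> t)) c) m = cmp CG t m"
  using hom_functor_simps(2)[OF t, of "opp C" F] c m by simp

lemma full_faithful:
  assumes X: "X \<in> obj CG" and Y: "Y \<in> obj CG"
  shows "bij_betw (far \<Phi>) (homs CG X Y) (homs SH (fob \<Phi> X) (fob \<Phi> Y))"
proof -
  interpret \<Phi>: is_functor CG "PSh \<U> (opp C)" \<Phi> by (rule is_functor_\<Phi>_PSh)
  have ob: "fob \<Phi> X = hom X" "fob \<Phi> Y = hom Y" using X Y by (simp_all add: hom_functor_simps(1))
  have SH: "homs SH (fob \<Phi> X) (fob \<Phi> Y) = homs (PSh \<U> (opp C)) (hom X) (hom Y)"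
    using hom_sheaf X Y by (simp add: Sh_def homs_full_sub ob)
  have inj: "inj_on (far \<Phi>) (homs CG X Y)"
  proof (rule inj_onI)
    fix t s assume t: "t \<in> homs CG X Y" and s: "s \<in> homs CG X Y" and eq: "far \<Phi> t = far \<Phi> s"
    show "t = s"
    proof (rule gapp_ext[OF t s])
      fix x assume x: "x \<in> fst X"
      obtain c \<chi> m where c: "c \<in> obj C" "\<chi> \<in> H c" and m: "m \<in> homs CG (fob F c) X" "gapp m \<chi> = x"
        using F_covers[OF X x] .
      have "cmp CG t m = cmp CG s m" using \<Phi>_app[OF t c(1) m(1)] \<Phi>_app[OF s c(1) m(1)] eq by simp
      then show "gapp t x = gapp s x"
        using gapp_cmp[OF m(1) t, of \<chi>] gapp_cmp[OF m(1) s, of \<chi>] c m(2) by simp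
    qed
  qed
  have surj: "\<exists>t\<in>homs CG X Y. far \<Phi> t = \<alpha>" if \<alpha>: "\<alpha> \<in> homs (PSh \<U> (opp C)) (hom X) (hom Y)" for \<alpha>
  proof -
    define a where "a c m = app (snd (snd \<alpha>) c) m" for c m
    have a: "a c m \<in> homs CG (fob F c) Y" if "c \<in> obj C" "m \<in> homs CG (fob F c) X" for c m
      using PSh_app_in[OF \<alpha>, of c m] that by (simp add: hom_simps(1) a_def)
    have a_nat: "a d (cmp CG m (far F f)) = cmp CG (a c m) (far F f)"
      if f: "f \<in> homs C c d" and m: "m \<in> homs CG (fob F c) X" for c d f m
      using PSh_app_nat[OF \<alpha>, of f d c m] f m a[OF C.homs_obj(1)[OF f] m] C.homs_obj[OF f]
        hom_simps(2)[OF f m] hom_simps(2)[OF f a[OF C.homs_obj(1)[OF f] m]]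
      by (simp add: hom_simps(1) a_def)
    have push: "gapp (a e (cmp CG m (far F f))) \<zeta> = gapp (a c m) (res \<zeta> f)"
      if f: "f \<in> homs C c e" and m: "m \<in> homs CG (fob F c) X" and \<zeta>: "\<zeta> \<in> H e" for c e f m \<zeta>
      using a_nat[OF f m] gapp_res[OF f a[OF C.homs_obj(1)[OF f] m] \<zeta>] by simp
    have indep: "gapp (a c m) \<chi> = gapp (a d n) \<xi>"
      if c: "c \<in> obj C" "\<chi> \<in> H c" and m: "m \<in> homs CG (fob F c) X"
        and d: "d \<in> obj C" "\<xi> \<in> H d" and n: "n \<in> homs CG (fob F d) X" and eq: "gapp m \<chi> = gapp n \<xi>" for c \<chi> m d \<xi> n
    proof -
      obtain e \<zeta> f g where e: "e \<in> obj C" and \<zeta>: "\<zeta> \<in> H e" and f: "f \<in> homs C c e" and g: "g \<in> homs C d e"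
        and r: "\<chi> = res \<zeta> f" "\<xi> = res \<zeta> g"
        using elements_dominate[OF c(1) d(1) c(2) d(2)] by blast
      have "cmp CG m (far F f) = cmp CG n (far F g)"
        by (rule F_hom_ext[OF e CG.cmp_homs[OF F_ar(1)[OF f] m] CG.cmp_homs[OF F_ar(1)[OF g] n] \<zeta>])
          (use gapp_res[OF f m \<zeta>] gapp_res[OF g n \<zeta>] eq r in simp)
      then show ?thesis using push[OF f m \<zeta>] push[OF g n \<zeta>] r by simp
    qed
    have "\<exists>y. \<forall>c \<chi> m. c \<in> obj C \<longrightarrow> \<chi> \<in> H c \<longrightarrow> m \<in> homs CG (fob F c) X \<longrightarrow> gapp m \<chi> = x \<longrightarrow> gapp (a c m) \<chi> = y" for x
    proof (cases "\<exists>c \<chi> m. c \<in> obj C \<and> \<chi> \<in> H c \<and> m \<in> homs CG (fob F c) X \<and> gapp m \<chi> = x")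
      case True
      then obtain d \<xi> n where dn: "d \<in> obj C" "\<xi> \<in> H d" "n \<in> homs CG (fob F d) X" "gapp n \<xi> = x" by blast
      show ?thesis by (rule exI[of _ "gapp (a d n) \<xi>"]) (use indep[OF _ _ _ dn(1,2,3)] dn(4) in auto)
    qed blast
    then obtain y where y: "\<And>c \<chi> m. c \<in> obj C \<Longrightarrow> \<chi> \<in> H c \<Longrightarrow> m \<in> homs CG (fob F c) X \<Longrightarrow> gapp (a c m) \<chi> = y (gapp m \<chi>)"
      by metis
    define t where "t = (X, Y, \<lambda>x\<in>fst X. y x)"
    have t: "t \<in> homs CG X Y" unfolding t_def
    proof (rule Cont_homsI[OF X Y])
      fix x assume x: "x \<in> fst X"
      obtain c \<chi> m where c: "c \<in> obj C" "\<chi> \<in> H c" and m: "m \<in> homs CG (fob F c) X" "gapp m \<chi> = x"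
        using F_covers[OF X x] .
      show "y x \<in> fst Y" using gapp_homs[OF a[OF c(1) m(1)], of \<chi>] y[OF c m(1)] m(2) c by simp
      fix g assume g: "g \<in> carrier G"
      have "snd X g x = gapp m (cmp D g \<chi>)" using gapp_act[OF m(1) g, of \<chi>] m(2) c g by simp
      then show "y (snd X g x) = snd Y g (y x)"
        using y[OF c(1) act_in[OF g c(2)] m(1)] y[OF c m(1)] m(2) gapp_act[OF a[OF c(1) m(1)] g, of \<chi>] c g by simp
    qed
    have "far \<Phi> t = \<alpha>"
    proof (rule PSh_ext[OF _ \<alpha>])
      show "far \<Phi> t \<in> homs (PSh \<U> (opp C)) (hom X) (hom Y)" using \<Phi>.far_homs[OF t] by (simp add: ob)
      fix c m assume "c \<in> obj (opp C)" and "m \<in> fob (hom X) c"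
      then have c: "c \<in> obj C" and m: "m \<in> homs CG (fob F c) X" by (simp_all add: hom_simps(1))
      have "cmp CG t m = a c m"
      proof (rule gapp_ext[OF CG.cmp_homs[OF m t] a[OF c m]])
        fix \<chi> assume \<chi>: "\<chi> \<in> fst (fob F c)"
        then have "gapp (cmp CG t m) \<chi> = y (gapp m \<chi>)"
          using gapp_cmp[OF m t \<chi>] gapp_homs[OF m \<chi>] by (simp add: t_def)
        then show "gapp (cmp CG t m) \<chi> = gapp (a c m) \<chi>" using y[OF c _ m] \<chi> c by simp
      qed
      then show "app (snd (snd (far \<Phi> t)) c) m = app (snd (snd \<alpha>) c) m"
        using \<Phi>_app[OF t c m] by (simp add: a_def)
    qed
    then show ?thesis using t by blast
  qed
  have "far \<Phi> ` homs CG X Y = homs (PSh \<U> (opp C)) (hom X) (hom Y)"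
    using surj \<Phi>.far_homs[of _ X Y] by (auto simp: ob) (metis imageI)
  then show ?thesis using inj by (simp add: bij_betw_def SH)
qed

text \<open>The continuous action with \<open>Hom(F -, X) \<cong> P\<close> is the colimit of the sets \<open>P c\<close> over the pairs of an object
  \<open>c\<close> and an arrow \<open>\<chi>: c \<rightarrow> u\<close>, on which \<open>G\<close> acts through \<open>\<chi>\<close>.\<close>

lemma essentially_surjective:
  assumes "P \<in> obj SH"
  shows "\<exists>X\<in>obj CG. iso SH (fob \<Phi> X) P \<noteq> {}"
proof -
  have P: "is_functor C (SetC \<U>) P" and sheaf: "is_sheaf (opp C) (atomic_topology (opp C)) P"
    using assms by (simp_all add: Sh_def PSh_def)
  note Pin = copresheafD(3)[OF P]
  have Pcmp: "app (far P (cmp C g f)) p = app (far P g) (app (far P f) p)"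
    if "f \<in> homs C a b" "g \<in> homs C b c" "p \<in> fob P a" for f g a b c p
    by (rule copresheafD(5)[OF P that(2,1,3)])
  note sh = sheaf[unfolded atomic_sheaf_iff[OF C.category_axioms AP P]]
  have sep: "p = p'" if "f \<in> homs C c d" "p \<in> fob P c" "p' \<in> fob P c" "app (far P f) p = app (far P f) p'"
    for c d f p p' using conjunct1[OF sh] that by blast
  have desc: "\<exists>p\<in>fob P c. app (far P f) p = q" if "f \<in> homs C c d" "q \<in> fob P d"
    "\<And>e h h'. h \<in> homs C d e \<Longrightarrow> h' \<in> homs C d e \<Longrightarrow> cmp C h f = cmp C h' f \<Longrightarrow> app (far P h) q = app (far P h') q"
    for c d f q using conjunct2[OF sh] that by blast
  define S where "S = (SIGMA c:obj C. H c \<times> fob P c)"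
  define R where "R = (\<lambda>(c, \<chi>, p) (d, \<xi>, q). \<exists>e \<zeta> f g. \<zeta> \<in> H e \<and> f \<in> homs C c e \<and> g \<in> homs C d e \<and>
    \<chi> = res \<zeta> f \<and> \<xi> = res \<zeta> g \<and> app (far P f) p = app (far P g) q)"
  have S_iff: "(c, \<chi>, p) \<in> S \<longleftrightarrow> c \<in> obj C \<and> \<chi> \<in> H c \<and> p \<in> fob P c" for c \<chi> p by (simp add: S_def)
  have small_S: "small \<U> S" unfolding S_def
    by (intro small_Sigma[OF univ] small_obj hom_small copresheafD(1)[OF P])
  have R_push: "R (c, res \<xi> f, p) (d, \<xi>, app (far P f) p)"
    if f: "f \<in> homs C c d" and \<xi>: "\<xi> \<in> H d" and p: "p \<in> fob P c" for c d f \<xi> p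
  proof -
    have d: "d \<in> obj C" using C.homs_obj[OF f] by simp
    show ?thesis unfolding R_def prod.case
      by (intro exI[of _ d] exI[of _ \<xi>] exI[of _ f] exI[of _ "ide C d"])
        (use f \<xi> C.ide_homs[OF d] res_ide[OF d \<xi>] copresheafD(4)[OF P d Pin[OF f p]] in simp)
  qed
  have R_refl: "R x x" if "x \<in> S" for x
  proof -
    obtain c \<chi> p where x: "x = (c, \<chi>, p)" by (cases x)
    then have c: "c \<in> obj C" "\<chi> \<in> H c" "p \<in> fob P c" using that by (simp_all add: S_iff)
    show ?thesis unfolding R_def x prod.case
      by (intro exI[of _ c] exI[of _ \<chi>] exI[of _ "ide C c"]) (use c C.ide_homs res_ide in simp)
  qed
  have R_sym: "R y x" if "R x y" for x y
    using that unfolding R_def by (cases x, cases y) (clarsimp, metis)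
  have R_trans: "R x z" if x: "x \<in> S" and y: "y \<in> S" and z: "z \<in> S" and xy: "R x y" and yz: "R y z" for x y z
  proof -
    obtain c \<chi> p d \<xi> q b \<omega> s where [simp]: "x = (c, \<chi>, p)" "y = (d, \<xi>, q)" "z = (b, \<omega>, s)" by (cases x, cases y, cases z)
    have p: "p \<in> fob P c" and q: "q \<in> fob P d" and s: "s \<in> fob P b" using x y z by (simp_all add: S_iff)
    obtain e \<zeta> f g where e: "\<zeta> \<in> H e" "f \<in> homs C c e" "g \<in> homs C d e" "\<chi> = res \<zeta> f" "\<xi> = res \<zeta> g"
      "app (far P f) p = app (far P g) q" using xy by (auto simp: R_def)
    obtain e' \<zeta>' f' g' where e': "\<zeta>' \<in> H e'" "f' \<in> homs C d e'" "g' \<in> homs C b e'" "\<xi> = res \<zeta>' f'" "\<omega> = res \<zeta>' g'"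
      "app (far P f') q = app (far P g') s" using yz by (auto simp: R_def)
    obtain k \<eta> a a' where k: "\<eta> \<in> H k" "a \<in> homs C e k" "a' \<in> homs C e' k" "\<zeta> = res \<eta> a" "\<zeta>' = res \<eta> a'"
      using elements_dominate[OF _ _ e(1) e'(1)] C.homs_obj(2)[OF e(2)] C.homs_obj(2)[OF e'(2)] by blast
    note ag = C.cmp_homs[OF e(3) k(2)] and af' = C.cmp_homs[OF e'(2) k(3)]
    have "res \<eta> (cmp C a g) = res \<eta> (cmp C a' f')"
      using res_cmp[OF e(3) k(2,1)] res_cmp[OF e'(2) k(3,1)] k(4,5) e(5) e'(4) by simp
    then obtain l h \<eta>' where l: "h \<in> homs C k l" "\<eta>' \<in> H l" "\<eta> = res \<eta>' h" "cmp C h (cmp C a g) = cmp C h (cmp C a' f')"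
      using elements_equalize[OF ag af' k(1)] by blast
    note ha = C.cmp_homs[OF k(2) l(1)] and ha' = C.cmp_homs[OF k(3) l(1)]
    have hh: "cmp C (cmp C h a) g = cmp C (cmp C h a') f'"
      using l(4) C.cmp_assoc[OF e(3) k(2) l(1)] C.cmp_assoc[OF e'(2) k(3) l(1)] by simp
    let ?f = "cmp C (cmp C h a) f" and ?g = "cmp C (cmp C h a') g'"
    have fg: "?f \<in> homs C c l" "?g \<in> homs C b l" using C.cmp_homs[OF e(2) ha] C.cmp_homs[OF e'(3) ha'] by auto
    have "app (far P ?f) p = app (far P (cmp C (cmp C h a) g)) q"
      using Pcmp[OF e(2) ha p] Pcmp[OF e(3) ha q] e(6) by simp
    also have "\<dots> = app (far P ?g) s"
      unfolding hh using Pcmp[OF e'(2) ha' q] Pcmp[OF e'(3) ha' s] e'(6) by simp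
    finally have "app (far P ?f) p = app (far P ?g) s" .
    moreover have "\<chi> = res \<eta>' ?f" "\<omega> = res \<eta>' ?g"
      using res_cmp[OF e(2) ha l(2)] res_cmp[OF k(2) l(1,2)] res_cmp[OF e'(3) ha' l(2)] res_cmp[OF k(3) l(1,2)]
        e(4) e'(5) k(4,5) l(3) by simp_all
    ultimately show ?thesis using l(2) fg unfolding R_def by auto
  qed
  have "\<exists>q :: 'o \<times> 'n \<times> _ \<Rightarrow> 'v. \<forall>x\<in>S. \<forall>y\<in>S. q x = q y \<longleftrightarrow> R x y"
    by (rule small_quotient[OF small_S]) (blast intro: R_refl R_sym R_trans)+
  then obtain q0 :: "'o \<times> 'n \<times> _ \<Rightarrow> 'v" where q0: "\<forall>x\<in>S. \<forall>y\<in>S. q0 x = q0 y \<longleftrightarrow> R x y" by blast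
  obtain emb :: "'v \<Rightarrow> 'n" where emb: "inj emb" using embedding by blast
  define Q where "Q x = emb (q0 x)" for x
  have Q: "Q x = Q y \<longleftrightarrow> R x y" if "x \<in> S" "y \<in> S" for x y
    using q0 that inj_eq[OF emb] by (simp add: Q_def)
  have Q_cases: "\<exists>c \<chi> p. x = Q (c, \<chi>, p) \<and> (c, \<chi>, p) \<in> S" if "x \<in> Q ` S" for x
  proof -
    obtain y where y: "x = Q y" "y \<in> S" using \<open>x \<in> Q ` S\<close> by (rule imageE)
    obtain c \<chi> p where "y = (c, \<chi>, p)" by (rule prod_cases3)
    then show ?thesis using y by blast
  qed
  have Q_push: "Q (c, res \<xi> f, p) = Q (d, \<xi>, app (far P f) p)"
    if f: "f \<in> homs C c d" and \<xi>: "\<xi> \<in> H d" and p: "p \<in> fob P c" for c d f \<xi> p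
    using Q R_push[OF that] C.homs_obj[OF f] res_in[OF f \<xi>] Pin[OF f p] \<xi> p by (simp add: S_iff)
  have Q_inj: "p = p'" if c: "c \<in> obj C" "\<chi> \<in> H c" and p: "p \<in> fob P c" "p' \<in> fob P c" and eq: "Q (c, \<chi>, p) = Q (c, \<chi>, p')"
    for c \<chi> p p'
  proof -
    obtain e \<zeta> f g where e: "\<zeta> \<in> H e" "f \<in> homs C c e" "g \<in> homs C c e" "\<chi> = res \<zeta> f" "\<chi> = res \<zeta> g"
      "app (far P f) p = app (far P g) p'" using eq c p by (auto simp: Q S_iff R_def)
    obtain l h where h: "h \<in> homs C e l" "cmp C h f = cmp C h g"
      using elements_equalize[OF e(2,3,1)] e(4,5) by blast
    have "app (far P (cmp C h f)) p = app (far P (cmp C h f)) p'"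
      using Pcmp[OF e(2) h(1) p(1)] Pcmp[OF e(3) h(1) p(2)] e(6) h(2) by simp
    then show ?thesis by (rule sep[OF C.cmp_homs[OF e(2) h(1)] p])
  qed
  define \<phi> where "\<phi> = (\<lambda>g\<in>carrier G. \<lambda>x\<in>Q ` S. lift S Q (\<lambda>(c, \<chi>, p). Q (c, cmp D g \<chi>, p)) x)"
  have S_act: "(c, cmp D g \<chi>, p) \<in> S" if "g \<in> carrier G" "(c, \<chi>, p) \<in> S" for g c \<chi> p
    using that act_in by (simp add: S_iff)
  have \<phi>: "\<phi> g (Q (c, \<chi>, p)) = Q (c, cmp D g \<chi>, p)" if g: "g \<in> carrier G" and x: "(c, \<chi>, p) \<in> S" for g c \<chi> p
  proof -
    have "Q (d, cmp D g \<xi>, q) = Q (c, cmp D g \<chi>, p)" if y: "(d, \<xi>, q) \<in> S" and eq: "Q (d, \<xi>, q) = Q (c, \<chi>, p)" for d \<xi> q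
    proof -
      obtain e \<zeta> f f' where e: "\<zeta> \<in> H e" "f \<in> homs C d e" "f' \<in> homs C c e" "\<xi> = res \<zeta> f" "\<chi> = res \<zeta> f'"
        "app (far P f) q = app (far P f') p" using eq x y by (auto simp: Q R_def)
      then show ?thesis
        using Q_push[OF e(2) act_in[OF g e(1)], of q] Q_push[OF e(3) act_in[OF g e(1)], of p] x y
          act_res[OF g e(1,2)] act_res[OF g e(1,3)] by (simp add: S_iff)
    qed
    then have eq: "(\<lambda>(c, \<chi>, p). Q (c, cmp D g \<chi>, p)) y = (\<lambda>(c, \<chi>, p). Q (c, cmp D g \<chi>, p)) (c, \<chi>, p)"
      if "y \<in> S" "Q y = Q (c, \<chi>, p)" for y using that by (cases y) simp
    have "lift S Q (\<lambda>(c, \<chi>, p). Q (c, cmp D g \<chi>, p)) (Q (c, \<chi>, p)) = (\<lambda>(c, \<chi>, p). Q (c, cmp D g \<chi>, p)) (c, \<chi>, p)"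
      by (rule lift_eq[of S Q "(c, \<chi>, p)" "\<lambda>(c, \<chi>, p). Q (c, cmp D g \<chi>, p)", OF eq x])
    then show ?thesis using g x by (simp add: \<phi>_def)
  qed
  have act: "group_action G (Q ` S) \<phi>"
  proof (rule group_actionI[OF G.is_group])
    show "\<phi> g x \<in> Q ` S" if "g \<in> carrier G" "x \<in> Q ` S" for g x
    proof -
      from Q_cases[OF that(2)] obtain c \<chi> p where x: "x = Q (c, \<chi>, p)" "(c, \<chi>, p) \<in> S" by metis
      show ?thesis unfolding x(1) \<phi>[OF that(1) x(2)] by (rule imageI[OF S_act[OF that(1) x(2)]])
    qed
    show "\<phi> g \<in> extensional (Q ` S)" if "g \<in> carrier G" for g using that by (simp add: \<phi>_def)
    show "\<phi> \<one>\<^bsub>G\<^esub> x = x" if "x \<in> Q ` S" for x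
    proof -
      from Q_cases[OF that] obtain c \<chi> p where x: "x = Q (c, \<chi>, p)" "(c, \<chi>, p) \<in> S" by metis
      then show ?thesis using \<phi>[OF G.one_closed x(2)] act_one[of \<chi> c] by (simp add: S_iff)
    qed
    show "\<phi> (g \<otimes>\<^bsub>G\<^esub> h) x = \<phi> g (\<phi> h x)" if "g \<in> carrier G" "h \<in> carrier G" "x \<in> Q ` S" for g h x
    proof -
      from Q_cases[OF that(3)] obtain c \<chi> p where x: "x = Q (c, \<chi>, p)" "(c, \<chi>, p) \<in> S" by metis
      then show ?thesis
        using \<phi>[OF G.m_closed[OF that(1,2)] x(2)] \<phi>[OF that(2) x(2)] \<phi>[OF that(1) S_act[OF that(2) x(2)]]
          act_mult[OF that(1,2), of \<chi> c] by (simp add: S_iff)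
    qed
  qed
  define X where "X = (Q ` S, \<phi>)"
  have "continuous_action G T (Q ` S, \<phi>)"
    unfolding continuous_iff
  proof (intro conjI act ballI)
    fix x assume "x \<in> Q ` S"
    from Q_cases[OF this] obtain c \<chi> p where x: "x = Q (c, \<chi>, p)" "(c, \<chi>, p) \<in> S" by metis
    show "\<exists>K\<in>B. \<forall>h\<in>K. \<phi> h x = x"
      by (rule bexI[OF _ fixator_in[of c \<chi>]]) (use x \<phi> in \<open>auto simp: S_iff fixator_iff\<close>)
  qed
  then have X: "X \<in> obj CG"
    using small_image[OF small_S, of Q] by (simp add: X_def obj_Cont \<phi>_def)
  define \<eta> where "\<eta> c p = (fob F c, X, \<lambda>\<chi>\<in>fst (fob F c). Q (c, \<chi>, p))" for c p
  have \<eta>: "\<eta> c p \<in> homs CG (fob F c) X" if c: "c \<in> obj C" and p: "p \<in> fob P c" for c p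
    unfolding \<eta>_def by (rule Cont_homsI[OF F_obj[OF c] X]) (use c p \<phi> in \<open>auto simp: X_def S_iff\<close>)
  have \<eta>_app: "gapp (\<eta> c p) \<chi> = Q (c, \<chi>, p)" if "c \<in> obj C" "\<chi> \<in> H c" for c p \<chi>
    using that by (simp add: \<eta>_def)
  have \<eta>_surj: "\<exists>p\<in>fob P c. \<eta> c p = m" if c: "c \<in> obj C" and m: "m \<in> homs CG (fob F c) X" for c m
  proof -
    obtain \<chi> where \<chi>: "\<chi> \<in> H c" using hom_ne[OF c] by blast
    have "gapp m \<chi> \<in> Q ` S" using gapp_homs[OF m, of \<chi>] \<chi> c by (simp add: X_def)
    from Q_cases[OF this] obtain d \<xi> q where q: "gapp m \<chi> = Q (d, \<xi>, q)" "d \<in> obj C" "\<xi> \<in> H d" "q \<in> fob P d"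
      using S_iff by metis
    obtain e \<zeta> f g where e: "e \<in> obj C" and \<zeta>: "\<zeta> \<in> H e" and f: "f \<in> homs C c e" and g: "g \<in> homs C d e"
      and r: "\<chi> = res \<zeta> f" "\<xi> = res \<zeta> g"
      using elements_dominate[OF c q(2) \<chi> q(3)] by blast
    define q' where "q' = app (far P g) q"
    have q': "q' \<in> fob P e" "gapp m \<chi> = Q (e, \<zeta>, q')"
      using Pin[OF g q(4)] Q_push[OF g \<zeta> q(4)] q(1) r(2) by (simp_all add: q'_def)
    have "\<exists>p\<in>fob P c. app (far P f) p = q'"
    proof (rule desc[OF f q'(1)])
      fix k h h' assume h: "h \<in> homs C e k" and h': "h' \<in> homs C e k" and eq: "cmp C h f = cmp C h' f"
      obtain \<omega> where \<omega>: "\<omega> \<in> H k" "res \<omega> h = \<zeta>" using extend[OF h \<zeta>] .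
      obtain a where a: "a \<in> carrier G" "cmp D a \<zeta> = res \<omega> h'" using transitive[OF e \<zeta> res_in[OF h' \<omega>(1)]] .
      have "cmp D a \<chi> = \<chi>"
        using act_res[OF a(1) \<zeta> f] a(2) r(1) res_cmp[OF f h' \<omega>(1)] res_cmp[OF f h \<omega>(1)] eq \<omega>(2) by simp
      then have "gapp m \<chi> = snd X a (gapp m \<chi>)" using gapp_act[OF m a(1), of \<chi>] a(1) \<chi> c by simp
      then have "Q (e, \<zeta>, q') = Q (e, cmp D a \<zeta>, q')"
        using \<phi>[OF a(1), of e \<zeta> q'] e \<zeta> q' by (simp add: X_def S_iff)
      then have "Q (e, res \<omega> h, q') = Q (e, res \<omega> h', q')" using a(2) \<omega>(2) by simp
      then have "Q (k, \<omega>, app (far P h) q') = Q (k, \<omega>, app (far P h') q')"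
        using Q_push[OF h \<omega>(1) q'(1)] Q_push[OF h' \<omega>(1) q'(1)] by simp
      then show "app (far P h) q' = app (far P h') q'"
        by (rule Q_inj[OF C.homs_obj(2)[OF h] \<omega>(1) Pin[OF h q'(1)] Pin[OF h' q'(1)]])
    qed
    then obtain p where p: "p \<in> fob P c" "app (far P f) p = q'" by blast
    have "gapp (\<eta> c p) \<chi> = gapp m \<chi>" using \<eta>_app[OF c \<chi>] Q_push[OF f \<zeta> p(1)] p(2) q'(2) r(1) by simp
    then have "\<eta> c p = m" by (rule F_hom_ext[OF c \<eta>[OF c p(1)] m \<chi>])
    then show ?thesis using p(1) by blast
  qed
  define \<eta>' where "\<eta>' = (\<lambda>c\<in>obj (opp C). (fob P c, fob (hom X) c, \<lambda>p\<in>fob P c. \<eta> c p))"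
  have nat: "(P, hom X, \<eta>') \<in> homs (PSh \<U> (opp C)) P (hom X)"
    unfolding \<eta>'_def
  proof (rule presheaf_homI)
    show "is_functor (opp (opp C)) (SetC \<U>) P" "is_functor (opp (opp C)) (SetC \<U>) (hom X)"
      using P is_functor_hom[OF X] by simp_all
    show "\<eta> c p \<in> fob (hom X) c" if "c \<in> obj (opp C)" "p \<in> fob P c" for c p
      using \<eta> that by (simp add: hom_simps(1))
    fix f d c p assume "f \<in> homs (opp C) d c" and p: "p \<in> fob P c"
    then have f: "f \<in> homs C c d" by simp
    note cd = C.homs_obj[OF f]
    obtain \<xi> where \<xi>: "\<xi> \<in> H d" using hom_ne[OF cd(2)] by blast
    have "\<eta> d (app (far P f) p) = cmp CG (\<eta> c p) (far F f)"
      by (rule F_hom_ext[OF cd(2) \<eta>[OF cd(2) Pin[OF f p]] CG.cmp_homs[OF F_ar(1)[OF f] \<eta>[OF cd(1) p]] \<xi>])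
        (simp add: gapp_res[OF f \<eta>[OF cd(1) p] \<xi>] \<eta>_app[OF cd(2) \<xi>] \<eta>_app[OF cd(1) res_in[OF f \<xi>]] Q_push[OF f \<xi> p])
    then show "\<eta> d (app (far P f) p) = app (far (hom X) f) (\<eta> c p)"
      using hom_simps(2)[OF f \<eta>[OF cd(1) p]] by simp
  qed
  have bij: "bij_betw (app (\<eta>' c)) (fob P c) (fob (hom X) c)" if "c \<in> obj (opp C)" for c
  proof -
    have c: "c \<in> obj C" using that by simp
    obtain \<chi> where \<chi>: "\<chi> \<in> H c" using hom_ne[OF c] by blast
    have "inj_on (\<eta> c) (fob P c)"
    proof (rule inj_onI)
      fix p p' assume p: "p \<in> fob P c" "p' \<in> fob P c" and eq: "\<eta> c p = \<eta> c p'"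
      show "p = p'"
        by (rule Q_inj[OF c \<chi> p]) (use eq \<eta>_app[OF c \<chi>, of p] \<eta>_app[OF c \<chi>, of p'] in simp)
    qed
    moreover have "\<eta> c ` fob P c = fob (hom X) c"
      unfolding hom_simps(1)[OF c] using \<eta>[OF c] \<eta>_surj[OF c] by blast
    moreover have "bij_betw (app (\<eta>' c)) (fob P c) (fob (hom X) c) \<longleftrightarrow> bij_betw (\<eta> c) (fob P c) (fob (hom X) c)"
      by (rule bij_betw_cong) (simp add: \<eta>'_def c)
    ultimately show ?thesis by (simp add: bij_betw_def)
  qed
  have "iso (PSh \<U> (opp C)) P (hom X) \<noteq> {}" by (rule presheaf_isoI[OF nat bij])
  then have "iso (PSh \<U> (opp C)) (hom X) P \<noteq> {}" unfolding iso_def by blast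
  then have "iso SH (fob \<Phi> X) P \<noteq> {}"
    using X sheaf hom_sheaf[OF X] by (simp add: Sh_def iso_full_sub hom_functor_simps(1))
  then show ?thesis using X by blast
qed

lemma equivalence: "is_equivalence CG SH \<Phi>"
  by (rule is_equivalenceI[OF is_functor_\<Phi> full_faithful essentially_surjective])

end

lemma embedding_ntrans: "\<exists>e :: 'v \<Rightarrow> ('v, 'v, 'v set, 'v sarr) ntrans. inj e"
  by (rule exI[of _ "\<lambda>v. (undefined, undefined, \<lambda>_. ({v}, {}, undefined))"]) (auto simp: inj_def dest: fun_cong)

lemma Ind_diagram:
  fixes C :: "('v, 'v) cat"
  assumes "category C" "universe \<U>" "arr C \<in> \<U>" "u \<in> obj (Ind \<U> C)"
  obtains I :: "('v, 'v) cat" and D \<tau> where "filtered_diagram \<U> C I D u \<tau>"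
proof -
  obtain I :: "('v, 'v) cat" and D \<tau> where "category I" "obj I \<in> \<U>" "filtered I" "is_functor I C D"
    "is_colimit I (PSh \<U> C) (comp_ftor I (yoneda C) D) u \<tau>"
    using assms(4) by (auto simp: Ind_def)
  then have "filtered_diagram \<U> C I D u \<tau>"
    using assms by (simp add: filtered_diagram_def filtered_diagram_axioms_def)
  then show thesis by (rule that)
qed

lemma homogeneous_Ind:
  assumes univ: "universe \<U>" and C: "category C" and obj: "obj C \<in> \<U>" and arr: "arr C \<in> \<U>" and ne: "obj C \<noteq> {}"
    and AP: "AP C" and u: "universal_obj C (Ind \<U> C) (yoneda C) u"
    and homog: "ultrahomogeneous C (Ind \<U> C) (yoneda C) u"
  shows "homogeneous \<U> C (Ind \<U> C) (yoneda C) u"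
proof -
  let ?D = "Ind \<U> C"
  have uD: "u \<in> obj ?D" and hne: "\<And>c. c \<in> obj C \<Longrightarrow> homs ?D (fob (yoneda C) c) u \<noteq> {}"
    using u by (auto simp: universal_obj_def)
  obtain I D \<tau> where "filtered_diagram \<U> C I D u \<tau>" using Ind_diagram[OF C univ arr uD] .
  then interpret filtered_diagram \<U> C I D u \<tau> .
  have Dhoms: "homs ?D (fob (yoneda C) c) u = homs (PSh \<U> C) (fob (yoneda C) c) u"
    and Dob: "fob (yoneda C) c \<in> obj ?D" if "c \<in> obj C" for c
    using hne[OF that] P.homs_obj by (auto simp: Ind_def homs_full_sub split: if_splits)
  have Dcmp: "cmp ?D = cmp (PSh \<U> C)" by (simp add: Ind_def)
  have E: "is_functor C ?D (yoneda C)"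
    using Dob unfolding Ind_def by (intro is_functor_full_sub[OF y.is_functor_axioms]) auto
  interpret E: is_functor C ?D "yoneda C" by (rule E)
  show ?thesis
  proof unfold_locales
    show "universe \<U>" "AP C" "ultrahomogeneous C ?D (yoneda C) u" by fact+
    show "obj C \<noteq> {}" by (rule ne)
    show "small \<U> (obj C)" by (rule small_in[OF obj])
    show "\<exists>e :: 'a \<Rightarrow> ('a, 'a, 'a set, 'a sarr) ntrans. inj e" by (rule embedding_ntrans)
    fix c assume c: "c \<in> obj C"
    then show "homs ?D (fob (yoneda C) c) u \<noteq> {}" by (rule hne)
    show "small \<U> (homs ?D (fob (yoneda C) c) u)"
      unfolding Dhoms[OF c]
    proof (rule small_inj_on)
      show "small \<U> (fob u c)" by (rule presheafD(1)[OF u_presheaf c])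
      show "inj_on (yel C c) (homs (PSh \<U> C) (fob (yoneda C) c) u)"
        by (rule inj_onI) (rule yel_inj[OF C _ _ c])
      show "yel C c ` homs (PSh \<U> C) (fob (yoneda C) c) u \<subseteq> fob u c" using yel_in[OF C _ c] by blast
    qed
  next
    fix a b \<chi> \<xi> assume "a \<in> obj C" "b \<in> obj C" "\<chi> \<in> homs ?D (fob (yoneda C) a) u" "\<xi> \<in> homs ?D (fob (yoneda C) b) u"
    then show "\<exists>e\<in>obj C. \<exists>\<zeta>\<in>homs ?D (fob (yoneda C) e) u. \<exists>f\<in>homs C a e. \<exists>g\<in>homs C b e.
        \<chi> = cmp ?D \<zeta> (far (yoneda C) f) \<and> \<xi> = cmp ?D \<zeta> (far (yoneda C) g)"
      using elements_dominate[of a b \<chi> \<xi>] by (simp add: Dhoms Dcmp)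
  next
    fix f a b g \<zeta> assume fg: "f \<in> homs C a b" "g \<in> homs C a b" and "\<zeta> \<in> homs ?D (fob (yoneda C) b) u"
      "cmp ?D \<zeta> (far (yoneda C) f) = cmp ?D \<zeta> (far (yoneda C) g)"
    then show "\<exists>e\<in>obj C. \<exists>h\<in>homs C b e. \<exists>\<zeta>'\<in>homs ?D (fob (yoneda C) e) u.
        \<zeta> = cmp ?D \<zeta>' (far (yoneda C) h) \<and> cmp C h f = cmp C h g"
      using elements_equalize[OF fg, of \<zeta>] C.homs_obj[OF fg(1)] by (simp add: Dhoms Dcmp)
  qed
qed

theorem theorem3p5:
  fixes \<U> :: "'v set set"
    and C :: "('v, 'v) cat"
    and u :: "('v, 'v, 'v set, 'v sarr) ftor"
  defines "D \<equiv> Ind \<U> C"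
  defines "G \<equiv> Aut D u"
    and "T \<equiv> Aut_topology C D (yoneda C) u"
    and "F \<equiv> orbit_functor C D (yoneda C) u"
  assumes "universe \<U>"
    and "category C" and "obj C \<in> \<U>" and "arr C \<in> \<U>" and "obj C \<noteq> {}"
    and "AP C" and "JEP C"
    and "universal_obj C D (yoneda C) u"
    and "ultrahomogeneous C D (yoneda C) u"
  shows "algebraic_base G (fixators C D (yoneda C) u) \<and>
    is_functor (opp C) (Cont_t \<U> G T) F \<and>
    is_equivalence (Cont \<U> G T) (Sh \<U> (opp C) (atomic_topology (opp C)))
      (hom_functor (opp C) (Cont \<U> G T) F)"
proof -
  interpret homogeneous \<U> C D "yoneda C" u
    unfolding D_def by (rule homogeneous_Ind) (use assms in \<open>simp_all add: D_def\<close>)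
  show ?thesis unfolding G_def T_def F_def
    using base is_functor_F_transitive equivalence by blast
qed

end
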